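(* Let $n\ge1$ and $0\le p\le 2n+1$. Let $cl(\mathcal M_{p,2n+1-p})$ be the closure in $L^2(Mp(n,\mathbb R))$ of the linear span $\mathcal M_{p,2n+1-p}$ of the matrix coefficients $g\mapsto(\omega_{p,2n+1-p}(g)u,v)$, $u,v\in\mathcal P_{p,2n+1-p}$. There exists a set $B_{p,2n+1-p}$ of elements of $\mathcal P_{p,2n+1-p}\otimes\mathcal P_{p,2n+1-p}$ such that $\{M_{\omega_{p,2n+1-p}}(b)\}_{b\in B_{p,2n+1-p}}$ is an orthonormal basis of $cl(\mathcal M_{p,2n+1-p})$. In particular, each $M_{\omega_{p,2n+1-p}}(b)$ is bounded by a constant multiple of $|\Lambda(g)|^{2n+1}$.
   Context: $J=\begin{pmatrix}0&I_n\\-I_n&0\end{pmatrix}$, $Sp(n,\mathbb R)=\{g\in GL(2n,\mathbb R): g^tJg=J\}$; $Sp(n,\mathbb R)\cap O(2n)$ is identified with $U(n)$ by $\begin{pmatrix}A&B\\-B&A\end{pmatrix}\leftrightarrow A+iB$. For $g=\begin{pmatrix}A&B\\C&D\end{pmatrix}$ put $C_g^{\mathbb C}=\frac{A+D}2+i\frac{B-C}2$. $Mp(n,\mathbb R)=\{(\lambda,g): g\in Sp(n,\mathbb R),\ \lambda^2\det C_g^{\mathbb C}=1\}$ is the connected double cover with identity $(1,I)$, and $\Lambda(\lambda,g)=\lambda$. For $g=k_1\exp(H)k_2$ with $k_1,k_2\in U(n)$, $H=\mathrm{diag}(\lambda_1,\dots,\lambda_n,-\lambda_1,\dots,-\lambda_n)$,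 $H^{\mathbb C}=\mathrm{diag}(\lambda_1,\dots,\lambda_n)$, put $$\mathcal H(g)=\begin{pmatrix}\overline{k_1}&0\\0&\overline{k_2}^t\end{pmatrix}\begin{pmatrix}\tanh H^{\mathbb C}&-i\,\mathrm{sech}\,H^{\mathbb C}\\-i\,\mathrm{sech}\,H^{\mathbb C}&\tanh H^{\mathbb C}\end{pmatrix}\begin{pmatrix}k_1^{-1}&0\\0&\overline{k_2}\end{pmatrix}.$$ Let $d\mu(z)=\exp(-\frac12\|z\|^2)dz$ on $\mathbb C^n$ (total mass 1), $\mathcal P_n$ the polynomials on $\mathbb C^n$, $\mathcal F_n$ the completion of $\mathcal P_n$ under $(f,h)=\int f\overline h\,d\mu$. The oscillator representation on $\mathcal F_n$ is $$\omega(\lambda,g)f(z)=\int_{\mathbb C^n}\lambda\exp\Big(\tfrac14(iz^t,\overline w^t)\mathcal H(g)\begin{pmatrix}iz\\\overline w\end{pmatrix}\Big)f(w)\,d\mu(w).$$ $\omega^c$ is $\omega$ with conjugate scalar multiplication and inner product $(u,v)_{\omega^c}=(v,u)_\omega$; $\mathcal P_n^c$ is $\mathcal P_n$ with conjugate scalar multiplication; $\omega_{p,q}=(\otimes^p\omega)\otimes(\otimes^q\omega^c)$, $\mathcal P_{p,q}=(\otimes^p\mathcal P_n)\otimes(\otimes^q\mathcal P_n^c)$. For a finite sum $b=\sum_i u_i\otimes v_i$, $M_{\omega_{p,q}}(b)(g)=\sum_i(\omega_{p,q}(g)u_i,v_i)$ (the second tensor factor is taken with conjugate scalar multiplication, so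 that this is well defined). *)

theory Defs
  imports
    "HOL-Analysis.Analysis"
    "HOL-Library.Poly_Mapping"
    "HOL-Algebra.Group"
begin

section \<open>The symplectic group and the metaplectic group\<close>

text \<open>A \<open>2n \<times> 2n\<close> matrix is indexed by \<open>'n + 'n\<close> with \<open>n = CARD('n)\<close>.\<close>

type_synonym 'n symat = "real^('n + 'n)^('n + 'n)"
type_synonym 'n mpair = "complex \<times> (real^('n + 'n)^('n + 'n))"

definition block :: "'a^'n^'n \<Rightarrow> 'a^'n^'n \<Rightarrow> 'a^'n^'n \<Rightarrow> 'a^'n^'n \<Rightarrow> 'a^('n + 'n)^('n + 'n)" where
  "block A B C D = (\<chi> i j. case i of
      Inl a \<Rightarrow> (case j of Inl b \<Rightarrow> A $ a $ b | Inr b \<Rightarrow> B $ a $ b)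
    | Inr a \<Rightarrow> (case j of Inl b \<Rightarrow> C $ a $ b | Inr b \<Rightarrow> D $ a $ b))"

definition diagm :: "('n \<Rightarrow> 'a::zero) \<Rightarrow> 'a^'n^'n" where
  "diagm d = (\<chi> i j. if i = j then d i else 0)"

definition Jmat :: "'n::finite symat" where
  "Jmat = block 0 (mat 1) (- mat 1) 0"

definition Sp :: "'n::finite symat set" where
  "Sp = {g. invertible g \<and> transpose g ** Jmat ** g = Jmat}"

definition cpart :: "'n symat \<Rightarrow> complex^'n^'n" where
  "cpart g = (\<chi> i j. Complex ((g $ Inl i $ Inl j + g $ Inr i $ Inr j) / 2)
                              ((g $ Inl i $ Inr j - g $ Inr i $ Inl j) / 2))"

definition Mp :: "'n::finite mpair set" where
  "Mp = {(l, g). g \<in> Sp \<and> l\<^sup>2 * det (cpart g) = 1}"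

text \<open>
  The group law of \<open>Mp\<close>: the topological group structure with identity \<open>(1, I)\<close> for which
  \<open>(l, g) \<mapsto> g\<close> is a homomorphism.  As \<open>Mp\<close> is a connected cover of \<open>Sp\<close>, these requirements
  determine the law on \<open>Mp\<close> uniquely (unique lifting of \<open>(x, y) \<mapsto> g\<^sub>x g\<^sub>y\<close>).
\<close>

definition metaplectic_law ::
  "('n::finite mpair \<Rightarrow> 'n mpair \<Rightarrow> 'n mpair) \<Rightarrow> bool" where
  "metaplectic_law m \<longleftrightarrow>
     group \<lparr>carrier = Mp, monoid.mult = m, one = (1, mat 1)\<rparr> \<and>
     continuous_on (Mp \<times> Mp) (\<lambda>(x, y). m x y) \<and>
     (\<forall>x\<in>Mp. \<forall>y\<in>Mp. snd (m x y) = snd x ** snd y)"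

text \<open>
  \<open>Mp\<close> is closed in its ambient Euclidean space, hence locally compact and second countable, so
  that Borel measures finite on compact sets are automatically regular.
\<close>

definition haar_measure ::
  "('n::finite mpair \<Rightarrow> 'n mpair \<Rightarrow> 'n mpair) \<Rightarrow>
   'n mpair measure \<Rightarrow> bool" where
  "haar_measure m M \<longleftrightarrow>
     sets M = sets (restrict_space borel Mp) \<and>
     (\<forall>x\<in>Mp. \<forall>A\<in>sets M. emeasure M (m x ` A) = emeasure M A) \<and>
     (\<forall>K. compact K \<and> K \<subseteq> Mp \<longrightarrow> emeasure M K < \<infinity>) \<and>
     emeasure M Mp \<noteq> 0"

section \<open>The matrix \<open>\<H>(g)\<close>\<close>

definition maxcompact :: "'n::finite symat set" where
  "maxcompact = Sp \<inter> {k. orthogonal_matrix k}"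

definition unitary_of :: "'n symat \<Rightarrow> complex^'n^'n" where
  "unitary_of k = (\<chi> i j. Complex (k $ Inl i $ Inl j) (k $ Inl i $ Inr j))"

definition conjm :: "complex^'n^'m \<Rightarrow> complex^'n^'m" where
  "conjm X = (\<chi> i j. cnj (X $ i $ j))"

text \<open>\<open>exp H\<close> for \<open>H = diag(t\<^sub>1, \<dots>, t\<^sub>n, -t\<^sub>1, \<dots>, -t\<^sub>n)\<close>\<close>

definition expH :: "real^'n \<Rightarrow> 'n symat" where
  "expH t = block (diagm (\<lambda>i. exp (t $ i))) 0 0 (diagm (\<lambda>i. exp (- (t $ i))))"

text \<open>
  The value does not depend on the decomposition \<open>g = k\<^sub>1 exp(H) k\<^sub>2\<close>: e.g. the upper right block
  is \<open>-\<i>\<close> times the transposed inverse of \<open>cpart g\<close>.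
\<close>

definition calH :: "'n::finite symat \<Rightarrow> complex^('n + 'n)^('n + 'n)" where
  "calH g = (SOME X. \<exists>k1\<in>maxcompact. \<exists>k2\<in>maxcompact. \<exists>t :: real^'n.
     g = k1 ** expH t ** k2 \<and>
     X = block (conjm (unitary_of k1)) 0 0 (transpose (conjm (unitary_of k2)))
       ** block (diagm (\<lambda>i. of_real (tanh (t $ i)))) (diagm (\<lambda>i. - \<i> * of_real (1 / cosh (t $ i))))
                (diagm (\<lambda>i. - \<i> * of_real (1 / cosh (t $ i)))) (diagm (\<lambda>i. of_real (tanh (t $ i))))
       ** block (matrix_inv (unitary_of k1)) 0 0 (conjm (unitary_of k2)))"

section \<open>The oscillator representation on Fock space\<close>

text \<open>Lebesgue measure is normalised so that the total mass is \<open>1\<close>.\<close>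

definition gauss :: "(complex^'n::finite) measure" where
  "gauss = density lborel (\<lambda>z. ennreal (exp (- (norm z)\<^sup>2 / 2) / (2 * pi) ^ CARD('n)))"

definition fock_inner :: "(complex^'n::finite \<Rightarrow> complex) \<Rightarrow> (complex^'n \<Rightarrow> complex) \<Rightarrow> complex" where
  "fock_inner f h = (\<integral>z. f z * cnj (h z) \<partial>gauss)"

definition polys :: "(complex^'n::finite \<Rightarrow> complex) set" where
  "polys = {f. \<exists>(S :: ('n \<Rightarrow> nat) set) c. finite S \<and>
                 f = (\<lambda>z. \<Sum>\<alpha>\<in>S. c \<alpha> * (\<Prod>i\<in>UNIV. (z $ i) ^ \<alpha> i))}"

text \<open>
  The completion of the polynomials, realised as a space of functions.  Evaluation at a point is
  bounded on polynomials, so norm convergence implies pointwise convergence, and asking for both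
  picks the (entire) representative of each limit in \<open>L\<^sup>2(gauss)\<close>.
\<close>

definition fock :: "(complex^'n::finite \<Rightarrow> complex) set" where
  "fock = {f. \<exists>h :: nat \<Rightarrow> complex^'n \<Rightarrow> complex. (\<forall>k. h k \<in> polys) \<and>
                (\<forall>z. (\<lambda>k. h k z) \<longlonglongrightarrow> f z) \<and>
                (\<lambda>k. \<integral>\<^sup>+z. ennreal ((norm (h k z - f z))\<^sup>2) \<partial>gauss) \<longlonglongrightarrow> 0}"

definition stack :: "'a^'n \<Rightarrow> 'a^'n \<Rightarrow> 'a^('n + 'n)" where
  "stack a b = (\<chi> i. case i of Inl k \<Rightarrow> a $ k | Inr k \<Rightarrow> b $ k)"

definition bilin :: "'a::comm_semiring_0^'m^'m \<Rightarrow> 'a^'m \<Rightarrow> 'a" where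
  "bilin X v = (\<Sum>i\<in>UNIV. \<Sum>j\<in>UNIV. v $ i * X $ i $ j * v $ j)"

definition omega :: "'n::finite mpair \<Rightarrow>
    (complex^'n \<Rightarrow> complex) \<Rightarrow> complex^'n \<Rightarrow> complex" where
  "omega x f z = (\<integral>w. fst x *
     exp (1/4 * bilin (calH (snd x)) (stack (\<chi> i. \<i> * z $ i) (\<chi> i. cnj (w $ i)))) * f w \<partial>gauss)"

section \<open>Algebraic tensor products of complex vector spaces\<close>

record 'v cspace =
  vecs :: "'v set"
  vadd :: "'v \<Rightarrow> 'v \<Rightarrow> 'v"
  vscale :: "complex \<Rightarrow> 'v \<Rightarrow> 'v"

definition conj_space :: "'v cspace \<Rightarrow> 'v cspace" where
  "conj_space V = V\<lparr>vscale := (\<lambda>c. vscale V (cnj c))\<rparr>"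

definition fun_space :: "('x \<Rightarrow> complex) set \<Rightarrow> ('x \<Rightarrow> complex) cspace" where
  "fun_space S = \<lparr>vecs = S, vadd = (\<lambda>f h x. f x + h x), vscale = (\<lambda>c f x. c * f x)\<rparr>"

text \<open>
  The tensor product of a finite family is the free complex vector space on the tuples of vectors,
  modulo the multilinear relations.  Its elements are cosets of finitely supported functions.
\<close>

definition tuples :: "'i set \<Rightarrow> ('i \<Rightarrow> 'v cspace) \<Rightarrow> ('i \<Rightarrow> 'v) set" where
  "tuples I V = (\<Pi>\<^sub>E i\<in>I. vecs (V i))"

definition free_vecs :: "'i set \<Rightarrow> ('i \<Rightarrow> 'v cspace) \<Rightarrow> (('i \<Rightarrow> 'v) \<Rightarrow>\<^sub>0 complex) set" where
  "free_vecs I V = {a. Poly_Mapping.keys a \<subseteq> tuples I V}"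

inductive_set multilinear_rels :: "'i set \<Rightarrow> ('i \<Rightarrow> 'v cspace) \<Rightarrow> (('i \<Rightarrow> 'v) \<Rightarrow>\<^sub>0 complex) set"
  for I :: "'i set" and V :: "'i \<Rightarrow> 'v cspace" where
  zero: "0 \<in> multilinear_rels I V"
| plus: "a \<in> multilinear_rels I V \<Longrightarrow> b \<in> multilinear_rels I V \<Longrightarrow> a + b \<in> multilinear_rels I V"
| scale: "a \<in> multilinear_rels I V \<Longrightarrow> Poly_Mapping.map ((*) c) a \<in> multilinear_rels I V"
| additive: "x \<in> tuples I V \<Longrightarrow> i \<in> I \<Longrightarrow> u \<in> vecs (V i) \<Longrightarrow> w \<in> vecs (V i) \<Longrightarrow>
    Poly_Mapping.single (x(i := vadd (V i) u w)) 1
      - Poly_Mapping.single (x(i := u)) 1 - Poly_Mapping.single (x(i := w)) 1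
    \<in> multilinear_rels I V"
| homogeneous: "x \<in> tuples I V \<Longrightarrow> i \<in> I \<Longrightarrow> u \<in> vecs (V i) \<Longrightarrow>
    Poly_Mapping.single (x(i := vscale (V i) c u)) 1 - Poly_Mapping.single (x(i := u)) c
    \<in> multilinear_rels I V"

definition tensor_class :: "'i set \<Rightarrow> ('i \<Rightarrow> 'v cspace) \<Rightarrow>
    (('i \<Rightarrow> 'v) \<Rightarrow>\<^sub>0 complex) \<Rightarrow> (('i \<Rightarrow> 'v) \<Rightarrow>\<^sub>0 complex) set" where
  "tensor_class I V a = {b \<in> free_vecs I V. a - b \<in> multilinear_rels I V}"

definition tensor_space :: "'i set \<Rightarrow> ('i \<Rightarrow> 'v cspace) \<Rightarrow> (('i \<Rightarrow> 'v) \<Rightarrow>\<^sub>0 complex) set cspace" where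
  "tensor_space I V =
     \<lparr>vecs = tensor_class I V ` free_vecs I V,
      vadd = (\<lambda>A B. \<Union>a\<in>A. \<Union>b\<in>B. tensor_class I V (a + b)),
      vscale = (\<lambda>c A. \<Union>a\<in>A. tensor_class I V (Poly_Mapping.map ((*) c) a))\<rparr>"

text \<open>The linear functional on the tensor product induced by a multilinear \<open>\<phi>\<close>.\<close>

definition tensor_lift :: "(('i \<Rightarrow> 'v) \<Rightarrow> complex) \<Rightarrow> (('i \<Rightarrow> 'v) \<Rightarrow>\<^sub>0 complex) set \<Rightarrow> complex" where
  "tensor_lift \<phi> A = (let a = (SOME a. a \<in> A) in \<Sum>x\<in>Poly_Mapping.keys a. Poly_Mapping.lookup a x * \<phi> x)"

definition tensor2 :: "'v cspace \<Rightarrow> 'v cspace \<Rightarrow> ((bool \<Rightarrow> 'v) \<Rightarrow>\<^sub>0 complex) set cspace" where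
  "tensor2 V W = tensor_space UNIV (\<lambda>i. if i then W else V)"

section \<open>Mixed tensor powers of the oscillator representation and their matrix coefficients\<close>

definition factors :: "nat \<Rightarrow> 'v cspace \<Rightarrow> nat \<Rightarrow> 'v cspace" where
  "factors p V k = (if k < p then V else conj_space V)"

definition mixed_tensors :: "nat \<Rightarrow> nat \<Rightarrow> 'v cspace \<Rightarrow> ((nat \<Rightarrow> 'v) \<Rightarrow>\<^sub>0 complex) set cspace" where
  "mixed_tensors p q V = tensor_space {..<p + q} (factors p V)"

type_synonym 'n tens = "((nat \<Rightarrow> (complex^'n \<Rightarrow> complex)) \<Rightarrow>\<^sub>0 complex) set"

definition polys_pq :: "nat \<Rightarrow> nat \<Rightarrow>
    'n::finite tens cspace" where
  "polys_pq p q = mixed_tensors p q (fun_space polys)"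

text \<open>
  \<open>\<omega>\<^sub>p\<^sub>,\<^sub>q(x)\<close>, with values in the algebraic tensor product of Fock spaces.  On the last \<open>q\<close>
  factors the operator is again \<open>\<omega>(x)\<close>; only the scalar multiplication of the space is conjugated.
\<close>

definition omega_pq :: "nat \<Rightarrow> nat \<Rightarrow> 'n::finite mpair \<Rightarrow>
    'n tens \<Rightarrow> 'n tens" where
  "omega_pq p q x U = (\<Union>a\<in>U. tensor_class {..<p + q} (factors p (fun_space fock))
     (\<Sum>u\<in>Poly_Mapping.keys a. Poly_Mapping.single (\<lambda>k\<in>{..<p + q}. omega x (u k)) (Poly_Mapping.lookup a u)))"

text \<open>
  The inner product on tensors, linear in the first and conjugate linear in the second argument;
  on the last \<open>q\<close> factors it is \<open>(u, v) \<mapsto> (v, u)\<close>.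
\<close>

definition inner_pq :: "nat \<Rightarrow> nat \<Rightarrow>
    'n::finite tens \<Rightarrow> 'n tens \<Rightarrow> complex" where
  "inner_pq p q U V =
     tensor_lift (\<lambda>u. cnj (tensor_lift (\<lambda>v. cnj (\<Prod>k<p + q.
        if k < p then fock_inner (u k) (v k) else fock_inner (v k) (u k))) V)) U"

definition matcoeff :: "nat \<Rightarrow> nat \<Rightarrow>
    ((bool \<Rightarrow> 'n::finite tens) \<Rightarrow>\<^sub>0 complex) set \<Rightarrow>
    'n mpair \<Rightarrow> complex" where
  "matcoeff p q b x = tensor_lift (\<lambda>t. inner_pq p q (omega_pq p q x (t False)) (t True)) b"

definition cspan :: "('x \<Rightarrow> complex) set \<Rightarrow> ('x \<Rightarrow> complex) set" where
  "cspan S = {f. \<exists>T c. finite T \<and> T \<subseteq> S \<and> f = (\<lambda>x. \<Sum>h\<in>T. c h * h x)}"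

definition coeff_span :: "nat \<Rightarrow> nat \<Rightarrow> ('n::finite mpair \<Rightarrow> complex) set" where
  "coeff_span p q = cspan {\<lambda>x. inner_pq p q (omega_pq p q x u) v | u v.
     u \<in> vecs (polys_pq p q) \<and> v \<in> vecs (polys_pq p q)}"

section \<open>Square integrable functions\<close>

definition L2 :: "'x measure \<Rightarrow> ('x \<Rightarrow> complex) set" where
  "L2 M = {f \<in> borel_measurable M. integrable M (\<lambda>x. (norm (f x))\<^sup>2)}"

definition L2_inner :: "'x measure \<Rightarrow> ('x \<Rightarrow> complex) \<Rightarrow> ('x \<Rightarrow> complex) \<Rightarrow> complex" where
  "L2_inner M f h = (\<integral>x. f x * cnj (h x) \<partial>M)"

definition L2_closure :: "'x measure \<Rightarrow> ('x \<Rightarrow> complex) set \<Rightarrow> ('x \<Rightarrow> complex) set" where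
  "L2_closure M S = {f \<in> L2 M. \<forall>e>0. \<exists>h\<in>S. (\<integral>\<^sup>+x. ennreal ((norm (f x - h x))\<^sup>2) \<partial>M) < ennreal e}"

text \<open>\<open>(F b)\<close> for \<open>b \<in> B\<close> is an orthonormal basis of the closed subspace \<open>W\<close> of \<open>L\<^sup>2(M)\<close>.\<close>

definition orthonormal_basis :: "'x measure \<Rightarrow> ('b \<Rightarrow> 'x \<Rightarrow> complex) \<Rightarrow> 'b set \<Rightarrow> ('x \<Rightarrow> complex) set \<Rightarrow> bool" where
  "orthonormal_basis M F B W \<longleftrightarrow>
     F ` B \<subseteq> W \<and>
     (\<forall>b\<in>B. \<forall>b'\<in>B. L2_inner M (F b) (F b') = (if b = b' then 1 else 0)) \<and>
     L2_closure M (cspan (F ` B)) = W"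

end

theory Submission
  imports Defs "HOL-Probability.Distributions"
begin

text \<open>
  By the Cartan decomposition the quadratic form of \<open>calH g\<close> is bounded by \<open>|v|\<^sup>2\<close>.  Hence
  \<open>omega (l, g)\<close> maps a polynomial to a polynomial times the exponential of a quadratic form, which
  lies in Fock space, and the matrix coefficients of \<open>omega\<close> are \<open>O(|l|)\<close>.  Those of a tensor
  product of \<open>2n + 1\<close> factors are \<open>O(|l|\<^sup>2\<^sup>n\<^sup>+\<^sup>1)\<close>, so that they are square integrable once
  \<open>|l|\<^sup>2\<^sup>(\<^sup>2\<^sup>n\<^sup>+\<^sup>1\<^sup>) = |det P|\<^sup>-\<^sup>(\<^sup>2\<^sup>n\<^sup>+\<^sup>1\<^sup>)\<close>, with \<open>P = cpart g\<close>, is integrable for the Haar measure.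

  For this let \<open>g\<close> act on the Siegel disc of symmetric contractions \<open>S\<close>, and let \<open>k(g, S) = 1\<close> if
  \<open>S\<close> lies in the image of a fixed small ball and \<open>k(g, S) = 0\<close> otherwise.  For fixed \<open>S\<close> the set
  of all \<open>g\<close> with \<open>k(g, S) = 1\<close> is empty or a left translate of a subset of a fixed compact set, so
  its measure is bounded.  For fixed \<open>g\<close>, the image contains a set of volume of order
  \<open>|det P|\<^sup>-\<^sup>(\<^sup>2\<^sup>n\<^sup>+\<^sup>2\<^sup>)\<close> on which \<open>det (1 - S S\<^sup>*)\<^sup>-\<^sup>1\<^sup>/\<^sup>2\<close> is at least of order \<open>|det P|\<close>.  The function
  \<open>det (1 - S S\<^sup>*)\<^sup>-\<^sup>1\<^sup>/\<^sup>2\<close> is integrable over the disc, and Fubini's theorem for its product with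
  \<open>k\<close> gives the claim.  An antisymmetric part is adjoined to \<open>S\<close> only in order to integrate over
  all matrices.

  The coefficients of tensors of monomials form a countable spanning family, to which Gram-Schmidt
  orthonormalisation applies.
\<close>

section \<open>Structure of the symplectic group\<close>

section \<open>Complex matrices\<close>

text \<open>The exponent 2n + 1 results from one balance. The image of the ball has size about
  \<open>1 / (cosh (t $ i) * cosh (t $ j))\<close> in the complex direction of the symmetric entry
  (i, j); over all pairs and both real directions this gives 2n + 2. The weight gives one power
  back: plain volume would only show that \<open>|det P|^-(2n+2)\<close> is integrable. As a
  Gaussian integral, the weight can be integrated over the disc without handling determinants: after
  exchanging the integrals, a unitary rotation of \<open>z\<close> leaves one matrix entry, and the
  disc is sliced by the distance of that entry from 1. The Haar measure enters through left
  invariance and finiteness on compact sets, so no density in Cartan coordinates has to be computed.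
  Identities between matrix coefficients are available on \<open>Mp\<close> only, and elements of
  \<open>L2\<close> are functions rather than classes. This is why spans are compared on
  \<open>Mp\<close> or almost everywhere, and why the basis is indexed by tensors and not by
  functions.\<close>

lemma norm_vec_sq: "(norm x)\<^sup>2 = (\<Sum>i\<in>UNIV. (norm (x $ i))\<^sup>2)"
  for x :: "'a::real_normed_vector ^ 'n::finite"
  by (simp add: norm_vec_def L2_set_def sum_nonneg)

lemma conjm_nth [simp]: "conjm A $ i $ j = cnj (A $ i $ j)"
  by (simp add: conjm_def)

lemma conjm_mult: "conjm (A ** B) = conjm A ** conjm B"
  by (simp add: matrix_matrix_mult_def vec_eq_iff)

lemma conjm_conjm [simp]: "conjm (conjm A) = A"
  by (simp add: vec_eq_iff)

lemma conjm_transpose: "conjm (transpose A) = transpose (conjm A)"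
  by (simp add: vec_eq_iff transpose_def)

lemma conjm_mat_1 [simp]: "conjm (mat 1) = mat 1"
  by (simp add: vec_eq_iff mat_def)

lemma norm_conjm [simp]: "norm (conjm A) = norm A"
  by (simp add: norm_vec_def)

lemma norm_transpose [simp]: "norm (transpose A) = norm A" for A :: "complex^'n::finite^'m::finite"
proof (rule power2_eq_imp_eq)
  show "(norm (transpose A))\<^sup>2 = (norm A)\<^sup>2"
    by (simp add: norm_vec_sq transpose_def sum.swap[of _ "UNIV :: 'n set"])
qed auto

definition unitarym :: "complex^'n^'n \<Rightarrow> bool" where
  "unitarym u \<longleftrightarrow> transpose (conjm u) ** u = mat 1"

lemma unitarym_right: "unitarym u \<Longrightarrow> u ** transpose (conjm u) = mat 1" for u :: "complex^'n::finite^'n"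
  by (simp add: unitarym_def matrix_left_right_inverse)

lemma unitarym_conjm: "unitarym u \<Longrightarrow> unitarym (conjm u)"
  unfolding unitarym_def by (metis conjm_conjm conjm_mat_1 conjm_mult conjm_transpose)

lemma unitarym_transpose: "unitarym u \<Longrightarrow> unitarym (transpose u)" for u :: "complex^'n::finite^'n"
  unfolding unitarym_def
  by (metis conjm_transpose matrix_left_right_inverse matrix_transpose_mul transpose_mat transpose_transpose)

lemma unitarym_adjoint: "unitarym u \<Longrightarrow> unitarym (transpose (conjm u))" for u :: "complex^'n::finite^'n"
  by (simp add: unitarym_conjm unitarym_transpose)

lemma matrix_inv_unique: "A ** B = mat 1 \<Longrightarrow> matrix_inv A = B" for A :: "'a::field^'n::finite^'n"
proof -
  assume *: "A ** B = mat 1"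
  then have "B ** A = mat 1" by (simp add: matrix_left_right_inverse)
  with * have "invertible A" by (auto simp: invertible_def)
  then have "matrix_inv A ** A = mat 1"
    by (metis (mono_tags, lifting) invertible_def matrix_inv_def someI_ex)
  then have "matrix_inv A ** A ** B = B" by simp
  then show ?thesis using * by (metis matrix_mul_assoc matrix_mul_rid)
qed

lemma unitarym_matrix_inv: "unitarym u \<Longrightarrow> matrix_inv u = transpose (conjm u)"
  for u :: "complex^'n::finite^'n"
  by (simp add: matrix_inv_unique unitarym_right)

lemma unitarym_norm_vector:
  fixes u :: "complex^'n::finite^'n"
  assumes "unitarym u" shows "norm (u *v x) = norm x"
proof -
  have sq: "complex_of_real ((norm x)\<^sup>2) = (\<Sum>i\<in>UNIV. cnj (x $ i) * x $ i)" for x :: "complex^'n"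
    by (simp add: norm_vec_sq complex_norm_square[symmetric] mult.commute[of "cnj _"])
  have orth: "(\<Sum>i\<in>UNIV. cnj (u $ i $ j) * u $ i $ k) = (if j = k then 1 else 0)" for j k
    using arg_cong[OF assms[unfolded unitarym_def], of "\<lambda>A. A $ j $ k"]
    by (simp add: matrix_matrix_mult_def transpose_def mat_def)
  have "complex_of_real ((norm (u *v x))\<^sup>2)
      = (\<Sum>i\<in>UNIV. \<Sum>j\<in>UNIV. \<Sum>k\<in>UNIV. cnj (u $ i $ j) * u $ i $ k * (cnj (x $ j) * x $ k))"
  proof -
    have "cnj ((u *v x) $ i) * (u *v x) $ i = (\<Sum>j\<in>UNIV. \<Sum>k\<in>UNIV. (cnj (u $ i $ j) * cnj (x $ j)) * (u $ i $ k * x $ k))" for i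
      by (simp add: matrix_vector_mult_def sum_product)
    then show ?thesis unfolding sq by (simp only: mult_ac)
  qed
  also have "\<dots> = (\<Sum>j\<in>UNIV. \<Sum>k\<in>UNIV. \<Sum>i\<in>UNIV. cnj (u $ i $ j) * u $ i $ k * (cnj (x $ j) * x $ k))"
    by (subst sum.swap, rule sum.cong[OF refl], rule sum.swap)
  also have "\<dots> = (\<Sum>j\<in>UNIV. \<Sum>k\<in>UNIV. (if j = k then 1 else 0) * (cnj (x $ j) * x $ k))"
    by (simp only: sum_distrib_right[symmetric] orth)
  also have "\<dots> = complex_of_real ((norm x)\<^sup>2)"
    unfolding sq by (simp add: if_distrib[of "\<lambda>y. y * _"] sum.delta cong: if_cong)
  finally have "(norm (u *v x))\<^sup>2 = (norm x)\<^sup>2"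
    using of_real_eq_iff by blast
  then show ?thesis by simp
qed

text \<open>The norm of a matrix, taken as a vector of rows, is the Hilbert-Schmidt norm; read by
  columns it turns claims about \<open>A ** B\<close> into claims about
  \<open>A *v column j B\<close>.\<close>

lemma norm_matrix_sq_columns: "(norm A)\<^sup>2 = (\<Sum>j\<in>UNIV. (norm (column j A))\<^sup>2)"
  for A :: "complex^'n::finite^'m::finite"
  by (simp add: norm_vec_sq column_def sum.swap[of _ "UNIV :: 'n set"])

lemma column_matrix_mult: "column j (A ** B) = A *v column j B"
  by (simp add: vec_eq_iff column_def matrix_matrix_mult_def matrix_vector_mult_def)

lemma norm_unitarym_mult_left: "unitarym u \<Longrightarrow> norm (u ** A) = norm A"
  for u :: "complex^'n::finite^'n" and A :: "complex^'m::finite^'n"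
  by (rule power2_eq_imp_eq)
    (simp_all only: norm_matrix_sq_columns column_matrix_mult unitarym_norm_vector norm_ge_zero)

lemma norm_unitarym_mult_right: "unitarym u \<Longrightarrow> norm (A ** u) = norm A"
  for u :: "complex^'n::finite^'n" and A :: "complex^'n::finite^'m::finite"
  by (metis matrix_transpose_mul norm_transpose norm_unitarym_mult_left unitarym_transpose)

lemma norm_matrix_vector_mult_le: "norm (A *v x) \<le> norm A * norm x"
  for A :: "complex^'n::finite^'m::finite"
proof -
  have row: "norm ((A *v x) $ i) \<le> norm (A $ i) * norm x" for i
  proof -
    have "norm ((A *v x) $ i) \<le> (\<Sum>j\<in>UNIV. norm (A $ i $ j) * norm (x $ j))"
      by (auto simp: matrix_vector_mult_def norm_mult intro!: order_trans[OF norm_sum] sum_mono)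
    also have "\<dots> \<le> norm (A $ i) * norm x"
      using L2_set_mult_ineq[of "\<lambda>j. norm (A $ i $ j)" "\<lambda>j. norm (x $ j)" UNIV]
      by (simp add: norm_vec_def)
    finally show ?thesis .
  qed
  have "(norm (A *v x))\<^sup>2 \<le> (\<Sum>i\<in>UNIV. (norm (A $ i) * norm x)\<^sup>2)"
    unfolding norm_vec_sq[of "A *v x"] by (intro sum_mono power_mono row) auto
  also have "\<dots> = (norm A * norm x)\<^sup>2"
    by (simp add: norm_vec_sq[of A] power_mult_distrib sum_distrib_right)
  finally show ?thesis by (rule power2_le_imp_le) auto
qed

lemma norm_matrix_mult_le: "norm (A ** B) \<le> norm A * norm B"
  for A :: "complex^'n::finite^'m::finite" and B :: "complex^'k::finite^'n"
proof -
  have "(norm (A ** B))\<^sup>2 \<le> (\<Sum>j\<in>UNIV. (norm A * norm (column j B))\<^sup>2)"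
    unfolding norm_matrix_sq_columns[of "A ** B"] column_matrix_mult
    by (intro sum_mono power_mono norm_matrix_vector_mult_le) auto
  also have "\<dots> = (norm A * norm B)\<^sup>2"
    by (simp add: norm_matrix_sq_columns[of B] power_mult_distrib sum_distrib_left)
  finally show ?thesis by (rule power2_le_imp_le) auto
qed

lemma cmod_det_unitarym: "unitarym u \<Longrightarrow> cmod (det u) = 1" for u :: "complex^'n::finite^'n"
proof -
  assume "unitarym u"
  then have "det (conjm u) * det u = 1"
    by (metis unitarym_def det_I det_mul det_transpose)
  moreover have "det (conjm u) = cnj (det u)"
    unfolding det_def by (simp add: sign_def)
  ultimately have "(cmod (det u))\<^sup>2 = 1"
    by (metis complex_norm_square mult.commute of_real_eq_1_iff)
  then show ?thesis using power2_eq_iff_nonneg[of "cmod (det u)" 1] by simp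
qed

lemma diagm_vector_mult: "diagm d *v x = (\<chi> i. d i * x $ i)" for d :: "'n::finite \<Rightarrow> 'a::comm_semiring_1"
  by (simp add: vec_eq_iff matrix_vector_mult_def diagm_def if_distrib[of "\<lambda>y. y * _"] sum.delta' cong: if_cong)

lemma diagm_mult_left: "diagm d ** A = (\<chi> i j. d i * A $ i $ j)" for d :: "'n::finite \<Rightarrow> 'a::comm_semiring_1"
  by (simp add: vec_eq_iff matrix_matrix_mult_def diagm_def if_distrib[of "\<lambda>y. y * _"] sum.delta' cong: if_cong)

lemma diagm_mult: "diagm d ** diagm e = diagm (\<lambda>i. d i * e i)" for d :: "'n::finite \<Rightarrow> 'a::comm_semiring_1"
  by (subst diagm_mult_left) (simp add: vec_eq_iff diagm_def)

lemma diagm_1: "diagm (\<lambda>i. 1) = mat 1"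
  by (simp add: vec_eq_iff diagm_def mat_def)

lemma det_diagm: "det (diagm d) = (\<Prod>i\<in>UNIV. d i)" for d :: "'n::finite \<Rightarrow> 'a::comm_ring_1"
  by (subst det_diagonal) (auto simp: diagm_def)

lemma transpose_diagm [simp]: "transpose (diagm d) = diagm d"
  by (simp add: vec_eq_iff transpose_def diagm_def)

lemma conjm_diagm: "conjm (diagm d) = diagm (\<lambda>i. cnj (d i))"
  by (simp add: vec_eq_iff diagm_def)

section \<open>Block matrices and the complex form of a real matrix\<close>

lemma sum_UNIV_Plus:
  "(\<Sum>i\<in>UNIV. f i) = (\<Sum>i\<in>UNIV. f (Inl i)) + (\<Sum>i\<in>UNIV. f (Inr i))"
  for f :: "('a::finite + 'b::finite) \<Rightarrow> 'c::comm_monoid_add"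
  by (simp add: UNIV_Plus_UNIV[symmetric] sum.Plus del: UNIV_Plus_UNIV)

lemma block_nth [simp]:
  "block A B C D $ Inl i $ Inl j = A $ i $ j"
  "block A B C D $ Inl i $ Inr j = B $ i $ j"
  "block A B C D $ Inr i $ Inl j = C $ i $ j"
  "block A B C D $ Inr i $ Inr j = D $ i $ j"
  by (simp_all add: block_def)

lemma all_Plus: "(\<forall>i :: 'a + 'b. P i) \<longleftrightarrow> (\<forall>i. P (Inl i)) \<and> (\<forall>i. P (Inr i))"
  by (metis sum.exhaust)

lemma block_mult:
  "block A B C D ** block A' B' C' D'
   = block (A ** A' + B ** C') (A ** B' + B ** D') (C ** A' + D ** C') (C ** B' + D ** D')"
  for A :: "'a::comm_semiring_1^'n::finite^'n"
  by (simp add: vec_eq_iff all_Plus matrix_matrix_mult_def sum_UNIV_Plus)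

lemma block_1: "block (mat 1) 0 0 (mat 1) = mat 1"
  by (simp add: vec_eq_iff all_Plus mat_def)

lemma transpose_block: "transpose (block A B C D) = block (transpose A) (transpose C) (transpose B) (transpose D)"
  by (simp add: vec_eq_iff all_Plus transpose_def)

text \<open>Identifying \<open>(x, y)\<close> with \<open>z = x - \<i>y\<close>, the real matrix \<open>g\<close> is \<open>z \<mapsto> cpart g z + apart g z\<^sup>*\<close>.\<close>

definition apart :: "'n symat \<Rightarrow> complex^'n^'n" where
  "apart g = (\<chi> i j. Complex ((g $ Inl i $ Inl j - g $ Inr i $ Inr j) / 2)
                              (- (g $ Inl i $ Inr j + g $ Inr i $ Inl j) / 2))"

text \<open>Linear part of a composition: an inner antilinear map becomes linear again when the
  outer map conjugates it. Hence the conjugate on the second factor of the term that contains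
  \<open>apart g\<close>.\<close>

lemma cpart_mult: "cpart (g ** h) = cpart g ** cpart h + apart g ** conjm (apart h)"
  by (simp add: vec_eq_iff cpart_def apart_def matrix_matrix_mult_def complex_eq_iff sum_UNIV_Plus
      sum.distrib[symmetric] sum_subtractf[symmetric] sum_divide_distrib)
    (auto intro!: sum.cong simp: field_simps)

lemma apart_mult: "apart (g ** h) = cpart g ** apart h + apart g ** conjm (cpart h)"
  by (simp add: vec_eq_iff cpart_def apart_def matrix_matrix_mult_def complex_eq_iff sum_UNIV_Plus
      sum.distrib[symmetric] sum_subtractf[symmetric] sum_negf[symmetric] sum_divide_distrib)
    (auto intro!: sum.cong simp: field_simps)

lemma cpart_1 [simp]: "cpart (mat 1) = mat 1"
  by (simp add: vec_eq_iff cpart_def mat_def complex_eq_iff)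

lemma cpart_transpose: "cpart (transpose g) = transpose (conjm (cpart g))"
  by (simp add: vec_eq_iff cpart_def transpose_def complex_eq_iff field_simps)

lemma cpart_expH: "cpart (expH t) = diagm (\<lambda>i. complex_of_real (cosh (t $ i)))"
  by (simp add: vec_eq_iff cpart_def expH_def diagm_def complex_eq_iff cosh_def)

lemma apart_expH: "apart (expH t) = diagm (\<lambda>i. complex_of_real (sinh (t $ i)))"
  by (simp add: vec_eq_iff apart_def expH_def diagm_def complex_eq_iff sinh_def)

lemma Jmat_mult_left:
  "(Jmat ** g) $ Inl i $ j = g $ Inr i $ j" "(Jmat ** g) $ Inr i $ j = - g $ Inl i $ j"
  for g :: "'n::finite symat"
  by (simp_all add: matrix_matrix_mult_def sum_UNIV_Plus Jmat_def mat_def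
      if_distrib[of "\<lambda>y. y * _"] if_distrib[of uminus] sum.delta' cong: if_cong)

lemma Jmat_mult_right:
  "(g ** Jmat) $ i $ Inr j = g $ i $ Inl j" "(g ** Jmat) $ i $ Inl j = - g $ i $ Inr j"
  for g :: "'n::finite symat"
  by (simp_all add: matrix_matrix_mult_def sum_UNIV_Plus Jmat_def mat_def
      if_distrib[of "\<lambda>y. _ * y"] if_distrib[of uminus] sum.delta cong: if_cong)

lemma Jmat_square: "Jmat ** Jmat = (- mat 1 :: 'n::finite symat)"
  by (simp add: vec_eq_iff all_Plus Jmat_mult_left) (simp add: Jmat_def mat_def)

lemma transpose_Jmat: "transpose Jmat = (- Jmat :: 'n::finite symat)"
  by (simp add: vec_eq_iff all_Plus transpose_def Jmat_def mat_def)

lemma maxcompact_commute: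
  assumes "k \<in> maxcompact" shows "Jmat ** k = k ** Jmat"
proof -
  have "transpose k ** Jmat ** k = Jmat" "k ** transpose k = mat 1"
    using assms by (auto simp: maxcompact_def Sp_def orthogonal_matrix_def)
  then show ?thesis
    by (metis matrix_mul_assoc matrix_mul_lid)
qed

text \<open>Commuting with \<open>Jmat\<close> means being complex linear, so the antilinear part
  vanishes and orthogonality becomes unitarity.\<close>

lemma maxcompact_complex_form:
  assumes "k \<in> maxcompact"
  shows "apart k = 0" "cpart k = unitary_of k" "unitarym (unitary_of k)"
proof -
  note c = arg_cong[OF maxcompact_commute[OF assms], of "\<lambda>A. A $ Inl _ $ _"]
  have 1: "k $ Inr i $ Inr j = k $ Inl i $ Inl j" for i j
    using c[of i "Inr j"] by (simp add: Jmat_mult_left Jmat_mult_right)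
  have 2: "k $ Inr i $ Inl j = - k $ Inl i $ Inr j" for i j
    using c[of i "Inl j"] by (simp add: Jmat_mult_left Jmat_mult_right)
  show a: "apart k = 0"
    by (simp add: vec_eq_iff apart_def complex_eq_iff 1 2)
  show u: "cpart k = unitary_of k"
    by (simp add: vec_eq_iff cpart_def unitary_of_def complex_eq_iff 1 2)
  have "cpart (transpose k ** k) = mat 1"
    using assms by (simp add: maxcompact_def orthogonal_matrix_def)
  then show "unitarym (unitary_of k)"
    by (simp add: cpart_mult a cpart_transpose u unitarym_def vec_eq_iff conjm_def)
      (simp add: matrix_matrix_mult_def)
qed

section \<open>The Cartan decomposition\<close>

lemma matrix_mult_uminus:
  "(- A) ** B = - (A ** B)" "A ** (- B) = - (A ** B)" "(- A) *v x = - (A *v x)"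
  for A :: "'a::comm_ring_1^'n::finite^'m" and B :: "'a^'k^'n"
  by (simp_all add: vec_eq_iff matrix_matrix_mult_def matrix_vector_mult_def sum_negf)

text \<open>Maximise the Rayleigh quotient over the unit sphere of \<open>W\<close>. The form
  \<open>q\<close> is nonnegative on \<open>W\<close> and vanishes at the maximiser
  \<open>e\<close>; along the line through \<open>e\<close> in the direction of the residual
  \<open>w\<close> its linear term is twice the squared norm of \<open>w\<close>, which forces
  \<open>w = 0\<close>.\<close>

lemma selfadjoint_eigenvector:
  fixes p :: "real^'m::finite^'m"
  assumes sym: "\<And>x y. (p *v x) \<bullet> y = x \<bullet> (p *v y)"
    and W: "subspace W" "\<And>x. x \<in> W \<Longrightarrow> p *v x \<in> W" "W \<noteq> {0}"
  obtains e \<mu> where "e \<in> W" "norm e = 1" "p *v e = \<mu> *\<^sub>R e"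
proof -
  define S where "S = W \<inter> sphere 0 1"
  have "compact S"
    unfolding S_def using W(1) closed_subspace by (intro closed_Int_compact) auto
  moreover have "S \<noteq> {}"
  proof -
    obtain w where "w \<in> W" "w \<noteq> 0" using subspace_0[OF W(1)] W(3) by blast
    then have "(1 / norm w) *\<^sub>R w \<in> S"
      by (simp add: S_def W(1) subspace_mul)
    then show ?thesis by blast
  qed
  moreover have "continuous_on S (\<lambda>x. (p *v x) \<bullet> x)"
    by (intro continuous_intros matrix_vector_mult_linear_continuous_on)
  ultimately obtain e where e: "e \<in> S" "\<And>x. x \<in> S \<Longrightarrow> (p *v x) \<bullet> x \<le> (p *v e) \<bullet> e"
    using continuous_attains_sup[of S "\<lambda>x. (p *v x) \<bullet> x"] by metis
  define \<mu> where "\<mu> = (p *v e) \<bullet> e"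
  define q where "q x = \<mu> * (x \<bullet> x) - (p *v x) \<bullet> x" for x
  have eW: "e \<in> W" and ne: "e \<bullet> e = 1"
    using e(1) by (auto simp: S_def dot_square_norm)
  have q_nonneg: "q x \<ge> 0" if "x \<in> W" for x
  proof (cases "x = 0")
    case False
    then have "(1 / norm x) *\<^sub>R x \<in> S"
      using that by (simp add: S_def W(1) subspace_mul)
    from e(2)[OF this] False show ?thesis
      by (simp add: q_def \<mu>_def matrix_vector_mult_scaleR dot_square_norm power2_eq_square field_simps)
  qed (simp add: q_def)
  define w where "w = \<mu> *\<^sub>R e - p *v e"
  have wW: "w \<in> W" unfolding w_def by (intro subspace_diff subspace_mul W eW)
  have line: "0 \<le> 2 * s * (w \<bullet> w) + s\<^sup>2 * q w" for s
  proof -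
    have 1: "(p *v (e + s *\<^sub>R w)) \<bullet> (e + s *\<^sub>R w)
        = (p *v e) \<bullet> e + 2 * s * ((p *v e) \<bullet> w) + s\<^sup>2 * ((p *v w) \<bullet> w)"
    proof -
      have "(p *v w) \<bullet> e = (p *v e) \<bullet> w" using sym[of w e] by (simp only: inner_commute)
      then show ?thesis
        by (simp add: matrix_vector_right_distrib matrix_vector_mult_scaleR inner_add_left
            inner_add_right power2_eq_square algebra_simps)
    qed
    have 2: "(e + s *\<^sub>R w) \<bullet> (e + s *\<^sub>R w) = e \<bullet> e + 2 * s * (e \<bullet> w) + s\<^sup>2 * (w \<bullet> w)"
      by (simp add: inner_add_left inner_add_right inner_commute[of w e] power2_eq_square algebra_simps)
    have 3: "\<mu> * (e \<bullet> w) - (p *v e) \<bullet> w = w \<bullet> w"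
      by (simp add: w_def inner_diff_left)
    have "q (e + s *\<^sub>R w) = q e + 2 * s * (\<mu> * (e \<bullet> w) - (p *v e) \<bullet> w) + s\<^sup>2 * q w"
      unfolding q_def 1 2 by (simp add: algebra_simps)
    then have "q (e + s *\<^sub>R w) = q e + 2 * s * (w \<bullet> w) + s\<^sup>2 * q w" unfolding 3 .
    moreover have "q e = 0" by (simp add: q_def \<mu>_def ne)
    ultimately show ?thesis
      using q_nonneg[of "e + s *\<^sub>R w"] W(1) wW eW
      by (simp add: subspace_add subspace_mul)
  qed
  have "w \<bullet> w = 0"
  proof (rule ccontr)
    assume "w \<bullet> w \<noteq> 0"
    then have pos: "w \<bullet> w > 0" by simp
    \<comment> \<open>The summand 1 keeps the denominator positive when \<open>q w = 0\<close>; the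
      step is still short enough for the linear term to dominate.\<close>
    define s where "s = - (w \<bullet> w) / (q w + 1)"
    have qw: "q w \<ge> 0" using q_nonneg wW by blast
    have "2 * s * (w \<bullet> w) + s\<^sup>2 * q w = s * (2 * (w \<bullet> w) + s * q w)"
      by (simp add: power2_eq_square algebra_simps)
    also have "2 * (w \<bullet> w) + s * q w = (w \<bullet> w) * (2 - q w / (q w + 1))"
      by (simp add: s_def algebra_simps)
    also have "s * \<dots> < 0"
    proof (intro mult_neg_pos mult_pos_pos pos)
      show "s < 0" using pos qw by (simp add: s_def divide_neg_pos)
      have "q w / (q w + 1) < 1" using qw by (simp add: divide_less_eq)
      then show "0 < 2 - q w / (q w + 1)" by simp
    qed
    finally show False using line[of s] by simp
  qed
  then have "p *v e = \<mu> *\<^sub>R e" by (simp add: w_def)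
  moreover have "norm e = 1" using e(1) by (simp add: S_def)
  ultimately show ?thesis using that eW by blast
qed

lemma inner_matrix_transpose: "(A *v x) \<bullet> y = x \<bullet> (transpose A *v y)"
  for A :: "real^'n::finite^'m::finite"
  by (metis dot_lmul_matrix inner_commute vector_transpose_matrix)

text \<open>The relation \<open>p ** Jmat ** p = Jmat\<close> makes \<open>Jmat\<close> carry the
  eigenspace of \<open>c\<close> to that of \<open>1 / c\<close>, so eigenvectors come in
  pairs.\<close>

lemma symplectic_eigenvector_J:
  fixes p :: "'n::finite symat"
  assumes "p ** Jmat ** p = Jmat" "p *v x = c *\<^sub>R x" "c \<noteq> 0"
  shows "p *v (Jmat *v x) = (1 / c) *\<^sub>R (Jmat *v x)"
proof -
  have "c *\<^sub>R (p *v (Jmat *v x)) = p *v (Jmat *v (p *v x))"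
    by (simp add: assms(2) matrix_vector_mult_scaleR)
  also have "\<dots> = Jmat *v x"
    by (simp only: matrix_vector_mul_assoc assms(1) matrix_mul_assoc)
  finally have "Jmat *v x = c *\<^sub>R (p *v (Jmat *v x))" ..
  then show ?thesis using assms(3) by (metis divide_inverse left_inverse mult_1 scaleR_one scaleR_scaleR)
qed

text \<open>Half of an eigenbasis, spanning an isotropic subspace; \<open>Jmat\<close> supplies the
  other half. Vectors are added one at a time: the orthogonal complement of those found so far and
  of their images under \<open>Jmat\<close> is invariant under \<open>p\<close> and, by counting
  dimensions, nonzero while fewer than n vectors have been found.\<close>

lemma symplectic_eigenbasis:
  fixes p :: "'n::finite symat"
  assumes sym: "transpose p = p" and pJp: "p ** Jmat ** p = Jmat"
    and pos: "\<And>x. x \<noteq> 0 \<Longrightarrow> (p *v x) \<bullet> x > 0"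
  obtains e :: "'n \<Rightarrow> real^('n + 'n)" and \<mu> :: "'n \<Rightarrow> real" where
    "\<And>i. p *v e i = \<mu> i *\<^sub>R e i" "\<And>i j. e i \<bullet> e j = (if i = j then 1 else 0)"
    "\<And>i j. e i \<bullet> (Jmat *v e j) = 0"
proof -
  have selfadj: "(p *v x) \<bullet> y = x \<bullet> (p *v y)" for x y
    by (simp add: inner_matrix_transpose sym)
  have skew: "(Jmat *v x) \<bullet> y = - (x \<bullet> (Jmat *v y))" for x y :: "real^('n + 'n)"
    by (simp add: inner_matrix_transpose transpose_Jmat matrix_mult_uminus)
  note eig_J = symplectic_eigenvector_J[OF pJp]
  have "\<exists>e \<mu>. (\<forall>i\<in>I. p *v e i = \<mu> i *\<^sub>R e i) \<and>
      (\<forall>i\<in>I. \<forall>j\<in>I. e i \<bullet> e j = (if i = j then 1 else 0) \<and> e i \<bullet> (Jmat *v e j) = 0)"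
    if "finite I" for I :: "'n set"
    using that
  proof induction
    case (insert i I)
    then obtain e \<mu> where e: "\<And>i. i \<in> I \<Longrightarrow> p *v e i = \<mu> i *\<^sub>R e i"
      "\<And>i j. i \<in> I \<Longrightarrow> j \<in> I \<Longrightarrow> e i \<bullet> e j = (if i = j then 1 else 0)"
      "\<And>i j. i \<in> I \<Longrightarrow> j \<in> I \<Longrightarrow> e i \<bullet> (Jmat *v e j) = 0" by blast
    have \<mu>0: "\<mu> j \<noteq> 0" if "j \<in> I" for j
      using pos[of "e j"] e(1,2)[OF that] e(2)[OF that that] by fastforce
    define T where "T = e ` I \<union> (\<lambda>j. Jmat *v e j) ` I"
    define W where "W = {x. \<forall>j\<in>I. x \<bullet> e j = 0 \<and> x \<bullet> (Jmat *v e j) = 0}"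
    have "subspace W"
      by (auto simp: W_def subspace_def inner_add_left)
    moreover have "p *v x \<in> W" if "x \<in> W" for x
      using that by (auto simp: W_def selfadj e eig_J[OF e(1) \<mu>0])
    moreover have "W \<noteq> {0}"
    proof -
      have "card T \<le> card I + card I"
        unfolding T_def
        by (rule order_trans[OF card_Un_le add_mono[OF card_image_le card_image_le]]) (use insert in auto)
      moreover have "card I < CARD('n)"
        using insert(2) by (metis UNIV_I finite_code psubsetI psubset_card_mono subset_UNIV)
      ultimately have "dim T < DIM(real^('n + 'n))"
        using dim_le_card'[of T] insert(1) by (simp add: T_def)
      then obtain x where "x \<noteq> 0" "\<And>y. y \<in> span T \<Longrightarrow> orthogonal x y"
        using orthogonal_to_subspace_exists by blast
      then have "x \<in> W" by (auto simp: W_def T_def orthogonal_def span_base)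
      with \<open>x \<noteq> 0\<close> show ?thesis by blast
    qed
    ultimately obtain v c where v: "v \<in> W" "norm v = 1" "p *v v = c *\<^sub>R v"
      using selfadjoint_eigenvector[of p W] selfadj by metis
    have vv: "v \<bullet> v = 1" "v \<bullet> (Jmat *v v) = 0"
      using v(2) skew[of v v] by (simp_all add: dot_square_norm inner_commute)
    have ve: "v \<bullet> e j = 0" "e j \<bullet> v = 0" "v \<bullet> (Jmat *v e j) = 0" "e j \<bullet> (Jmat *v v) = 0" if "j \<in> I" for j
      using v(1) that skew[of "e j" v] by (auto simp: W_def inner_commute)
    show ?case
      by (rule exI[of _ "e(i := v)"], rule exI[of _ "\<mu>(i := c)"])
        (use insert(2) e v(3) vv ve in auto)
  qed simp
  from this[of UNIV, OF finite] obtain e :: "'n \<Rightarrow> real^('n + 'n)" and \<mu> where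
    "\<forall>i\<in>UNIV. p *v e i = \<mu> i *\<^sub>R e i"
    "\<forall>i\<in>UNIV. \<forall>j\<in>UNIV. e i \<bullet> e j = (if i = j then 1 else 0) \<and> e i \<bullet> (Jmat *v e j) = 0"
    by blast
  then show ?thesis by (intro that[of e \<mu>]) blast+
qed

lemma maxcompactI:
  assumes "orthogonal_matrix k" "Jmat ** k = k ** Jmat" shows "k \<in> maxcompact"
proof -
  have "transpose k ** Jmat ** k = transpose k ** k ** Jmat"
    by (metis assms(2) matrix_mul_assoc)
  then show ?thesis
    using assms(1) by (auto simp: maxcompact_def Sp_def orthogonal_matrix_def invertible_def)
qed

lemma maxcompact_transpose: "k \<in> maxcompact \<Longrightarrow> transpose k \<in> maxcompact"
proof (rule maxcompactI)
  assume k: "k \<in> maxcompact"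
  then have o: "transpose k ** k = mat 1" "k ** transpose k = mat 1"
    by (auto simp: maxcompact_def orthogonal_matrix_def)
  show "orthogonal_matrix (transpose k)" using o by (simp add: orthogonal_matrix_def)
  have "Jmat ** transpose k = transpose k ** (k ** Jmat) ** transpose k"
    by (simp add: matrix_mul_assoc o)
  also have "\<dots> = transpose k ** (Jmat ** k) ** transpose k" using maxcompact_commute[OF k] by simp
  also have "\<dots> = transpose k ** Jmat ** (k ** transpose k)" by (simp add: matrix_mul_assoc)
  finally show "Jmat ** transpose k = transpose k ** Jmat" by (simp add: o)
qed

lemma Sp_mult: "g \<in> Sp \<Longrightarrow> h \<in> Sp \<Longrightarrow> g ** h \<in> Sp"
  unfolding Sp_def
  by (auto simp: invertible_mult matrix_transpose_mul) (metis matrix_mul_assoc)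

lemma expH_mult: "expH s ** expH t = expH (s + t)" for s t :: "real^'n::finite"
  by (simp add: expH_def block_mult diagm_mult exp_add[symmetric] exp_minus[symmetric] vec_eq_iff)

lemma expH_0: "expH 0 = mat 1"
  by (simp add: expH_def diagm_1 block_1)

lemma transpose_expH: "transpose (expH t) = expH t"
  by (simp add: expH_def transpose_block) (simp add: transpose_def zero_vec_def)

lemma expH_Sp: "expH t \<in> Sp" for t :: "real^'n::finite"
proof -
  have "expH t ** expH (- t) = mat 1" "expH (- t) ** expH t = mat 1" by (simp_all add: expH_mult expH_0)
  then have "invertible (expH t)" by (auto simp: invertible_def)
  moreover have "expH t ** Jmat ** expH t = Jmat"
  proof -
    have J: "Jmat = (block 0 (diagm (\<lambda>i. 1)) (diagm (\<lambda>i. - 1)) 0 :: 'n symat)"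
      by (simp add: Jmat_def vec_eq_iff all_Plus diagm_def mat_def)
    show ?thesis
      unfolding expH_def J by (simp add: block_mult diagm_mult) (simp add: exp_minus)
  qed
  ultimately show ?thesis by (simp add: Sp_def transpose_expH)
qed

lemma Sp_transpose_J: "g \<in> Sp \<Longrightarrow> g ** Jmat ** transpose g = Jmat"
proof -
  assume g: "g \<in> Sp"
  then have "(- Jmat ** transpose g ** Jmat) ** g = mat 1"
    unfolding Sp_def using Jmat_square
    by (metis (mono_tags, lifting) matrix_mul_assoc matrix_mult_uminus mem_Collect_eq minus_minus)
  then have "g ** (- Jmat ** transpose g ** Jmat) = mat 1" by (simp add: matrix_left_right_inverse)
  then have "g ** Jmat ** transpose g ** Jmat ** Jmat = - Jmat"
    by (metis (no_types, opaque_lifting) matrix_mul_assoc matrix_mul_lid matrix_mult_uminus matrix_mult_uminus minus_minus)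
  then show ?thesis
    by (metis (no_types, opaque_lifting) matrix_mul_assoc matrix_mul_rid matrix_mult_uminus minus_minus Jmat_square)
qed

text \<open>Polar decomposition: diagonalise \<open>p = transpose g ** g\<close> as
  \<open>exp (2 H)\<close> by some \<open>k\<close> in \<open>maxcompact\<close>; then
  \<open>g ** transpose k ** expH (- t)\<close> is orthogonal.\<close>

theorem cartan_decomposition:
  fixes g :: "'n::finite symat"
  assumes g: "g \<in> Sp"
  obtains k1 k2 and t :: "real^'n" where "k1 \<in> maxcompact" "k2 \<in> maxcompact" "g = k1 ** expH t ** k2"
proof -
  define p where "p = transpose g ** g"
  have gJg: "transpose g ** Jmat ** g = Jmat" "invertible g" using g by (auto simp: Sp_def)
  have sym: "transpose p = p" by (simp add: p_def matrix_transpose_mul)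
  have "p ** Jmat ** p = transpose g ** (g ** Jmat ** transpose g) ** g"
    by (simp add: p_def matrix_mul_assoc)
  then have pJp: "p ** Jmat ** p = Jmat" by (simp add: Sp_transpose_J g gJg)
  have pos: "(p *v x) \<bullet> x > 0" if "x \<noteq> 0" for x
  proof -
    have "(p *v x) \<bullet> x = (g *v x) \<bullet> (g *v x)"
      unfolding p_def matrix_vector_mul_assoc[symmetric] inner_matrix_transpose transpose_transpose ..
    moreover have "g *v x \<noteq> 0"
      using that gJg(2) by (metis invertible_left_inverse matrix_left_invertible_ker)
    ultimately show ?thesis by simp
  qed
  obtain e :: "'n \<Rightarrow> real^('n + 'n)" and \<mu> where e: "\<And>i. p *v e i = \<mu> i *\<^sub>R e i"
    "\<And>i j. e i \<bullet> e j = (if i = j then 1 else 0)" "\<And>i j. e i \<bullet> (Jmat *v e j) = 0"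
    using symplectic_eigenbasis[OF sym pJp pos] by blast
  have \<mu>: "\<mu> i > 0" for i
    using pos[of "e i"] e(1,2)[of i] e(2)[of i i] by (cases "e i = 0") auto
  define t :: "real^'n" where "t = (\<chi> i. ln (\<mu> i) / 2)"
  have \<mu>t: "\<mu> i = exp (2 * t $ i)" for i using \<mu> by (simp add: t_def)
  \<comment> \<open>The first half of the rows determines the second: with the rows
    \<open>- (Jmat *v e a)\<close> the matrix \<open>k\<close> commutes with
    \<open>Jmat\<close>.\<close>
  define k :: "'n symat" where "k = (\<chi> i. case i of Inl a \<Rightarrow> e a | Inr a \<Rightarrow> - (Jmat *v e a))"
  have kl: "k $ Inl a = e a" "k $ Inr a = - (Jmat *v e a)" for a by (simp_all add: k_def)
  have J: "(Jmat *v x) $ Inl a = x $ Inr a" "(Jmat *v x) $ Inr a = - x $ Inl a" for x :: "real^('n+'n)" and a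
    by (simp_all add: matrix_vector_mult_def sum_UNIV_Plus Jmat_def mat_def
        if_distrib[of "\<lambda>y. y * _"] if_distrib[of uminus] sum.delta' cong: if_cong)
  have JJ: "(Jmat *v x) \<bullet> (Jmat *v y) = x \<bullet> y" for x y :: "real^('n+'n)"
    by (simp add: inner_vec_def sum_UNIV_Plus J)
  have "k ** transpose k = mat 1"
  proof -
    have "(k ** transpose k) $ i $ j = k $ i \<bullet> k $ j" for i j
      by (simp add: matrix_matrix_mult_def transpose_def inner_vec_def)
    then show ?thesis
      by (simp add: vec_eq_iff all_Plus kl e JJ inner_commute[of "Jmat *v _" "e _"] mat_def)
  qed
  then have ok: "orthogonal_matrix k" "transpose k ** k = mat 1"
    by (simp_all add: orthogonal_matrix_def matrix_left_right_inverse)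
  have kK: "k \<in> maxcompact"
    by (intro maxcompactI ok)
      (simp add: vec_eq_iff all_Plus Jmat_mult_left Jmat_mult_right kl J)
  have "p ** transpose k = transpose k ** (expH t ** expH t)"
  proof -
    have *: "(p ** transpose k) $ i $ j = (p *v (k $ j)) $ i" for i j
      by (simp add: matrix_matrix_mult_def matrix_vector_mult_def transpose_def)
    have "(transpose k ** expH (t + t)) $ i $ Inl a = k $ Inl a $ i * exp (2 * t $ a)"
      "(transpose k ** expH (t + t)) $ i $ Inr a = k $ Inr a $ i * exp (- (2 * t $ a))" for i a
      by (simp_all add: matrix_matrix_mult_def sum_UNIV_Plus expH_def diagm_def transpose_def
          if_distrib[of "\<lambda>y. _ * y"] sum.delta cong: if_cong)
    moreover have "p *v k $ Inl a = exp (2 * t $ a) *\<^sub>R k $ Inl a" for a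
      by (simp add: kl e \<mu>t)
    moreover have "p *v k $ Inr a = exp (- (2 * t $ a)) *\<^sub>R k $ Inr a" for a
      using symplectic_eigenvector_J[OF pJp e(1), of a] \<mu>[of a]
      by (simp add: kl \<mu>t exp_minus divide_inverse vec.neg)
    ultimately show ?thesis
      unfolding expH_mult vec_eq_iff all_Plus * by simp
  qed
  then have pk: "k ** p ** transpose k = expH t ** expH t"
    by (metis matrix_mul_assoc matrix_mul_lid \<open>k ** transpose k = mat 1\<close>)
  define k1 where "k1 = g ** transpose k ** expH (- t)"
  have "k1 \<in> Sp"
    unfolding k1_def using maxcompact_transpose[OF kK]
    by (intro Sp_mult g expH_Sp) (simp add: maxcompact_def)
  moreover have "transpose k1 ** k1 = expH (- t) ** (k ** p ** transpose k) ** expH (- t)"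
    by (simp add: k1_def p_def matrix_transpose_mul transpose_expH matrix_mul_assoc)
  then have "orthogonal_matrix k1"
    by (simp add: pk expH_mult expH_0 orthogonal_matrix)
  ultimately have "k1 \<in> maxcompact" by (simp add: maxcompact_def)
  moreover have "k1 ** expH t ** k = g ** transpose k ** (expH (- t) ** expH t) ** k"
    by (simp add: k1_def matrix_mul_assoc)
  then have "g = k1 ** expH t ** k"
    by (simp add: expH_mult expH_0 matrix_mul_assoc[symmetric] ok)
  ultimately show ?thesis using kK that by blast
qed

section \<open>The matrix \<open>calH g\<close>\<close>

text \<open>\<open>calH g\<close> is defined by a choice, so it is known only together with the
  decomposition behind it. Unpacking the choice once, with \<open>cpart g\<close> and
  \<open>apart g\<close> written in the same \<open>u\<close>, \<open>v\<close>, \<open>t\<close>,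
  allows every later estimate to be made in diagonal form.\<close>

lemma Sp_unitary_form:
  fixes g :: "'n::finite symat"
  assumes g: "g \<in> Sp"
  obtains u v and t :: "real^'n" where "unitarym u" "unitarym v"
    "cpart g = u ** diagm (\<lambda>i. complex_of_real (cosh (t $ i))) ** v"
    "apart g = u ** diagm (\<lambda>i. complex_of_real (sinh (t $ i))) ** conjm v"
    "calH g = block (conjm u) 0 0 (transpose (conjm v))
       ** block (diagm (\<lambda>i. of_real (tanh (t $ i)))) (diagm (\<lambda>i. - \<i> * of_real (1 / cosh (t $ i))))
                (diagm (\<lambda>i. - \<i> * of_real (1 / cosh (t $ i)))) (diagm (\<lambda>i. of_real (tanh (t $ i))))
       ** block (transpose (conjm u)) 0 0 (conjm v)"
proof -
  define Q where "Q X \<longleftrightarrow> (\<exists>k1\<in>maxcompact. \<exists>k2\<in>maxcompact. \<exists>t :: real^'n.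
     g = k1 ** expH t ** k2 \<and>
     X = block (conjm (unitary_of k1)) 0 0 (transpose (conjm (unitary_of k2)))
       ** block (diagm (\<lambda>i. of_real (tanh (t $ i)))) (diagm (\<lambda>i. - \<i> * of_real (1 / cosh (t $ i))))
                (diagm (\<lambda>i. - \<i> * of_real (1 / cosh (t $ i)))) (diagm (\<lambda>i. of_real (tanh (t $ i))))
       ** block (matrix_inv (unitary_of k1)) 0 0 (conjm (unitary_of k2)))" for X
  have "\<exists>X. Q X"
    using cartan_decomposition[OF g] unfolding Q_def by metis
  then have "Q (calH g)"
    unfolding calH_def Q_def by (rule someI_ex)
  then obtain k1 k2 and t :: "real^'n" where k: "k1 \<in> maxcompact" "k2 \<in> maxcompact"
    "g = k1 ** expH t ** k2"
    and X: "calH g = block (conjm (unitary_of k1)) 0 0 (transpose (conjm (unitary_of k2)))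
       ** block (diagm (\<lambda>i. of_real (tanh (t $ i)))) (diagm (\<lambda>i. - \<i> * of_real (1 / cosh (t $ i))))
                (diagm (\<lambda>i. - \<i> * of_real (1 / cosh (t $ i)))) (diagm (\<lambda>i. of_real (tanh (t $ i))))
       ** block (matrix_inv (unitary_of k1)) 0 0 (conjm (unitary_of k2))"
    unfolding Q_def by blast
  note c = maxcompact_complex_form
  have zero: "0 ** A = 0" "A ** 0 = 0" "conjm 0 = 0" for A :: "complex^'n^'n"
    by (simp_all add: vec_eq_iff matrix_matrix_mult_def)
  show ?thesis
  proof (rule that)
    show "unitarym (unitary_of k1)" "unitarym (unitary_of k2)" using c k by blast+
    then show "calH g = block (conjm (unitary_of k1)) 0 0 (transpose (conjm (unitary_of k2)))
       ** block (diagm (\<lambda>i. of_real (tanh (t $ i)))) (diagm (\<lambda>i. - \<i> * of_real (1 / cosh (t $ i))))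
                (diagm (\<lambda>i. - \<i> * of_real (1 / cosh (t $ i)))) (diagm (\<lambda>i. of_real (tanh (t $ i))))
       ** block (transpose (conjm (unitary_of k1))) 0 0 (conjm (unitary_of k2))"
      using X by (simp add: unitarym_matrix_inv)
    show "cpart g = unitary_of k1 ** diagm (\<lambda>i. complex_of_real (cosh (t $ i))) ** unitary_of k2"
      unfolding k(3) cpart_mult apart_mult c(1)[OF k(1)] c(1)[OF k(2)] zero cpart_expH
        c(2)[OF k(1)] c(2)[OF k(2)] by simp
    show "apart g = unitary_of k1 ** diagm (\<lambda>i. complex_of_real (sinh (t $ i))) ** conjm (unitary_of k2)"
      unfolding k(3) cpart_mult apart_mult c(1)[OF k(1)] c(1)[OF k(2)] zero apart_expH
        c(2)[OF k(1)] c(2)[OF k(2)] by simp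
  qed
qed

lemma stack_nth [simp]: "stack a b $ Inl i = a $ i" "stack a b $ Inr i = b $ i"
  by (simp_all add: stack_def)

lemma bilin_block:
  "bilin (block A B C D) (stack a b)
   = bilin A a + (\<Sum>i\<in>UNIV. \<Sum>j\<in>UNIV. a $ i * (B $ i $ j + C $ j $ i) * b $ j) + bilin D b"
  for A :: "'a::comm_semiring_1^'n::finite^'n"
proof -
  have "(\<Sum>i\<in>UNIV. \<Sum>j\<in>UNIV. b $ i * C $ i $ j * a $ j) = (\<Sum>i\<in>UNIV. \<Sum>j\<in>UNIV. a $ i * C $ j $ i * b $ j)"
    by (subst sum.swap) (simp add: mult_ac)
  then show ?thesis
    by (simp add: bilin_def sum_UNIV_Plus sum.distrib distrib_left distrib_right) (simp add: add_ac)
qed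

lemma bilin_conv_vector_mult: "bilin X v = (\<Sum>i\<in>UNIV. v $ i * (X *v v) $ i)"
  by (simp add: bilin_def matrix_vector_mult_def sum_distrib_left mult.assoc)

lemma bilin_congruence: "bilin (transpose R ** X ** R) v = bilin X (R *v v)"
  for X :: "'a::comm_semiring_1^'m::finite^'m"
proof -
  have "(\<Sum>i\<in>UNIV. v $ i * (transpose R *v y) $ i) = (\<Sum>i\<in>UNIV. (R *v v) $ i * y $ i)" for y
    by (simp add: matrix_vector_mult_def transpose_def sum_distrib_left sum_distrib_right)
      (subst sum.swap, simp add: mult_ac)
  then show ?thesis
    by (simp add: bilin_conv_vector_mult matrix_vector_mul_assoc[symmetric])
qed

lemma bilin_diagm: "bilin (diagm d) v = (\<Sum>i\<in>UNIV. d i * (v $ i)\<^sup>2)"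
  for d :: "'n::finite \<Rightarrow> 'a::comm_semiring_1"
  by (simp add: bilin_conv_vector_mult diagm_vector_mult power2_eq_square mult_ac)

lemma block_vector_mult:
  "block A B C D *v stack a b = stack (A *v a + B *v b) (C *v a + D *v b)"
  for A :: "'a::comm_semiring_1^'n::finite^'n"
  by (simp add: vec_eq_iff all_Plus matrix_vector_mult_def sum_UNIV_Plus)

lemma one_minus_tanh_sq: "1 - (tanh t)\<^sup>2 = 1 / (cosh t)\<^sup>2" for t :: real
proof -
  have "1 + (sinh t)\<^sup>2 \<noteq> 0" using zero_le_power2[of "sinh t"] by linarith
  then show ?thesis by (simp add: tanh_def power_divide cosh_square_eq field_simps)
qed

text \<open>In the coordinates \<open>a \<plusminus> b\<close> the middle matrix of \<open>calH g\<close> becomes diagonal with the unimodular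
  entries \<open>tanh t \<mp> \<i> sech t\<close>.\<close>

lemma cmod_tanh_sech_form_le:
  "cmod (of_real (tanh t) * a\<^sup>2 + 2 * (- \<i> * of_real (1 / cosh t)) * a * b + of_real (tanh t) * b\<^sup>2)
   \<le> (cmod a)\<^sup>2 + (cmod b)\<^sup>2" for t :: real
proof -
  define e where "e = Complex (tanh t) (1 / cosh t)"
  have "(tanh t)\<^sup>2 + (1 / cosh t)\<^sup>2 = 1"
    using one_minus_tanh_sq[of t] by (simp add: power_divide)
  then have e: "cmod e = 1" by (simp add: e_def cmod_def)
  have "of_real (tanh t) * a\<^sup>2 + 2 * (- \<i> * of_real (1 / cosh t)) * a * b + of_real (tanh t) * b\<^sup>2
     = cnj e * (a + b)\<^sup>2 / 2 + e * (a - b)\<^sup>2 / 2"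
  proof -
    define T S where "T = complex_of_real (tanh t)" and "S = complex_of_real (1 / cosh t)"
    have "e = T + \<i> * S" "cnj e = T - \<i> * S" by (simp_all add: e_def T_def S_def complex_eq_iff)
    moreover have "T * a\<^sup>2 + 2 * (- \<i> * S) * a * b + T * b\<^sup>2
        = (T - \<i> * S) * (a + b)\<^sup>2 / 2 + (T + \<i> * S) * (a - b)\<^sup>2 / 2"
      by (simp add: power2_eq_square field_simps)
    ultimately show ?thesis by (simp only: T_def S_def)
  qed
  also have "cmod \<dots> \<le> (cmod (a + b))\<^sup>2 / 2 + (cmod (a - b))\<^sup>2 / 2"
    by (rule order_trans[OF norm_triangle_ineq]) (simp add: norm_mult norm_divide norm_power e)
  also have "\<dots> = (cmod a)\<^sup>2 + (cmod b)\<^sup>2"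
    unfolding cmod_power2 by (simp add: power2_eq_square field_simps)
  finally show ?thesis .
qed

text \<open>The outer factors of \<open>calH g\<close> are unitary and transposes of each other, so
  they change the vector but not its norm; the middle form decouples into the pairs
  \<open>(a' $ i, b' $ i)\<close>.\<close>

lemma cmod_bilin_calH_le:
  fixes g :: "'n::finite symat"
  assumes "g \<in> Sp"
  shows "cmod (bilin (calH g) (stack a b)) \<le> (norm a)\<^sup>2 + (norm b)\<^sup>2"
proof -
  obtain u v and t :: "real^'n" where uv: "unitarym u" "unitarym v"
    and X: "calH g = block (conjm u) 0 0 (transpose (conjm v))
       ** block (diagm (\<lambda>i. of_real (tanh (t $ i)))) (diagm (\<lambda>i. - \<i> * of_real (1 / cosh (t $ i))))
                (diagm (\<lambda>i. - \<i> * of_real (1 / cosh (t $ i)))) (diagm (\<lambda>i. of_real (tanh (t $ i))))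
       ** block (transpose (conjm u)) 0 0 (conjm v)" (is "_ = _ ** ?U ** ?R")
    using Sp_unitary_form[OF assms] by metis
  define a' b' where "a' = transpose (conjm u) *v a" and "b' = conjm v *v b"
  have "block (conjm u) 0 0 (transpose (conjm v)) = transpose ?R"
    by (simp add: transpose_block) (simp add: vec_eq_iff transpose_def zero_vec_def)
  then have "bilin (calH g) (stack a b) = bilin ?U (?R *v stack a b)"
    by (simp only: X bilin_congruence)
  also have "?R *v stack a b = stack a' b'"
    by (simp add: block_vector_mult a'_def b'_def)
  also have "bilin ?U (stack a' b') = (\<Sum>i\<in>UNIV. of_real (tanh (t $ i)) * (a' $ i)\<^sup>2
       + 2 * (- \<i> * of_real (1 / cosh (t $ i))) * a' $ i * b' $ i + of_real (tanh (t $ i)) * (b' $ i)\<^sup>2)"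
  proof -
    have "diagm d $ i $ j + diagm d $ j $ i = (if i = j then 2 * d i else 0)" for d :: "'n \<Rightarrow> complex" and i j
      by (simp add: diagm_def)
    then show ?thesis
      unfolding bilin_block bilin_diagm
      by (simp add: sum.distrib sum.delta if_distrib[of "\<lambda>y. _ * y"] if_distrib[of "\<lambda>y. y * _"] sum_negf
          sum_subtractf algebra_simps cong: if_cong)
  qed
  also have "cmod \<dots> \<le> (\<Sum>i\<in>UNIV. (cmod (a' $ i))\<^sup>2 + (cmod (b' $ i))\<^sup>2)"
    by (intro order_trans[OF norm_sum] sum_mono cmod_tanh_sech_form_le)
  also have "\<dots> = (norm a')\<^sup>2 + (norm b')\<^sup>2" by (simp add: sum.distrib norm_vec_sq)
  also have "\<dots> = (norm a)\<^sup>2 + (norm b)\<^sup>2"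
    unfolding a'_def b'_def using uv by (simp only: unitarym_norm_vector unitarym_adjoint unitarym_conjm)
  finally show ?thesis .
qed

text \<open>Isolates the block that acts on \<open>z\<close> alone. Finitely many values
  \<open>tanh (t $ i)\<close> stay away from 1 in modulus, so this block contracts strictly.
  Strictness is what puts \<open>omega x f\<close> into Fock space; for the whole matrix only the
  bound 1 is available.\<close>

lemma calH_blocks:
  fixes g :: "'n::finite symat"
  assumes "g \<in> Sp"
  obtains A B C D \<tau> where "calH g = block A B C D" "0 \<le> \<tau>" "\<tau> < 1"
    "\<And>z. cmod (bilin A z) \<le> \<tau> * (norm z)\<^sup>2"
proof -
  obtain u v and t :: "real^'n" where uv: "unitarym u" "unitarym v"
    and X: "calH g = block (conjm u) 0 0 (transpose (conjm v))
       ** block (diagm (\<lambda>i. of_real (tanh (t $ i)))) (diagm (\<lambda>i. - \<i> * of_real (1 / cosh (t $ i))))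
                (diagm (\<lambda>i. - \<i> * of_real (1 / cosh (t $ i)))) (diagm (\<lambda>i. of_real (tanh (t $ i))))
       ** block (transpose (conjm u)) 0 0 (conjm v)"
    using Sp_unitary_form[OF assms] by metis
  define \<tau> where "\<tau> = Max (range (\<lambda>i. \<bar>tanh (t $ i)\<bar>))"
  have \<tau>: "\<bar>tanh (t $ i)\<bar> \<le> \<tau>" for i unfolding \<tau>_def by (intro Max_ge) auto
  have "\<tau> \<in> range (\<lambda>i. \<bar>tanh (t $ i)\<bar>)" unfolding \<tau>_def by (rule Max_in) auto
  then have "0 \<le> \<tau>" "\<tau> < 1" using tanh_real_bounds by (auto simp: abs_less_iff minus_less_iff)
  define A where "A = conjm u ** diagm (\<lambda>i. complex_of_real (tanh (t $ i))) ** transpose (conjm u)"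
  have "cmod (bilin A z) \<le> \<tau> * (norm z)\<^sup>2" for z
  proof -
    define w where "w = transpose (conjm u) *v z"
    have "bilin A z = (\<Sum>i\<in>UNIV. of_real (tanh (t $ i)) * (w $ i)\<^sup>2)"
      unfolding w_def bilin_diagm[symmetric] bilin_congruence[symmetric] A_def by simp
    also have "cmod \<dots> \<le> (\<Sum>i\<in>UNIV. \<tau> * (cmod (w $ i))\<^sup>2)"
      by (intro order_trans[OF norm_sum] sum_mono)
        (auto simp: norm_mult norm_power intro!: mult_right_mono \<tau>)
    also have "\<dots> = \<tau> * (norm w)\<^sup>2"
      by (simp add: norm_vec_sq[of w] sum_distrib_left)
    also have "norm w = norm z" unfolding w_def by (intro unitarym_norm_vector unitarym_adjoint uv)
    finally show ?thesis .
  qed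
  moreover have zero: "0 ** A = 0" "A ** 0 = 0" for A :: "complex^'n^'n"
    by (simp_all add: vec_eq_iff matrix_matrix_mult_def)
  obtain B C D where "calH g = block A B C D"
    unfolding X block_mult A_def zero by simp
  ultimately show ?thesis using that \<open>0 \<le> \<tau>\<close> \<open>\<tau> < 1\<close> by blast
qed

lemma matrix_inv_nth:
  fixes A :: "'a::field^'n::finite^'n"
  assumes "det A \<noteq> 0"
  shows "matrix_inv A $ k $ l = det (\<chi> i j. if j = k then (if i = l then 1 else 0) else A $ i $ j) / det A"
proof -
  have "invertible A" using assms by (simp add: invertible_det_nz)
  then have "A ** matrix_inv A = mat 1"
    by (metis (mono_tags, lifting) invertible_def matrix_inv_def someI_ex)
  then have "A *v column l (matrix_inv A) = axis l 1"
    unfolding column_matrix_mult[symmetric] by (simp add: vec_eq_iff column_def mat_def axis_def)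
  from cramer[OF assms, THEN iffD1, OF this] have "column l (matrix_inv A) $ k
    = det (\<chi> i j. if j = k then axis l 1 $ i else A $ i $ j) / det A" by simp
  then show ?thesis by (simp add: column_def axis_def cong: if_cong)
qed

text \<open>Removes the choice: the blocks depend only on \<open>cpart g\<close> and
  \<open>apart g\<close>. In this form continuity in \<open>g\<close> can be read off.\<close>

lemma calH_eq:
  fixes g :: "'n::finite symat"
  assumes "g \<in> Sp"
  shows "calH g = block (conjm (apart g) ** matrix_inv (cpart g)) (\<chi> i j. - \<i> * matrix_inv (cpart g) $ j $ i)
     (\<chi> i j. - \<i> * matrix_inv (cpart g) $ i $ j) (matrix_inv (cpart g) ** apart g)"
proof -
  obtain u v and t :: "real^'n" where uv: "unitarym u" "unitarym v"
    and P: "cpart g = u ** diagm (\<lambda>i. complex_of_real (cosh (t $ i))) ** v"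
    and Q: "apart g = u ** diagm (\<lambda>i. complex_of_real (sinh (t $ i))) ** conjm v"
    and X: "calH g = block (conjm u) 0 0 (transpose (conjm v))
       ** block (diagm (\<lambda>i. of_real (tanh (t $ i)))) (diagm (\<lambda>i. - \<i> * of_real (1 / cosh (t $ i))))
                (diagm (\<lambda>i. - \<i> * of_real (1 / cosh (t $ i)))) (diagm (\<lambda>i. of_real (tanh (t $ i))))
       ** block (transpose (conjm u)) 0 0 (conjm v)"
    using Sp_unitary_form[OF assms] by metis
  let ?s = "diagm (\<lambda>i. complex_of_real (1 / cosh (t $ i)))"
  have zero: "0 ** A = 0" "A ** 0 = 0" for A :: "complex^'n^'n"
    by (simp_all add: vec_eq_iff matrix_matrix_mult_def)
  have c0: "cosh (t $ i) \<noteq> 0" for i using cosh_real_pos[of "t $ i"] by simp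
  note un = unitarym_right[OF uv(1)] unitarym_right[OF uv(2)] uv[unfolded unitarym_def]
  have "cpart g ** (transpose (conjm v) ** ?s ** transpose (conjm u)) =
      u ** (diagm (\<lambda>i. complex_of_real (cosh (t $ i))) ** (v ** transpose (conjm v)) ** ?s) ** transpose (conjm u)"
    by (simp add: P matrix_mul_assoc)
  also have "\<dots> = mat 1" by (simp add: un diagm_mult c0 diagm_1)
  finally have inv: "matrix_inv (cpart g) = transpose (conjm v) ** ?s ** transpose (conjm u)"
    by (rule matrix_inv_unique)
  have 1: "conjm (apart g) ** matrix_inv (cpart g)
      = conjm u ** diagm (\<lambda>i. of_real (tanh (t $ i))) ** transpose (conjm u)"
  proof -
    have "conjm (apart g) ** matrix_inv (cpart g)
       = conjm u ** (diagm (\<lambda>i. complex_of_real (sinh (t $ i))) ** (v ** transpose (conjm v)) ** ?s) ** transpose (conjm u)"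
      by (simp add: Q inv conjm_mult conjm_diagm matrix_mul_assoc)
    then show ?thesis by (simp add: un diagm_mult tanh_def)
  qed
  have 2: "matrix_inv (cpart g) ** apart g
      = transpose (conjm v) ** diagm (\<lambda>i. of_real (tanh (t $ i))) ** conjm v"
  proof -
    have "matrix_inv (cpart g) ** apart g
       = transpose (conjm v) ** (?s ** (transpose (conjm u) ** u) ** diagm (\<lambda>i. complex_of_real (sinh (t $ i)))) ** conjm v"
      by (simp add: Q inv matrix_mul_assoc)
    then show ?thesis by (simp add: un diagm_mult tanh_def)
  qed
  have d: "diagm (\<lambda>i. - \<i> * of_real (1 / cosh (t $ i))) = (\<chi> i j. - \<i> * ?s $ i $ j)"
    by (simp add: vec_eq_iff diagm_def)
  have sc: "A ** (\<chi> i j. - \<i> * S $ i $ j) ** B = (\<chi> i j. - \<i> * (A ** S ** B) $ i $ j)" for A S B :: "complex^'n^'n"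
    by (simp add: vec_eq_iff matrix_matrix_mult_def sum_distrib_left sum_distrib_right sum_negf mult_ac)
  have 3: "conjm u ** ?s ** conjm v = transpose (matrix_inv (cpart g))"
    unfolding inv by (simp add: matrix_transpose_mul matrix_mul_assoc)
  have "transpose (conjm v) ** diagm (\<lambda>i. - \<i> * of_real (1 / cosh (t $ i))) ** transpose (conjm u)
      = (\<chi> i j. - \<i> * matrix_inv (cpart g) $ i $ j)"
    unfolding d sc inv ..
  moreover have "conjm u ** diagm (\<lambda>i. - \<i> * of_real (1 / cosh (t $ i))) ** conjm v
      = (\<chi> i j. - \<i> * matrix_inv (cpart g) $ j $ i)"
    unfolding d sc 3 by (simp add: transpose_def)
  ultimately show ?thesis
    unfolding X block_mult zero 1 2 by simp
qed

lemma cmod_det_cpart: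
  fixes g :: "'n::finite symat"
  assumes "g \<in> Sp" shows "cmod (det (cpart g)) \<ge> 1"
proof -
  obtain u v and t :: "real^'n" where uv: "unitarym u" "unitarym v"
    and P: "cpart g = u ** diagm (\<lambda>i. complex_of_real (cosh (t $ i))) ** v"
    using Sp_unitary_form[OF assms] by metis
  have "cmod (det (cpart g)) = (\<Prod>i\<in>UNIV. cosh (t $ i))"
    using uv by (simp add: P det_mul det_diagm norm_mult cmod_det_unitarym prod_norm[symmetric])
  also have "\<dots> \<ge> 1" by (intro prod_ge_1 cosh_real_ge_1)
  finally show ?thesis .
qed

lemma continuous_on_det:
  fixes A :: "'x::topological_space \<Rightarrow> 'a::{real_normed_field}^'n::finite^'n"
  assumes "\<And>i j. continuous_on S (\<lambda>x. A x $ i $ j)"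
  shows "continuous_on S (\<lambda>x. det (A x))"
  unfolding det_def by (intro continuous_intros assms)

lemma continuous_on_cpart: "continuous_on S (\<lambda>g. cpart g $ i $ j)" for S :: "'n::finite symat set"
  by (simp add: cpart_def Complex_eq) (intro continuous_intros ballI; simp)

lemma continuous_on_apart: "continuous_on S (\<lambda>g. apart g $ i $ j)" for S :: "'n::finite symat set"
  by (simp add: apart_def Complex_eq) (intro continuous_intros ballI; simp)

text \<open>By Cramer's rule the inverse of \<open>cpart g\<close> is a quotient of polynomials in
  the entries, and the denominator does not vanish on \<open>Sp\<close>. Continuity is needed for
  the measurability of matrix coefficients.\<close>

lemma continuous_on_calH: "continuous_on Sp (\<lambda>g :: 'n::finite symat. calH g $ i $ j)"
proof -
  define c :: "'n symat \<Rightarrow> 'n \<Rightarrow> 'n \<Rightarrow> complex" where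
    "c g k l = det (\<chi> i j. if j = k then (if i = l then 1 else 0) else cpart g $ i $ j) / det (cpart g)" for g k l
  have d: "det (cpart g) \<noteq> 0" if "g \<in> Sp" for g :: "'n symat"
    using cmod_det_cpart[OF that] by auto
  have c: "matrix_inv (cpart g) $ k $ l = c g k l" if "g \<in> Sp" for g k l
    unfolding c_def by (rule matrix_inv_nth[OF d[OF that]])
  have cont: "continuous_on Sp (\<lambda>g. c g k l)" for k l
  proof -
    have "continuous_on Sp (\<lambda>g :: 'n symat. (\<chi> i j. if j = k then if i = l then 1 else 0 else cpart g $ i $ j) $ i $ j)" for i j
      by (cases "j = k") (simp_all add: continuous_on_cpart)
    then show ?thesis
      unfolding c_def using d
      by (intro continuous_on_divide continuous_on_det continuous_on_cpart) auto
  qed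
  have "calH g = block (\<chi> i j. \<Sum>k\<in>UNIV. cnj (apart g $ i $ k) * c g k j) (\<chi> i j. - \<i> * c g j i)
     (\<chi> i j. - \<i> * c g i j) (\<chi> i j. \<Sum>k\<in>UNIV. c g i k * apart g $ k $ j)" if "g \<in> Sp" for g
    unfolding calH_eq[OF that] by (simp add: c[OF that] matrix_matrix_mult_def)
  then have "continuous_on Sp (\<lambda>g. calH g $ i $ j) \<longleftrightarrow>
     continuous_on Sp (\<lambda>g :: 'n symat. block (\<chi> i j. \<Sum>k\<in>UNIV. cnj (apart g $ i $ k) * c g k j) (\<chi> i j. - \<i> * c g j i)
     (\<chi> i j. - \<i> * c g i j) (\<chi> i j. \<Sum>k\<in>UNIV. c g i k * apart g $ k $ j) $ i $ j)"
    by (intro continuous_on_cong refl) simp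
  also have \<dots>
    by (cases i; cases j) (simp_all, (intro continuous_intros cont continuous_on_apart)+)
  finally show ?thesis .
qed

section \<open>Norm estimates in the complex form\<close>

text \<open>The sum over \<open>i\<close> of \<open>cosh^2 - sinh^2 = 1\<close>, since the unitary
  factors do not change the Hilbert-Schmidt norm.\<close>

lemma norm_cpart_apart:
  fixes g :: "'n::finite symat"
  assumes "g \<in> Sp" shows "(norm (cpart g))\<^sup>2 = real CARD('n) + (norm (apart g))\<^sup>2"
proof -
  obtain u v and t :: "real^'n" where uv: "unitarym u" "unitarym v"
    and P: "cpart g = u ** diagm (\<lambda>i. complex_of_real (cosh (t $ i))) ** v"
    and Q: "apart g = u ** diagm (\<lambda>i. complex_of_real (sinh (t $ i))) ** conjm v"
    using Sp_unitary_form[OF assms] by metis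
  have d: "(norm (diagm d))\<^sup>2 = (\<Sum>i\<in>UNIV. (cmod (d i))\<^sup>2)" for d :: "'n \<Rightarrow> complex"
    by (simp add: norm_vec_sq diagm_def if_distrib[of norm] if_distrib[of "\<lambda>y. y\<^sup>2"] sum.delta cong: if_cong)
  have "(norm (cpart g))\<^sup>2 = (\<Sum>i\<in>UNIV. (cosh (t $ i))\<^sup>2)"
    using uv by (simp add: P norm_unitarym_mult_left norm_unitarym_mult_right d)
  moreover have "(norm (apart g))\<^sup>2 = (\<Sum>i\<in>UNIV. (sinh (t $ i))\<^sup>2)"
    using uv by (simp add: Q norm_unitarym_mult_left norm_unitarym_mult_right unitarym_conjm d)
  ultimately show ?thesis by (simp add: cosh_square_eq sum.distrib)
qed

text \<open>The block matrix formed by \<open>cpart g\<close>, \<open>apart g\<close> and their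
  conjugates lies in U(n,n). In Cartan coordinates it consists of hyperbolic rotations in each
  coordinate, framed by unitary maps.\<close>

lemma pseudounitary_form:
  fixes g :: "'n::finite symat"
  assumes "g \<in> Sp"
  shows "(norm (conjm (apart g) *v a + conjm (cpart g) *v b))\<^sup>2 - (norm (cpart g *v a + apart g *v b))\<^sup>2
    = (norm b)\<^sup>2 - (norm a)\<^sup>2"
proof -
  obtain u v and t :: "real^'n" where uv: "unitarym u" "unitarym v"
    and P: "cpart g = u ** diagm (\<lambda>i. complex_of_real (cosh (t $ i))) ** v"
    and Q: "apart g = u ** diagm (\<lambda>i. complex_of_real (sinh (t $ i))) ** conjm v"
    using Sp_unitary_form[OF assms] by metis
  let ?c = "diagm (\<lambda>i. complex_of_real (cosh (t $ i)))" and ?s = "diagm (\<lambda>i. complex_of_real (sinh (t $ i)))"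
  define a' b' where "a' = v *v a" and "b' = conjm v *v b"
  have n: "norm a' = norm a" "norm b' = norm b"
    using uv by (simp_all add: a'_def b'_def unitarym_norm_vector unitarym_conjm)
  have "conjm (apart g) *v a + conjm (cpart g) *v b = conjm u *v (?s *v a' + ?c *v b')"
    by (simp add: P Q a'_def b'_def conjm_mult conjm_diagm matrix_vector_right_distrib matrix_vector_mul_assoc matrix_mul_assoc)
  moreover have "cpart g *v a + apart g *v b = u *v (?c *v a' + ?s *v b')"
    by (simp add: P Q a'_def b'_def matrix_vector_right_distrib matrix_vector_mul_assoc matrix_mul_assoc)
  moreover have "(norm (?s *v a' + ?c *v b'))\<^sup>2 - (norm (?c *v a' + ?s *v b'))\<^sup>2 = (norm b')\<^sup>2 - (norm a')\<^sup>2"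
  proof -
    have "(cmod (of_real s * x + of_real c * y))\<^sup>2 - (cmod (of_real c * x + of_real s * y))\<^sup>2
        = (c\<^sup>2 - s\<^sup>2) * ((cmod y)\<^sup>2 - (cmod x)\<^sup>2)" for s c :: real and x y
      unfolding cmod_power2 by (simp add: power2_eq_square algebra_simps)
    then show ?thesis
      by (simp add: norm_vec_sq diagm_vector_mult sum_subtractf[symmetric] cosh_square_eq)
  qed
  ultimately show ?thesis using uv n by (simp add: unitarym_norm_vector unitarym_conjm)
qed

text \<open>Every real entry of \<open>g\<close> is a sum or difference of real or imaginary parts
  of entries of \<open>cpart g\<close> and \<open>apart g\<close>, and there are
  \<open>(2n)^2\<close> entries.\<close>

lemma norm_symat_le: "norm g \<le> 4 * (real CARD('n))\<^sup>2 * (norm (cpart g) + norm (apart g))"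
  for g :: "'n::finite symat"
proof -
  have e: "cmod (A $ i $ j) \<le> norm A" for A :: "complex^'n^'n" and i j
    by (rule order_trans[OF Finite_Cartesian_Product.norm_nth_le Finite_Cartesian_Product.norm_nth_le])
  have r: "\<bar>Re (cpart g $ i $ j)\<bar> \<le> norm (cpart g)" "\<bar>Im (cpart g $ i $ j)\<bar> \<le> norm (cpart g)"
    "\<bar>Re (apart g $ i $ j)\<bar> \<le> norm (apart g)" "\<bar>Im (apart g $ i $ j)\<bar> \<le> norm (apart g)" for i j
    using e abs_Re_le_cmod abs_Im_le_cmod order_trans by blast+
  have "\<bar>g $ a $ b\<bar> \<le> norm (cpart g) + norm (apart g)" for a b
  proof (cases a; cases b)
    fix i j assume "a = Inl i" "b = Inl j"
    then show ?thesis using r(1,3)[of i j] by (simp add: cpart_def apart_def)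
  next
    fix i j assume "a = Inr i" "b = Inr j"
    then show ?thesis using r(1,3)[of i j] by (simp add: cpart_def apart_def)
  next
    fix i j assume "a = Inl i" "b = Inr j"
    then show ?thesis using r(2,4)[of i j] by (simp add: cpart_def apart_def)
  next
    fix i j assume "a = Inr i" "b = Inl j"
    then show ?thesis using r(2,4)[of i j] by (simp add: cpart_def apart_def)
  qed
  then have "(\<Sum>a\<in>UNIV. \<Sum>b\<in>UNIV. \<bar>g $ a $ b\<bar>) \<le> (\<Sum>a\<in>(UNIV::('n+'n) set). \<Sum>b\<in>(UNIV::('n+'n) set). norm (cpart g) + norm (apart g))"
    by (intro sum_mono)
  moreover have "norm g \<le> (\<Sum>a\<in>UNIV. \<Sum>b\<in>UNIV. \<bar>g $ a $ b\<bar>)"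
  proof -
    have "norm g \<le> (\<Sum>a\<in>UNIV. norm (g $ a))" unfolding norm_vec_def by (rule L2_set_le_sum) auto
    also have "\<dots> \<le> (\<Sum>a\<in>UNIV. \<Sum>b\<in>UNIV. \<bar>g $ a $ b\<bar>)" by (intro sum_mono norm_le_l1_cart)
    finally show ?thesis .
  qed
  ultimately show ?thesis by (simp add: power2_eq_square card_UNIV_sum algebra_simps)
qed

section \<open>Analysis on Fock space\<close>

section \<open>Gaussian integrals and isometries\<close>

lemma nn_integral_exp_norm_sq:
  assumes "a > 0"
  shows "(\<integral>\<^sup>+x. ennreal (exp (- a * (norm (x :: 'a::euclidean_space))\<^sup>2)) \<partial>lborel) = ennreal (sqrt (pi / a) ^ DIM('a))"
proof -
  have "(\<integral>\<^sup>+x. ennreal (exp (- a * (norm (x :: 'a))\<^sup>2)) \<partial>lborel)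
    = (\<integral>\<^sup>+x. (\<Prod>b\<in>Basis. ennreal (exp (- a * ((x :: 'a) \<bullet> b)\<^sup>2))) \<partial>lborel)"
  proof (rule nn_integral_cong)
    fix x :: 'a
    have "(norm x)\<^sup>2 = (\<Sum>b\<in>Basis. (x \<bullet> b)\<^sup>2)"
      unfolding power2_norm_eq_inner by (subst euclidean_inner) (simp add: power2_eq_square)
    then show "ennreal (exp (- a * (norm x)\<^sup>2)) = (\<Prod>b\<in>Basis. ennreal (exp (- a * (x \<bullet> b)\<^sup>2)))"
      by (simp add: prod_ennreal exp_sum[symmetric] sum_distrib_left sum_negf)
  qed
  also have "\<dots> = (\<Prod>b\<in>(Basis :: 'a set). \<integral>\<^sup>+x. ennreal (exp (- a * x\<^sup>2)) \<partial>lborel)"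
    by (rule nn_integral_lborel_prod) auto
  also have "(\<integral>\<^sup>+x. ennreal (exp (- a * x\<^sup>2)) \<partial>lborel) = ennreal (sqrt (pi / a))"
  proof -
    \<comment> \<open>The standard deviation for which the normal density has the exponent
      \<open>- a * x^2\<close>.\<close>
    define \<sigma> where "\<sigma> = sqrt (1 / (2 * a))"
    have \<sigma>: "\<sigma> > 0" "\<sigma>\<^sup>2 = 1 / (2 * a)" using assms by (simp_all add: \<sigma>_def)
    have e: "exp (- a * x\<^sup>2) = sqrt (pi / a) * normal_density 0 \<sigma> x" for x
      using assms \<sigma> by (simp add: normal_density_def)
    have i: "integrable lborel (normal_density 0 \<sigma>)"
      using \<sigma>(1) by (rule integrable_normal_density)
    have "(\<integral>\<^sup>+x. ennreal (exp (- a * x\<^sup>2)) \<partial>lborel) = ennreal (\<integral>x. sqrt (pi / a) * normal_density 0 \<sigma> x \<partial>lborel)"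
      unfolding e using i assms by (intro nn_integral_eq_integral) auto
    then show ?thesis using \<sigma>(1) by simp
  qed
  finally show ?thesis using assms by (simp add: ennreal_power)
qed

lemma nn_integral_exp_norm_sq_finite:
  "a > 0 \<Longrightarrow> (\<integral>\<^sup>+x. ennreal (exp (- a * (norm (x :: 'a::euclidean_space))\<^sup>2)) \<partial>lborel) < \<infinity>"
  by (simp only: nn_integral_exp_norm_sq) simp

lemma nn_integral_lborel_translate:
  "(\<integral>\<^sup>+x. f (c + x) \<partial>lborel) = (\<integral>\<^sup>+x. f x \<partial>lborel)"
  if "f \<in> borel_measurable borel" for f :: "'a::euclidean_space \<Rightarrow> ennreal"
proof -
  have "(\<integral>\<^sup>+x. f x \<partial>lborel) = (\<integral>\<^sup>+x. f x \<partial>distr lborel borel ((+) c))" by (simp add: lborel_distr_plus)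
  also have "\<dots> = (\<integral>\<^sup>+x. f (c + x) \<partial>lborel)" using that by (subst nn_integral_distr) auto
  finally show ?thesis ..
qed

lemma nn_integral_lborel_reflect:
  "(\<integral>\<^sup>+x. f (c - x) \<partial>lborel) = (\<integral>\<^sup>+x. f x \<partial>lborel)"
  if "f \<in> borel_measurable borel" for f :: "'a::euclidean_space \<Rightarrow> ennreal"
proof -
  have "(\<integral>\<^sup>+x. f x \<partial>lborel) = (\<integral>\<^sup>+x. f x \<partial>density (distr lborel borel (\<lambda>x. c + (- 1) *\<^sub>R x)) (\<lambda>_. ennreal (\<bar>- 1\<bar> ^ DIM('a))))"
    by (subst lborel_affine[symmetric]) auto
  also have "\<dots> = (\<integral>\<^sup>+x. f (c - x) \<partial>lborel)"
    using that by (subst nn_integral_density, simp, simp, subst nn_integral_distr) auto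
  finally show ?thesis ..
qed

text \<open>The uniqueness argument for invariant measures, with the rotation invariant weight \<open>exp (- |x|\<^sup>2)\<close>.\<close>

lemma lborel_distr_isometry:
  fixes T :: "'a::euclidean_space \<Rightarrow> 'a"
  assumes lin: "linear T" and iso: "\<And>x. norm (T x) = norm x"
  shows "distr lborel borel T = lborel"
proof (rule measure_eqI)
  fix A assume "A \<in> sets (distr lborel borel T)"
  then have A[measurable]: "A \<in> sets borel" by simp
  have T[measurable]: "T \<in> borel_measurable borel"
    using linear_continuous_on[OF lin[unfolded linear_conv_bounded_linear]]
    by (rule borel_measurable_continuous_onI)
  have "inj T" using lin iso by (metis linear_injective_0 norm_eq_zero)
  then have surj: "surj T" using lin linear_injective_imp_surjective by blast
  define g :: "'a \<Rightarrow> ennreal" where "g x = ennreal (exp (- 1 * (norm x)\<^sup>2))" for x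
  have g[measurable]: "g \<in> borel_measurable borel" unfolding g_def by measurable
  define G where "G = (\<integral>\<^sup>+x. g x \<partial>lborel)"
  have "G < \<infinity>" unfolding G_def g_def by (rule nn_integral_exp_norm_sq_finite) simp
  moreover have "G \<noteq> 0"
  proof
    assume "G = 0"
    then have "AE x in (lborel :: 'a measure). g x = 0" unfolding G_def by (subst (asm) nn_integral_0_iff_AE) auto
    then have "AE x in (lborel :: 'a measure). False" by (simp add: g_def)
    then show False by (simp add: AE_iff_null null_sets_def emeasure_lborel_UNIV)
  qed
  moreover have "emeasure (distr lborel borel T) A * G = emeasure lborel A * G"
  proof -
    have "emeasure (distr lborel borel T) A * G = (\<integral>\<^sup>+x. indicator A (T x) \<partial>lborel) * G"
    proof -
      have "emeasure (distr lborel borel T) A = (\<integral>\<^sup>+x. indicator A x \<partial>distr lborel borel T)" by simp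
      also have "\<dots> = (\<integral>\<^sup>+x. indicator A (T x) \<partial>lborel)"
        by (subst nn_integral_distr) auto
      finally show ?thesis by simp
    qed
    also have "\<dots> = (\<integral>\<^sup>+x. (\<integral>\<^sup>+y. indicator A (T x) * g (T x + y) \<partial>lborel) \<partial>lborel)"
      by (subst nn_integral_multc[symmetric], measurable)
        (simp add: nn_integral_cmult nn_integral_lborel_translate G_def)
    also have "\<dots> = (\<integral>\<^sup>+y. (\<integral>\<^sup>+x. indicator A (T x) * g (T x + y) \<partial>lborel) \<partial>lborel)"
      by (rule lborel_pair.Fubini') measurable
    also have "\<dots> = (\<integral>\<^sup>+y. (\<integral>\<^sup>+x. indicator A (T x - y) * g (T x) \<partial>lborel) \<partial>lborel)"
    proof (rule nn_integral_cong)
      fix y :: 'a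
      \<comment> \<open>Since \<open>T\<close> is onto, the shift by \<open>y\<close> in the image
        can be undone by a shift of the variable \<open>x\<close> itself.\<close>
      obtain s where s: "T s = y" using surj by (metis surjD)
      have "(\<integral>\<^sup>+x. indicator A (T x) * g (T x + y) \<partial>lborel)
          = (\<integral>\<^sup>+x. indicator A (T (- s + x)) * g (T (- s + x) + y) \<partial>lborel)"
        by (rule nn_integral_lborel_translate[symmetric]) measurable
      also have "\<dots> = (\<integral>\<^sup>+x. indicator A (T x - y) * g (T x) \<partial>lborel)"
        by (simp add: linear_diff[OF lin] s)
      finally show "(\<integral>\<^sup>+x. indicator A (T x) * g (T x + y) \<partial>lborel) = \<dots>" .
    qed
    also have "\<dots> = (\<integral>\<^sup>+x. (\<integral>\<^sup>+y. indicator A (T x - y) * g (T x) \<partial>lborel) \<partial>lborel)"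
      by (rule lborel_pair.Fubini') measurable
    also have "\<dots> = (\<integral>\<^sup>+x. emeasure lborel A * g (T x) \<partial>lborel)"
    proof (rule nn_integral_cong)
      fix x
      have "(\<integral>\<^sup>+y. indicator A (T x - y) * g (T x) \<partial>lborel) = (\<integral>\<^sup>+y. indicator A (T x - y) \<partial>lborel) * g (T x)"
        by (rule nn_integral_multc) measurable
      also have "(\<integral>\<^sup>+y. indicator A (T x - y) \<partial>lborel) = (\<integral>\<^sup>+y. indicator A y \<partial>lborel)"
        by (rule nn_integral_lborel_reflect) measurable
      finally show "(\<integral>\<^sup>+y. indicator A (T x - y) * g (T x) \<partial>lborel) = emeasure lborel A * g (T x)" by simp
    qed
    also have "\<dots> = emeasure lborel A * G"
      by (subst nn_integral_cmult) (auto simp: G_def g_def iso)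
    finally show ?thesis .
  qed
  ultimately show "emeasure (distr lborel borel T) A = emeasure lborel A"
    using ennreal_mult_cancel_left[of G "emeasure (distr lborel borel T) A" "emeasure lborel A"]
    by (auto simp: mult.commute[of G])
qed simp

lemma nn_integral_lborel_isometry:
  fixes T :: "'a::euclidean_space \<Rightarrow> 'a"
  assumes "linear T" "\<And>x. norm (T x) = norm x" and f[measurable]: "f \<in> borel_measurable borel"
  shows "(\<integral>\<^sup>+x. f (T x) \<partial>lborel) = (\<integral>\<^sup>+x. f x \<partial>lborel)"
proof -
  have T[measurable]: "T \<in> borel_measurable borel"
    using linear_continuous_on[OF assms(1)[unfolded linear_conv_bounded_linear]]
    by (rule borel_measurable_continuous_onI)
  have "(\<integral>\<^sup>+x. f x \<partial>lborel) = (\<integral>\<^sup>+x. f x \<partial>distr lborel borel T)"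
    by (simp add: lborel_distr_isometry[OF assms(1,2)])
  then show ?thesis by (simp add: nn_integral_distr)
qed

section \<open>The measure \<open>gauss\<close>\<close>

lemma sets_gauss [measurable_cong, simp]: "sets gauss = sets borel"
  by (simp add: gauss_def)

lemma space_gauss [simp]: "space gauss = UNIV"
  by (simp add: gauss_def)

lemma power_le_exp_sq:
  assumes "a > 0" shows "\<exists>K\<ge>0. \<forall>r\<ge>0::real. (1 + r) ^ m \<le> K * exp (a * r\<^sup>2)"
proof (intro exI conjI allI impI)
  fix r :: real assume "r \<ge> 0"
  have "(1 + r) ^ m / fact m \<le> exp (1 + r)"
  proof -
    note e = exp_converges[of "1 + r"]
    have "(\<Sum>n\<in>{m}. (1 + r) ^ n /\<^sub>R fact n) \<le> suminf (\<lambda>n. (1 + r) ^ n /\<^sub>R fact n)"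
      using \<open>r \<ge> 0\<close> by (intro sum_le_suminf sums_summable[OF e]) auto
    then show ?thesis using sums_unique[OF e] by (simp add: divide_inverse mult.commute)
  qed
  then have "(1 + r) ^ m \<le> fact m * exp (1 + r)" by (simp add: field_simps)
  \<comment> \<open>Completing the square absorbs the linear exponent into the quadratic one at the
    cost of a constant.\<close>
  also have "exp (1 + r) \<le> exp (1 + 1 / (4 * a) + a * r\<^sup>2)"
  proof -
    have "0 \<le> (2 * a * r - 1)\<^sup>2 / (4 * a)" using assms by simp
    also have "\<dots> = a * r\<^sup>2 - r + 1 / (4 * a)" using assms by (simp add: power2_eq_square field_simps)
    finally show ?thesis by simp
  qed
  finally show "(1 + r) ^ m \<le> (fact m * exp (1 + 1 / (4 * a))) * exp (a * r\<^sup>2)"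
    by (simp add: exp_add mult_left_mono mult.assoc)
qed simp

lemma nn_integral_gauss_finite:
  fixes c :: real
  assumes "c < 1 / 2"
  shows "(\<integral>\<^sup>+z. ennreal ((1 + norm z) ^ m * exp (c * (norm z)\<^sup>2)) \<partial>(gauss :: (complex^'n::finite) measure)) < \<infinity>"
proof -
  \<comment> \<open>Half of the gap between \<open>c\<close> and the critical value 1/2 pays for the
    polynomial factor; the other half leaves a convergent Gaussian.\<close>
  define a where "a = (1 / 2 - c) / 2"
  have "a > 0" using assms by (simp add: a_def)
  then obtain K where K: "K \<ge> 0" "\<And>r. r \<ge> 0 \<Longrightarrow> (1 + r) ^ m \<le> K * exp (a * r\<^sup>2)"
    using power_le_exp_sq by blast
  have "(\<integral>\<^sup>+z. ennreal ((1 + norm z) ^ m * exp (c * (norm z)\<^sup>2)) \<partial>(gauss :: (complex^'n) measure))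
     = (\<integral>\<^sup>+z. ennreal (exp (- (norm z)\<^sup>2 / 2) / (2 * pi) ^ CARD('n)) * ennreal ((1 + norm z) ^ m * exp (c * (norm z)\<^sup>2)) \<partial>(lborel :: (complex^'n) measure))"
    unfolding gauss_def by (subst nn_integral_density) auto
  also have "\<dots> \<le> (\<integral>\<^sup>+z. ennreal (K / (2 * pi) ^ CARD('n)) * ennreal (exp (- a * (norm z)\<^sup>2)) \<partial>(lborel :: (complex^'n) measure))"
  proof (rule nn_integral_mono)
    fix z :: "complex^'n"
    have "exp (- (norm z)\<^sup>2 / 2) * ((1 + norm z) ^ m * exp (c * (norm z)\<^sup>2))
       \<le> exp (- (norm z)\<^sup>2 / 2) * ((K * exp (a * (norm z)\<^sup>2)) * exp (c * (norm z)\<^sup>2))"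
      by (intro mult_left_mono mult_right_mono K(2)) auto
    also have "\<dots> = K * exp (- a * (norm z)\<^sup>2)"
      by (simp add: exp_add[symmetric] a_def field_simps)
    finally show "ennreal (exp (- (norm z)\<^sup>2 / 2) / (2 * pi) ^ CARD('n)) * ennreal ((1 + norm z) ^ m * exp (c * (norm z)\<^sup>2))
       \<le> ennreal (K / (2 * pi) ^ CARD('n)) * ennreal (exp (- a * (norm z)\<^sup>2))"
      using K(1) by (subst (1 2) ennreal_mult[symmetric]) (auto intro!: ennreal_leI simp: divide_right_mono)
  qed
  also have "\<dots> < \<infinity>"
    using nn_integral_exp_norm_sq_finite[OF \<open>a > 0\<close>, where 'a = "complex^'n"]
    by (subst nn_integral_cmult) (auto simp: ennreal_mult_less_top)
  finally show ?thesis .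
qed

lemma integrable_gaussI:
  fixes f :: "complex^'n::finite \<Rightarrow> 'a::{banach, second_countable_topology}"
  assumes [measurable]: "f \<in> borel_measurable borel" and "c < 1 / 2"
    and f: "\<And>z. norm (f z) \<le> C * ((1 + norm z) ^ m * exp (c * (norm z)\<^sup>2))"
  shows "integrable gauss f"
proof (rule integrableI_bounded)
  have "(\<integral>\<^sup>+z. ennreal (norm (f z)) \<partial>gauss)
      \<le> (\<integral>\<^sup>+z. ennreal \<bar>C\<bar> * ennreal ((1 + norm z) ^ m * exp (c * (norm z)\<^sup>2)) \<partial>(gauss :: (complex^'n) measure))"
  proof (rule nn_integral_mono)
    fix z :: "complex^'n"
    have "norm (f z) \<le> \<bar>C\<bar> * ((1 + norm z) ^ m * exp (c * (norm z)\<^sup>2))"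
      by (rule order_trans[OF f]) (auto intro!: mult_right_mono)
    then show "ennreal (norm (f z)) \<le> ennreal \<bar>C\<bar> * ennreal ((1 + norm z) ^ m * exp (c * (norm z)\<^sup>2))"
      by (simp add: ennreal_mult'[symmetric] ennreal_leI)
  qed
  also have "\<dots> < \<infinity>"
    using nn_integral_gauss_finite[OF assms(2), where 'n = 'n]
    by (subst nn_integral_cmult) (auto simp: ennreal_mult_less_top)
  finally show "(\<integral>\<^sup>+z. ennreal (norm (f z)) \<partial>gauss) < \<infinity>" .
qed simp

lemma integral_gauss_rotate:
  fixes f :: "complex^'n::finite \<Rightarrow> complex"
  assumes f[measurable]: "f \<in> borel_measurable borel" and e: "cmod e = 1"
  shows "(\<integral>w. f (e *s w) \<partial>gauss) = (\<integral>w. f w \<partial>gauss)"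
proof -
  define T :: "complex^'n \<Rightarrow> complex^'n" where "T w = e *s w" for w
  have lin: "linear T"
    by (rule linearI) (auto simp: T_def vec_eq_iff vector_scalar_mult_def algebra_simps)
  have iso: "norm (T w) = norm w" for w
    by (simp add: T_def norm_vec_def norm_mult e)
  have T[measurable]: "T \<in> borel_measurable borel"
    using linear_continuous_on[OF lin[unfolded linear_conv_bounded_linear]]
    by (rule borel_measurable_continuous_onI)
  have "distr gauss borel T = gauss"
  proof (rule measure_eqI)
    fix A assume "A \<in> sets (distr gauss borel T)"
    then have [measurable]: "A \<in> sets borel" by simp
    define h where "h z = ennreal (exp (- (norm z)\<^sup>2 / 2) / (2 * pi) ^ CARD('n))" for z :: "complex^'n"
    have [measurable]: "h \<in> borel_measurable borel" unfolding h_def by measurable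
    have "emeasure (distr gauss borel T) A = emeasure gauss (T -` A)"
      by (subst emeasure_distr) auto
    also have "\<dots> = (\<integral>\<^sup>+z. h z * indicator A (T z) \<partial>lborel)"
      unfolding gauss_def h_def[symmetric]
      by (subst emeasure_density) (auto intro!: nn_integral_cong simp: indicator_def measurable_sets_borel[OF T])
    also have "\<dots> = (\<integral>\<^sup>+z. h (T z) * indicator A (T z) \<partial>lborel)"
      by (simp add: h_def iso)
    also have "\<dots> = (\<integral>\<^sup>+z. h z * indicator A z \<partial>lborel)"
      by (rule nn_integral_lborel_isometry[OF lin iso]) measurable
    also have "\<dots> = emeasure gauss A"
      unfolding gauss_def h_def[symmetric] by (subst emeasure_density) auto
    finally show "emeasure (distr gauss borel T) A = emeasure gauss A" .
  qed simp
  then have "(\<integral>w. f w \<partial>gauss) = (\<integral>w. f w \<partial>distr gauss borel T)" by simp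
  also have "\<dots> = (\<integral>w. f (T w) \<partial>gauss)" by (rule integral_distr) auto
  finally show ?thesis by (simp add: T_def)
qed

section \<open>Polynomials\<close>

definition mono_fun :: "('n::finite \<Rightarrow> nat) \<Rightarrow> complex^'n \<Rightarrow> complex" where
  "mono_fun \<alpha> z = (\<Prod>i\<in>UNIV. (z $ i) ^ \<alpha> i)"

lemma polys_eq: "polys = {f. \<exists>S c. finite S \<and> f = (\<lambda>z. \<Sum>\<alpha>\<in>S. c \<alpha> * mono_fun \<alpha> z)}"
  by (simp add: polys_def mono_fun_def)

lemma polys_mono: "(\<lambda>z. c * mono_fun \<alpha> z) \<in> polys"
  unfolding polys_eq by (auto intro!: exI[of _ "{\<alpha>}"] exI[of _ "\<lambda>_. c"])

lemma polys_add: "f \<in> polys \<Longrightarrow> g \<in> polys \<Longrightarrow> (\<lambda>z. f z + g z) \<in> polys"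
proof -
  assume "f \<in> polys" "g \<in> polys"
  then obtain S c T d where S: "finite S" "f = (\<lambda>z. \<Sum>\<alpha>\<in>S. c \<alpha> * mono_fun \<alpha> z)"
    and T: "finite T" "g = (\<lambda>z. \<Sum>\<alpha>\<in>T. d \<alpha> * mono_fun \<alpha> z)" by (auto simp: polys_eq)
  have restrict: "(\<Sum>\<alpha>\<in>S \<union> T. (if \<alpha> \<in> A then e \<alpha> else 0) * mono_fun \<alpha> z) = (\<Sum>\<alpha>\<in>A. e \<alpha> * mono_fun \<alpha> z)"
    if "A \<subseteq> S \<union> T" for A e z
    using that S(1) T(1) by (intro sum.mono_neutral_cong_right) auto
  have eq: "(\<lambda>z. f z + g z) = (\<lambda>z. \<Sum>\<alpha>\<in>S \<union> T.
      ((if \<alpha> \<in> S then c \<alpha> else 0) + (if \<alpha> \<in> T then d \<alpha> else 0)) * mono_fun \<alpha> z)"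
    by (simp add: distrib_right sum.distrib restrict S(2) T(2))
  have fin: "finite (S \<union> T)" using S T by simp
  show ?thesis
    unfolding polys_eq by (rule CollectI, rule exI, rule exI, rule conjI, rule fin, rule eq)
qed

lemma polys_zero: "(\<lambda>z. 0) \<in> polys"
  using polys_mono[of 0] by simp

lemma polys_sum: "(\<And>i. i \<in> I \<Longrightarrow> f i \<in> polys) \<Longrightarrow> (\<lambda>z. \<Sum>i\<in>I. f i z) \<in> polys"
  by (induction I rule: infinite_finite_induct) (auto intro: polys_add polys_zero)

lemma polys_induct [consumes 1, case_names mono add]:
  assumes "f \<in> polys"
    and mono: "\<And>c \<alpha>. P (\<lambda>z. c * mono_fun \<alpha> z)"
    and add: "\<And>f g. f \<in> polys \<Longrightarrow> g \<in> polys \<Longrightarrow> P f \<Longrightarrow> P g \<Longrightarrow> P (\<lambda>z. f z + g z)"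
  shows "P f"
proof -
  obtain S c where S: "finite S" "f = (\<lambda>z. \<Sum>\<alpha>\<in>S. c \<alpha> * mono_fun \<alpha> z)"
    using assms(1) by (auto simp: polys_eq)
  have "P (\<lambda>z. \<Sum>\<alpha>\<in>S. c \<alpha> * mono_fun \<alpha> z)" using S(1)
  proof induction
    case empty
    then show ?case using mono[of 0] by simp
  next
    case (insert \<alpha> S)
    then show ?case by (simp add: add mono polys_mono polys_sum)
  qed
  then show ?thesis by (simp add: S(2))
qed

lemma polys_mult: "f \<in> polys \<Longrightarrow> g \<in> polys \<Longrightarrow> (\<lambda>z. f z * g z) \<in> polys"
proof (induction f rule: polys_induct)
  case (mono c \<alpha>)
  then show ?case
  proof (induction g rule: polys_induct)
    case (mono d \<beta>)
    have "(\<lambda>z. c * mono_fun \<alpha> z * (d * mono_fun \<beta> z)) = (\<lambda>z. (c * d) * mono_fun (\<lambda>i. \<alpha> i + \<beta> i) z)"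
      by (simp add: mono_fun_def power_add prod.distrib mult_ac)
    then show ?case by (simp only: polys_mono)
  qed (simp add: distrib_left polys_add)
qed (simp add: distrib_right polys_add)

lemma polys_const: "(\<lambda>z. c) \<in> polys"
  using polys_mono[of c "\<lambda>_. 0"] by (simp add: mono_fun_def)

lemma polys_cmult: "f \<in> polys \<Longrightarrow> (\<lambda>z. c * f z) \<in> polys"
  by (intro polys_mult polys_const)

lemma polys_power: "f \<in> polys \<Longrightarrow> (\<lambda>z. f z ^ k) \<in> polys"
  by (induction k) (auto intro: polys_mult polys_const)

lemma polys_nth: "(\<lambda>z. z $ i) \<in> polys"
proof -
  have "mono_fun (\<lambda>j. if j = i then 1 else 0) z = z $ i" for z :: "complex^'a"
    by (simp add: mono_fun_def if_distrib[of "\<lambda>k. _ ^ k"] prod.delta cong: if_cong)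
  then show ?thesis using polys_mono[of 1 "\<lambda>j. if j = i then 1 else 0"] by simp
qed

text \<open>The kernel of \<open>omega x\<close> depends on \<open>w\<close> through its conjugate,
  so polynomials in \<open>w\<close> do not suffice as integrands; measurability and polynomial
  growth are what the Gaussian integrals ask for.\<close>

definition polybdd :: "(complex^'n::finite \<Rightarrow> complex) \<Rightarrow> bool" where
  "polybdd q \<longleftrightarrow> q \<in> borel_measurable borel \<and> (\<exists>C m. \<forall>w. cmod (q w) \<le> C * (1 + norm w) ^ m)"

lemma polybdd_measurable: "polybdd q \<Longrightarrow> q \<in> borel_measurable borel"
  by (simp add: polybdd_def)

lemma polybddE:
  assumes "polybdd q" obtains C m where "C \<ge> 0" "\<And>w. cmod (q w) \<le> C * (1 + norm w) ^ m"
proof -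
  obtain C m where C: "\<And>w. cmod (q w) \<le> C * (1 + norm w) ^ m" using assms by (auto simp: polybdd_def)
  have "C \<ge> 0" using order_trans[OF norm_ge_zero C[of 0]] by simp
  with C that show ?thesis by blast
qed

lemma polybdd_const: "polybdd (\<lambda>w. c)"
  unfolding polybdd_def by (auto intro!: exI[of _ "cmod c"] exI[of _ "0::nat"])

lemma polybdd_mult: "polybdd p \<Longrightarrow> polybdd q \<Longrightarrow> polybdd (\<lambda>w. p w * q w)"
proof -
  assume p: "polybdd p" and q: "polybdd q"
  obtain C m where C: "C \<ge> 0" "\<And>w. cmod (p w) \<le> C * (1 + norm w) ^ m" using polybddE[OF p] by metis
  obtain D k where D: "D \<ge> 0" "\<And>w. cmod (q w) \<le> D * (1 + norm w) ^ k" using polybddE[OF q] by metis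
  have "cmod (p w * q w) \<le> (C * D) * (1 + norm w) ^ (m + k)" for w
    using mult_mono[OF C(2)[of w] D(2)[of w]] C(1) by (simp add: norm_mult power_add mult_ac)
  then show ?thesis using p q by (auto simp: polybdd_def)
qed

lemma polybdd_add: "polybdd p \<Longrightarrow> polybdd q \<Longrightarrow> polybdd (\<lambda>w. p w + q w)"
proof -
  assume p: "polybdd p" and q: "polybdd q"
  obtain C m where C: "C \<ge> 0" "\<And>w. cmod (p w) \<le> C * (1 + norm w) ^ m" using polybddE[OF p] by metis
  obtain D k where D: "D \<ge> 0" "\<And>w. cmod (q w) \<le> D * (1 + norm w) ^ k" using polybddE[OF q] by metis
  have "cmod (p w + q w) \<le> (C + D) * (1 + norm w) ^ (m + k)" for w
  proof -
    have "C * (1 + norm w) ^ m \<le> C * (1 + norm w) ^ (m + k)" "D * (1 + norm w) ^ k \<le> D * (1 + norm w) ^ (m + k)"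
      using C(1) D(1) by (auto intro!: mult_left_mono power_increasing)
    then show ?thesis using C(2)[of w] D(2)[of w] norm_triangle_ineq[of "p w" "q w"] by (simp add: distrib_right)
  qed
  then show ?thesis using p q by (auto simp: polybdd_def)
qed

lemma polybdd_power: "polybdd q \<Longrightarrow> polybdd (\<lambda>w. q w ^ k)"
  by (induction k) (auto intro: polybdd_mult polybdd_const)

lemma polybdd_sum: "(\<And>i. i \<in> I \<Longrightarrow> polybdd (f i)) \<Longrightarrow> polybdd (\<lambda>z. \<Sum>i\<in>I. f i z)"
  by (induction I rule: infinite_finite_induct) (auto intro: polybdd_add polybdd_const)

lemma polybdd_prod: "(\<And>i. i \<in> I \<Longrightarrow> polybdd (f i)) \<Longrightarrow> polybdd (\<lambda>z. \<Prod>i\<in>I. f i z)"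
  by (induction I rule: infinite_finite_induct) (auto intro: polybdd_mult polybdd_const)

lemma measurable_vec_nth [measurable]: "(\<lambda>z :: 'a::real_normed_vector^'n::finite. z $ i) \<in> borel_measurable borel"
  by (intro borel_measurable_continuous_onI continuous_intros)

lemma polybdd_nth: "polybdd (\<lambda>w. w $ i)"
proof -
  have "cmod (w $ i) \<le> 1 * (1 + norm w) ^ 1" for w :: "complex^'a"
    using Finite_Cartesian_Product.norm_nth_le[of w i] by simp
  then show ?thesis unfolding polybdd_def by (auto intro!: exI[of _ "1::real"] exI[of _ "1::nat"])
qed

lemma borel_measurable_cnj [measurable]: "cnj \<in> borel_measurable borel"
  by (intro borel_measurable_continuous_onI continuous_intros)

lemma polybdd_cnj: "polybdd q \<Longrightarrow> polybdd (\<lambda>w. cnj (q w))"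
  by (auto simp: polybdd_def)

lemma polys_polybdd: "f \<in> polys \<Longrightarrow> polybdd f"
  by (induction f rule: polys_induct)
    (auto simp: mono_fun_def intro!: polybdd_add polybdd_mult polybdd_const polybdd_prod polybdd_power polybdd_nth)

lemma polys_measurable: "f \<in> polys \<Longrightarrow> f \<in> borel_measurable borel"
  by (rule polybdd_measurable[OF polys_polybdd])

lemma integrable_polybdd_exp:
  assumes q: "polybdd q" and [measurable]: "e \<in> borel_measurable borel" and "c < 1 / 2"
    and e: "\<And>z. cmod (e z) \<le> K * exp (c * (norm z)\<^sup>2)"
  shows "integrable gauss (\<lambda>z. e z * q z)"
proof -
  obtain C m where C: "C \<ge> 0" "\<And>w. cmod (q w) \<le> C * (1 + norm w) ^ m" using polybddE[OF q] by metis
  note [measurable] = polybdd_measurable[OF q]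
  have "cmod (e z * q z) \<le> (K * C) * ((1 + norm z) ^ m * exp (c * (norm z)\<^sup>2))" for z
  proof -
    have "cmod (e z) * cmod (q z) \<le> (K * exp (c * (norm z)\<^sup>2)) * (C * (1 + norm z) ^ m)"
      by (rule mult_mono[OF e C(2)]) (auto intro: order_trans[OF norm_ge_zero e])
    then show ?thesis by (simp add: norm_mult mult_ac)
  qed
  then show ?thesis by (intro integrable_gaussI[OF _ assms(3)]) auto
qed

lemma integrable_polybdd: "polybdd q \<Longrightarrow> integrable gauss q"
  using integrable_polybdd_exp[of q "\<lambda>_. 1" 0 1] by simp

text \<open>The form of a kernel whose integral over \<open>w\<close> is a polynomial in
  \<open>z\<close>. It is closed under products, so the powers in the exponential series of the
  kernel keep it.\<close>

inductive separable :: "(complex^'n::finite \<Rightarrow> complex^'n \<Rightarrow> complex) \<Rightarrow> bool" where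
  base: "p \<in> polys \<Longrightarrow> polybdd q \<Longrightarrow> separable (\<lambda>z w. p z * q w)"
| add: "separable G \<Longrightarrow> separable H \<Longrightarrow> separable (\<lambda>z w. G z w + H z w)"

lemma separable_mult: "separable G \<Longrightarrow> separable H \<Longrightarrow> separable (\<lambda>z w. G z w * H z w)"
proof (induction G rule: separable.induct)
  case (base p q)
  from this(3,1,2) show ?case
  proof (induction H rule: separable.induct)
    case (base p' q')
    have "separable (\<lambda>z w. (p z * p' z) * (q w * q' w))"
      by (intro separable.base polys_mult polybdd_mult base)
    then show ?case by (simp add: mult_ac)
  qed (simp add: distrib_left separable.add)
qed (simp add: distrib_right separable.add)

lemma separable_power: "separable G \<Longrightarrow> separable (\<lambda>z w. G z w ^ k)"
proof (induction k)
  case 0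
  show ?case using separable.base[OF polys_const polybdd_const, of 1 1] by simp
qed (auto intro: separable_mult)

lemma separable_sum:
  "(\<And>i. i \<in> I \<Longrightarrow> separable (G i)) \<Longrightarrow> separable (\<lambda>z w. \<Sum>i\<in>I. G i z w)"
proof (induction I rule: infinite_finite_induct)
  case (infinite I)
  then show ?case using separable.base[OF polys_const polybdd_const, of 0 0] by simp
next
  case empty
  then show ?case using separable.base[OF polys_const polybdd_const, of 0 0] by simp
qed (auto intro: separable.add)

lemma separable_polybdd: "separable G \<Longrightarrow> polybdd (G z)"
  by (induction G rule: separable.induct) (auto intro: polybdd_mult polybdd_const polybdd_add)

lemma separable_integral: "separable G \<Longrightarrow> polybdd f \<Longrightarrow> (\<lambda>z. \<integral>w. G z w * f w \<partial>gauss) \<in> polys"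
proof (induction G rule: separable.induct)
  case (base p q)
  have "(\<lambda>z. \<integral>w. p z * q w * f w \<partial>gauss) = (\<lambda>z. p z * (\<integral>w. q w * f w \<partial>gauss))"
    by (simp add: mult.assoc)
  then show ?case by (simp add: polys_mult polys_const base)
next
  case (add G H)
  then show ?case
    by (simp add: distrib_right integrable_polybdd polybdd_mult separable_polybdd polys_add)
qed

lemma norm_exp_partial_sum_le: "cmod (\<Sum>k<N. x ^ k / fact k) \<le> exp (cmod x)"
proof -
  have "cmod (\<Sum>k<N. x ^ k / fact k) \<le> (\<Sum>k<N. cmod x ^ k /\<^sub>R fact k)"
    by (intro order_trans[OF norm_sum] sum_mono)
      (simp add: norm_mult norm_inverse norm_power divide_inverse mult.commute)
  also have "\<dots> \<le> suminf (\<lambda>k. cmod x ^ k /\<^sub>R fact k)"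
    by (intro sum_le_suminf sums_summable[OF exp_converges]) auto
  also have "\<dots> = exp (cmod x)" by (rule sums_unique[OF exp_converges, symmetric])
  finally show ?thesis .
qed

lemma exp_partial_sums_tendsto: "(\<lambda>N. \<Sum>k<N. x ^ k / fact k) \<longlonglongrightarrow> exp x" for x :: complex
  using exp_converges[of x] by (simp add: sums_def scaleR_conv_of_real divide_inverse mult.commute)

section \<open>The operators \<open>omega x\<close> on polynomials\<close>

lemma mono_fun_scale: "mono_fun \<alpha> (e *s w) = e ^ (\<Sum>i\<in>UNIV. \<alpha> i) * mono_fun \<alpha> w"
  by (simp add: mono_fun_def vector_scalar_mult_def power_mult_distrib prod.distrib power_sum)

text \<open>Rotating \<open>w\<close> by a scalar of modulus one shows that only finitely many terms of the exponential
  series contribute.\<close>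

lemma exp_integral_mono:
  fixes L :: "complex^'n::finite \<Rightarrow> complex^'n \<Rightarrow> complex"
  assumes sepL: "separable L" and D: "polybdd D"
    and homL: "\<And>e z w. L z (e *s w) = cnj e * L z w" and homD: "\<And>e w. D (e *s w) = (cnj e)\<^sup>2 * D w"
    and boundL: "\<And>z w. cmod (L z w) \<le> K z * norm w" and boundD: "\<And>w. cmod (D w) \<le> (norm w)\<^sup>2 / 4"
  shows "(\<lambda>z. \<integral>w. exp (L z w + D w) * mono_fun \<alpha> w \<partial>gauss) \<in> polys"
proof -
  define d where "d = (\<Sum>i\<in>UNIV. \<alpha> i)"
  have mono: "polybdd (mono_fun \<alpha>)" using polys_polybdd[OF polys_mono[of 1 \<alpha>]] by simp
  have sepR: "separable (\<lambda>z w. L z w + D w)"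
    using separable.add[OF sepL separable.base[OF polys_const D, of 1]] by simp
  note pb = polybdd_mult polybdd_power polybdd_add separable_polybdd[OF sepL] D mono polybdd_const
  have vanish: "(\<integral>w. (L z w + D w) ^ k * mono_fun \<alpha> w \<partial>gauss) = 0" if "k > d" for z k
  proof -
    have term0: "(\<integral>w. L z w ^ j * D w ^ (k - j) * mono_fun \<alpha> w \<partial>gauss) = 0" (is "?I = 0") if "j \<le> k" for j
    proof -
      \<comment> \<open>\<open>N\<close> is the conjugate degree of the integrand in
        \<open>w\<close> minus its degree \<open>d\<close>, and is positive since
        \<open>j + 2 (k - j) \<ge> k > d\<close>. Rotation by the angle \<open>pi / N\<close>
        therefore changes the sign of the integrand.\<close>
      define N where "N = j + 2 * (k - j) - d"
      have N: "N > 0" "j + 2 * (k - j) = N + d" using \<open>k > d\<close> that by (auto simp: N_def)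
      define e where "e = cis (pi / real N)"
      have e: "cmod e = 1" "cnj e * e = 1"
        by (auto simp: e_def cis_cnj cis_mult)
      have "cnj e ^ N = cis (real N * (- (pi / real N)))" by (simp add: e_def cis_cnj Complex.DeMoivre)
      then have eN: "cnj e ^ N = - 1" using N(1) by (simp add: complex_eq_iff)
      have "?I = (\<integral>w. L z (e *s w) ^ j * D (e *s w) ^ (k - j) * mono_fun \<alpha> (e *s w) \<partial>gauss)"
        by (rule integral_gauss_rotate[symmetric, OF _ e(1)], rule polybdd_measurable) (intro pb)
      also have "\<dots> = (\<integral>w. - (L z w ^ j * D w ^ (k - j) * mono_fun \<alpha> w) \<partial>gauss)"
      proof -
        have "cnj e ^ j * ((cnj e)\<^sup>2) ^ (k - j) * e ^ d = cnj e ^ N * (cnj e * e) ^ d"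
          by (simp only: power_mult[symmetric] power_add[symmetric] N(2) power_mult_distrib mult.assoc)
            (simp add: power_add mult.assoc)
        then have "cnj e ^ j * ((cnj e)\<^sup>2) ^ (k - j) * e ^ d = - 1" by (simp add: e eN)
        moreover have "L z (e *s w) ^ j * D (e *s w) ^ (k - j) * mono_fun \<alpha> (e *s w)
           = (cnj e ^ j * ((cnj e)\<^sup>2) ^ (k - j) * e ^ d) * (L z w ^ j * D w ^ (k - j) * mono_fun \<alpha> w)" for w
          unfolding homL homD mono_fun_scale power_mult_distrib[of "cnj e" "L z w"]
            power_mult_distrib[of "(cnj e)\<^sup>2" "D w"] d_def[symmetric] by (simp only: mult_ac)
        ultimately show ?thesis by (simp only: mult_minus1)
      qed
      also have "\<dots> = - ?I" by simp
      finally show ?thesis by simp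
    qed
    have "(\<integral>w. (L z w + D w) ^ k * mono_fun \<alpha> w \<partial>gauss)
       = (\<integral>w. (\<Sum>j\<le>k. of_nat (k choose j) * (L z w ^ j * D w ^ (k - j) * mono_fun \<alpha> w)) \<partial>gauss)"
      by (simp add: binomial_ring sum_distrib_right mult.assoc)
    also have "\<dots> = (\<Sum>j\<le>k. of_nat (k choose j) * (\<integral>w. L z w ^ j * D w ^ (k - j) * mono_fun \<alpha> w \<partial>gauss))"
      by (subst Bochner_Integration.integral_sum) (auto intro!: integrable_polybdd pb)
    finally show ?thesis by (simp add: term0)
  qed
  have "(\<integral>w. exp (L z w + D w) * mono_fun \<alpha> w \<partial>gauss)
      = (\<Sum>k\<le>d. (\<integral>w. (L z w + D w) ^ k * mono_fun \<alpha> w \<partial>gauss) / fact k)" (is "?l z = ?r z") for z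
  proof (rule LIMSEQ_unique)
    define s where "s N w = (\<Sum>k<N. (L z w + D w) ^ k / fact k) * mono_fun \<alpha> w" for N w
    have [measurable]: "(\<lambda>w. L z w) \<in> borel_measurable borel" "D \<in> borel_measurable borel"
      "mono_fun \<alpha> \<in> borel_measurable borel"
      by (intro polybdd_measurable pb)+
    show "(\<lambda>N. \<integral>w. s N w \<partial>gauss) \<longlonglongrightarrow> ?l z"
    proof (rule integral_dominated_convergence[where w = "\<lambda>w. exp (K z * norm w + (norm w)\<^sup>2 / 4) * cmod (mono_fun \<alpha> w)"])
      \<comment> \<open>Here \<open>K |w| \<le> 2 K^2 + |w|^2 / 8\<close>, so the exponent becomes
        1/4 + 1/8 = 3/8, below the critical 1/2.\<close>
      have "exp (K z * norm w + (norm w)\<^sup>2 / 4) \<le> exp (2 * (K z)\<^sup>2) * exp (3 / 8 * (norm w)\<^sup>2)" for w :: "complex^'n"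
      proof -
        have "0 \<le> (norm w / 2 - 2 * K z)\<^sup>2 / 2" by simp
        then show ?thesis
          by (simp add: exp_add[symmetric] power2_eq_square algebra_simps)
      qed
      then have "cmod (exp (complex_of_real (K z * norm w + (norm w)\<^sup>2 / 4))) \<le> exp (2 * (K z)\<^sup>2) * exp (3 / 8 * (norm w)\<^sup>2)" for w :: "complex^'n"
        by (simp add: norm_exp_eq_Re)
      then have "integrable gauss (\<lambda>w. exp (complex_of_real (K z * norm w + (norm w)\<^sup>2 / 4)) * mono_fun \<alpha> w)"
        by (intro integrable_polybdd_exp[where c = "3 / 8"] mono) auto
      from integrable_norm[OF this]
      show "integrable gauss (\<lambda>w. exp (K z * norm w + (norm w)\<^sup>2 / 4) * cmod (mono_fun \<alpha> w))"
        by (simp add: norm_mult norm_exp_eq_Re)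
      show "AE w in gauss. (\<lambda>N. s N w) \<longlonglongrightarrow> exp (L z w + D w) * mono_fun \<alpha> w"
        unfolding s_def by (intro AE_I2 tendsto_mult_right exp_partial_sums_tendsto)
      show "AE w in gauss. cmod (s N w) \<le> exp (K z * norm w + (norm w)\<^sup>2 / 4) * cmod (mono_fun \<alpha> w)" for N
      proof (rule AE_I2)
        fix w :: "complex^'n"
        have "cmod (\<Sum>k<N. (L z w + D w) ^ k / fact k) \<le> exp (cmod (L z w + D w))"
          by (rule norm_exp_partial_sum_le)
        also have "\<dots> \<le> exp (K z * norm w + (norm w)\<^sup>2 / 4)"
          using norm_triangle_ineq[of "L z w" "D w"] boundL[of z w] boundD[of w] by simp
        finally show "cmod (s N w) \<le> exp (K z * norm w + (norm w)\<^sup>2 / 4) * cmod (mono_fun \<alpha> w)"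
          by (simp add: s_def norm_mult mult_right_mono)
      qed
    qed (auto simp: s_def)
    have "(\<integral>w. s N w \<partial>gauss) = ?r z" if "N > d" for N
    proof -
      have "(\<integral>w. s N w \<partial>gauss) = (\<integral>w. (\<Sum>k<N. (L z w + D w) ^ k * mono_fun \<alpha> w / fact k) \<partial>gauss)"
        by (simp add: s_def sum_distrib_right)
      also have "\<dots> = (\<Sum>k<N. (\<integral>w. (L z w + D w) ^ k * mono_fun \<alpha> w \<partial>gauss) / fact k)"
        by (subst Bochner_Integration.integral_sum) (auto intro!: integrable_polybdd pb integrable_divide)
      also have "\<dots> = ?r z"
        using that by (intro sum.mono_neutral_right) (auto simp: vanish)
      finally show ?thesis .
    qed
    then show "(\<lambda>N. \<integral>w. s N w \<partial>gauss) \<longlonglongrightarrow> ?r z"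
      by (intro tendsto_eventually) (auto simp: eventually_sequentially intro!: exI[of _ "Suc d"])
  qed
  then have "?l = (\<lambda>z. \<Sum>k\<le>d. 1 / fact k * (\<integral>w. (L z w + D w) ^ k * mono_fun \<alpha> w \<partial>gauss))" by auto
  then show ?thesis
    by (simp only:) (intro polys_sum polys_cmult separable_integral separable_power sepR mono)
qed

text \<open>The partial sums of the exponential series are polynomials, dominated by
  \<open>exp (c |z|^2)\<close>. The square of this bound is integrable against the Gaussian weight
  because \<open>2 c < 1 / 2\<close>, and dominated convergence applies.\<close>

lemma fock_exp_quadratic:
  fixes p q :: "complex^'n::finite \<Rightarrow> complex"
  assumes p: "p \<in> polys" and q: "q \<in> polys" and c: "c < 1 / 4"
    and bound: "\<And>z. cmod (q z) \<le> c * (norm z)\<^sup>2"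
  shows "(\<lambda>z. exp (q z) * p z) \<in> fock"
proof -
  define h where "h N z = (\<Sum>k<N. q z ^ k / fact k) * p z" for N z
  have hp: "h N \<in> polys" for N
  proof -
    have "h N = (\<lambda>z. (\<Sum>k<N. 1 / fact k * q z ^ k) * p z)" by (rule ext) (simp add: h_def)
    then show ?thesis by (simp only:) (intro polys_mult polys_sum polys_cmult polys_power p q)
  qed
  have lim: "(\<lambda>N. h N z) \<longlonglongrightarrow> exp (q z) * p z" for z
    unfolding h_def by (intro tendsto_mult_right exp_partial_sums_tendsto)
  note [measurable] = polys_measurable[OF p] polys_measurable[OF q] polys_measurable[OF hp]
  define b where "b z = 4 * (exp (2 * c * (norm z)\<^sup>2) * (cmod (p z))\<^sup>2)" for z
  have hb: "(norm (h N z - exp (q z) * p z))\<^sup>2 \<le> b z" for N z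
  proof -
    have e: "cmod (\<Sum>k<N. q z ^ k / fact k) \<le> exp (c * (norm z)\<^sup>2)" "cmod (exp (q z)) \<le> exp (c * (norm z)\<^sup>2)"
      using norm_exp_partial_sum_le[of "q z" N] norm_exp[of "q z"] bound[of z]
      by (auto intro: order_trans[OF _ exp_le_cancel_iff[THEN iffD2]])
    have "norm (h N z - exp (q z) * p z) = cmod ((\<Sum>k<N. q z ^ k / fact k) - exp (q z)) * cmod (p z)"
      by (simp add: h_def left_diff_distrib[symmetric] norm_mult)
    also have "\<dots> \<le> (2 * exp (c * (norm z)\<^sup>2)) * cmod (p z)"
    proof (intro mult_right_mono)
      show "cmod ((\<Sum>k<N. q z ^ k / fact k) - exp (q z)) \<le> 2 * exp (c * (norm z)\<^sup>2)"
        using e norm_triangle_ineq4[of "\<Sum>k<N. q z ^ k / fact k" "exp (q z)"] by linarith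
    qed auto
    finally have "(norm (h N z - exp (q z) * p z))\<^sup>2 \<le> ((2 * exp (c * (norm z)\<^sup>2)) * cmod (p z))\<^sup>2"
      by (intro power_mono) auto
    also have "\<dots> = b z" by (simp add: b_def power_mult_distrib exp_double[symmetric] mult_ac)
    finally show ?thesis .
  qed
  have "integrable gauss (\<lambda>z. complex_of_real (exp (2 * c * (norm z)\<^sup>2)) * (p z * p z))"
    using c by (intro integrable_polybdd_exp[where c = "2 * c" and K = 1] polybdd_mult polys_polybdd p) auto
  from integrable_norm[OF this] have "integrable gauss b"
    by (simp add: b_def[abs_def] norm_mult power2_eq_square)
  then have "(\<integral>\<^sup>+z. ennreal (b z) \<partial>gauss) < \<infinity>"
    using integrableD(2)[of gauss b] by (simp add: b_def less_top[symmetric])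
  then have "(\<lambda>N. \<integral>\<^sup>+z. ennreal ((norm (h N z - exp (q z) * p z))\<^sup>2) \<partial>gauss) \<longlonglongrightarrow> (\<integral>\<^sup>+z. 0 \<partial>(gauss :: (complex^'n) measure))"
  proof (intro nn_integral_dominated_convergence[where w = "\<lambda>z. ennreal (b z)"])
    show "AE z in gauss. (\<lambda>N. ennreal ((norm (h N z - exp (q z) * p z))\<^sup>2)) \<longlonglongrightarrow> 0"
    proof (rule AE_I2)
      fix z
      have "(\<lambda>N. h N z - exp (q z) * p z) \<longlonglongrightarrow> 0" using lim[of z] by (simp add: LIM_zero)
      then have "(\<lambda>N. (norm (h N z - exp (q z) * p z))\<^sup>2) \<longlonglongrightarrow> 0"
        using tendsto_power[OF tendsto_norm_zero, of _ _ 2] by simp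
      then show "(\<lambda>N. ennreal ((norm (h N z - exp (q z) * p z))\<^sup>2)) \<longlonglongrightarrow> 0"
        using tendsto_ennrealI by fastforce
    qed
  qed (auto simp: b_def[symmetric] ennreal_leI hb, simp_all add: b_def)
  then show ?thesis unfolding fock_def using hp lim by auto
qed

lemma polybdd_calH: "polybdd (\<lambda>w. bilin X (stack u (\<chi> i. cnj (w $ i))))"
proof -
  have "polybdd (\<lambda>w. stack u (\<chi> i. cnj (w $ i)) $ a)" for a
    by (cases a) (auto intro: polybdd_const polybdd_cnj polybdd_nth)
  then show ?thesis
    unfolding bilin_def by (intro polybdd_sum polybdd_mult polybdd_const)
qed

lemma norm_scale_i: "norm (\<chi> i. \<i> * z $ i) = norm z"
  by (simp add: norm_vec_def norm_mult)

lemma norm_cnj_vec: "norm (\<chi> i. cnj (w $ i)) = norm w"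
  by (simp add: norm_vec_def)

lemma Mp_D: "x \<in> Mp \<Longrightarrow> snd x \<in> Sp" "x \<in> Mp \<Longrightarrow> (fst x)\<^sup>2 * det (cpart (snd x)) = 1"
  by (auto simp: Mp_def)

text \<open>The variables separate, each with the exponent 1/4, half of what the Gaussian weight
  tolerates.\<close>

lemma cmod_exp_calH_le:
  assumes "x \<in> Mp"
  shows "cmod (exp (1/4 * bilin (calH (snd x)) (stack (\<chi> i. \<i> * z $ i) (\<chi> i. cnj (w $ i)))))
    \<le> exp ((norm z)\<^sup>2 / 4) * exp ((norm w)\<^sup>2 / 4)"
proof -
  have "cmod (1/4 * bilin (calH (snd x)) (stack (\<chi> i. \<i> * z $ i) (\<chi> i. cnj (w $ i)))) \<le> (norm z)\<^sup>2 / 4 + (norm w)\<^sup>2 / 4"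
    using cmod_bilin_calH_le[OF Mp_D(1)[OF assms], of "\<chi> i. \<i> * z $ i" "\<chi> i. cnj (w $ i)"]
    by (simp add: norm_mult norm_scale_i norm_cnj_vec)
  then show ?thesis
    unfolding exp_add[symmetric] by (intro order_trans[OF norm_exp]) simp
qed

lemma integrable_omega:
  assumes "x \<in> Mp" "polybdd f"
  shows "integrable gauss (\<lambda>w. fst x *
     exp (1/4 * bilin (calH (snd x)) (stack (\<chi> i. \<i> * z $ i) (\<chi> i. cnj (w $ i)))) * f w)"
proof (rule integrable_polybdd_exp[where c = "1/4" and K = "cmod (fst x) * exp ((norm z)\<^sup>2 / 4)"])
  have [measurable]: "(\<lambda>w. bilin (calH (snd x)) (stack (\<chi> i. \<i> * z $ i) (\<chi> i. cnj (w $ i)))) \<in> borel_measurable borel"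
    by (rule polybdd_measurable[OF polybdd_calH])
  show "(\<lambda>w. fst x * exp (1/4 * bilin (calH (snd x)) (stack (\<chi> i. \<i> * z $ i) (\<chi> i. cnj (w $ i))))) \<in> borel_measurable borel"
    by measurable
  show "cmod (fst x * exp (1/4 * bilin (calH (snd x)) (stack (\<chi> i. \<i> * z $ i) (\<chi> i. cnj (w $ i)))))
     \<le> cmod (fst x) * exp ((norm z)\<^sup>2 / 4) * exp (1/4 * (norm w)\<^sup>2)" for w
    using mult_left_mono[OF cmod_exp_calH_le[OF assms(1), of z w], of "cmod (fst x)"]
    by (simp add: norm_mult mult.assoc)
qed (use assms in auto)

lemma omega_add:
  assumes "x \<in> Mp" "f \<in> polys" "g \<in> polys"
  shows "omega x (\<lambda>w. f w + g w) = (\<lambda>z. omega x f z + omega x g z)"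
  unfolding omega_def distrib_left
  by (intro ext Bochner_Integration.integral_add integrable_omega polys_polybdd assms)

lemma omega_cmult: "omega x (\<lambda>w. c * f w) = (\<lambda>z. c * omega x f z)"
proof
  fix z
  show "omega x (\<lambda>w. c * f w) z = c * omega x f z"
    unfolding omega_def by (subst integral_mult_right_zero[symmetric]) (simp add: mult_ac)
qed

text \<open>The exponent splits into \<open>q\<close> in \<open>z\<close> alone, a mixed part
  \<open>L\<close>, and \<open>E\<close> in \<open>w\<close> alone. Pulling \<open>exp (q z)\<close>
  out leaves an integral that is a polynomial by \<open>exp_integral_mono\<close>; the constant
  below 1/4 comes from the strict contraction in \<open>calH_blocks\<close>.\<close>

lemma omega_polys:
  fixes x :: "'n::finite mpair"
  assumes x: "x \<in> Mp" and f: "f \<in> polys"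
  obtains q p c where "q \<in> polys" "p \<in> polys" "c < 1 / 4"
    "\<And>z. cmod (q z) \<le> c * (norm z)\<^sup>2" "omega x f = (\<lambda>z. exp (q z) * p z)"
proof -
  obtain A B C D \<tau> where H: "calH (snd x) = block A B C D" and \<tau>: "0 \<le> \<tau>" "\<tau> < 1"
    and A: "\<And>z. cmod (bilin A z) \<le> \<tau> * (norm z)\<^sup>2"
    using calH_blocks[OF Mp_D(1)[OF x]] by metis
  \<comment> \<open>The minus sign is the square of the imaginary unit, as the kernel is evaluated
    at \<open>\<i> * z\<close>.\<close>
  define q where "q z = - (1/4) * bilin A z" for z
  define L where "L z w = (\<Sum>i\<in>UNIV. \<Sum>j\<in>UNIV. (1/4 * (\<i> * (B $ i $ j + C $ j $ i)) * z $ i) * cnj (w $ j))" for z w :: "complex^'n"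
  define E where "E w = 1/4 * bilin D (\<chi> i. cnj (w $ i))" for w :: "complex^'n"
  have split: "1/4 * bilin (calH (snd x)) (stack (\<chi> i. \<i> * z $ i) (\<chi> i. cnj (w $ i))) = q z + (L z w + E w)" for z w
  proof -
    have "bilin A (\<chi> i. \<i> * z $ i) = - bilin A z"
      by (simp add: bilin_def sum_negf[symmetric] mult_ac)
    then show ?thesis
      unfolding H bilin_block q_def L_def E_def
      by (simp add: distrib_left sum_distrib_left mult_ac)
  qed
  have qp: "q \<in> polys"
    unfolding q_def bilin_def by (intro polys_cmult polys_sum polys_mult polys_nth polys_const)
  have q: "cmod (q z) \<le> \<tau> / 4 * (norm z)\<^sup>2" for z
    using A[of z] by (simp add: q_def norm_mult)
  have sepL: "separable L"
  proof -
    have "separable (\<lambda>z w. \<Sum>i\<in>UNIV. \<Sum>j\<in>UNIV. (1/4 * (\<i> * (B $ i $ j + C $ j $ i)) * z $ i) * cnj (w $ j))"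
      by (intro separable_sum separable.base polys_cmult polys_nth polybdd_cnj polybdd_nth)
    then show ?thesis by (simp add: L_def[abs_def])
  qed
  have DE: "polybdd E"
  proof -
    have "polybdd (\<lambda>w. 1/4 * (\<Sum>i\<in>UNIV. \<Sum>j\<in>UNIV. cnj (w $ i) * D $ i $ j * cnj (w $ j)))"
      by (intro polybdd_mult polybdd_sum polybdd_const polybdd_cnj polybdd_nth)
    then show ?thesis by (simp add: E_def[abs_def] bilin_def)
  qed
  have homL: "L z (e *s w) = cnj e * L z w" for e z w
    by (simp add: L_def sum_distrib_left mult_ac)
  have homE: "E (e *s w) = (cnj e)\<^sup>2 * E w" for e w
    by (simp add: E_def bilin_def sum_distrib_left power2_eq_square mult_ac)
  have boundL: "cmod (L z w) \<le> (\<Sum>i\<in>UNIV. \<Sum>j\<in>UNIV. cmod (1/4 * (\<i> * (B $ i $ j + C $ j $ i)) * z $ i)) * norm w" for z w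
    unfolding L_def sum_distrib_right
    by (intro order_trans[OF norm_sum] sum_mono)
      (simp add: norm_mult mult_left_mono Finite_Cartesian_Product.norm_nth_le)
  have boundE: "cmod (E w) \<le> (norm w)\<^sup>2 / 4" for w
  proof -
    have "bilin A 0 = 0" by (simp add: bilin_def)
    then have "bilin (calH (snd x)) (stack 0 (\<chi> i. cnj (w $ i))) = bilin D (\<chi> i. cnj (w $ i))"
      by (simp add: H bilin_block)
    with cmod_bilin_calH_le[OF Mp_D(1)[OF x], of 0 "\<chi> i. cnj (w $ i)"]
    show ?thesis by (simp add: E_def norm_mult norm_cnj_vec)
  qed
  have "\<exists>p\<in>polys. omega x f = (\<lambda>z. exp (q z) * p z)" using f
  proof (induction f rule: polys_induct)
    case (mono c \<alpha>)
    let ?p = "\<lambda>z. c * fst x * (\<integral>w. exp (L z w + E w) * mono_fun \<alpha> w \<partial>gauss)"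
    have 1: "?p \<in> polys"
      by (intro polys_cmult exp_integral_mono[OF sepL DE homL homE boundL boundE])
    have 2: "omega x (\<lambda>z. c * mono_fun \<alpha> z) = (\<lambda>z. exp (q z) * ?p z)"
    proof
      fix z
      have "omega x (\<lambda>z. c * mono_fun \<alpha> z) z
          = (\<integral>w. (c * fst x * exp (q z)) * (exp (L z w + E w) * mono_fun \<alpha> w) \<partial>gauss)"
        unfolding omega_def split exp_add[of "q z"] by (simp add: mult_ac)
      also have "\<dots> = exp (q z) * ?p z" by (subst integral_mult_right_zero) (simp add: mult_ac)
      finally show "omega x (\<lambda>z. c * mono_fun \<alpha> z) z = exp (q z) * ?p z" .
    qed
    show ?case by (rule bexI[of _ ?p], rule 2, rule 1)
  next
    case (add f g)
    then obtain p1 p2 where "p1 \<in> polys" "omega x f = (\<lambda>z. exp (q z) * p1 z)"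
      "p2 \<in> polys" "omega x g = (\<lambda>z. exp (q z) * p2 z)" by blast
    then show ?case
      using add by (intro bexI[of _ "\<lambda>z. p1 z + p2 z"]) (auto simp: omega_add x distrib_left polys_add)
  qed
  then show ?thesis using that[OF qp, of _ "\<tau> / 4"] q \<tau> by fastforce
qed

lemma omega_fock:
  assumes "x \<in> Mp" "f \<in> polys" shows "omega x f \<in> fock"
proof -
  obtain q p c where "q \<in> polys" "p \<in> polys" "c < 1 / 4"
    "\<And>z. cmod (q z) \<le> c * (norm z)\<^sup>2" "omega x f = (\<lambda>z. exp (q z) * p z)"
    using omega_polys[OF assms] by blast
  then show ?thesis by (simp only: fock_exp_quadratic)
qed

section \<open>The inner product on Fock space\<close>

lemma fock_measurable:
  assumes "f \<in> fock" shows "f \<in> borel_measurable borel"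
proof -
  obtain h where "\<And>k. h k \<in> polys" "\<And>z. (\<lambda>k. h k z) \<longlonglongrightarrow> f z"
    using assms unfolding fock_def by blast
  then show ?thesis
    by (intro borel_measurable_LIMSEQ_metric[of h borel f]) (auto intro: polys_measurable)
qed

text \<open>A single polynomial at finite distance from \<open>f\<close> suffices.\<close>

lemma fock_square_integrable:
  fixes f :: "complex^'n::finite \<Rightarrow> complex"
  assumes "f \<in> fock" shows "integrable gauss (\<lambda>z. (norm (f z))\<^sup>2)"
proof -
  obtain h where h: "\<And>k. h k \<in> polys"
    "(\<lambda>k. \<integral>\<^sup>+z. ennreal ((norm (h k z - f z))\<^sup>2) \<partial>gauss) \<longlonglongrightarrow> 0"
    using assms unfolding fock_def by blast
  have "\<forall>\<^sub>F k in sequentially. (\<integral>\<^sup>+z. ennreal ((norm (h k z - f z))\<^sup>2) \<partial>gauss) < 1"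
    using order_tendstoD(2)[OF h(2), of 1] by simp
  then obtain k where k: "(\<integral>\<^sup>+z. ennreal ((norm (h k z - f z))\<^sup>2) \<partial>gauss) < 1"
    by (meson eventually_happens sequentially_bot)
  note [measurable] = fock_measurable[OF assms] polys_measurable[OF h(1)]
  have "polybdd (\<lambda>z. h k z * h k z)" using h(1) by (intro polybdd_mult polys_polybdd)
  from integrable_norm[OF integrable_polybdd[OF this]]
  have hk: "integrable gauss (\<lambda>z. (norm (h k z))\<^sup>2)" by (simp add: norm_mult power2_eq_square)
  have "(\<integral>\<^sup>+z. ennreal ((norm (f z))\<^sup>2) \<partial>gauss)
      \<le> (\<integral>\<^sup>+z. 2 * ennreal ((norm (h k z))\<^sup>2) + 2 * ennreal ((norm (h k z - f z))\<^sup>2) \<partial>gauss)"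
  proof (rule nn_integral_mono)
    fix z
    have "norm (f z) \<le> norm (h k z) + norm (h k z - f z)"
      by (metis norm_minus_commute norm_triangle_sub)
    then have "(norm (f z))\<^sup>2 \<le> (norm (h k z) + norm (h k z - f z))\<^sup>2" by (intro power_mono) auto
    also have "\<dots> \<le> 2 * (norm (h k z))\<^sup>2 + 2 * (norm (h k z - f z))\<^sup>2"
      using sum_squares_bound[of "norm (h k z)" "norm (h k z - f z)"] by (simp add: power2_sum)
    finally have "ennreal ((norm (f z))\<^sup>2) \<le> ennreal (2 * (norm (h k z))\<^sup>2 + 2 * (norm (h k z - f z))\<^sup>2)"
      by (rule ennreal_leI)
    then show "ennreal ((norm (f z))\<^sup>2) \<le> 2 * ennreal ((norm (h k z))\<^sup>2) + 2 * ennreal ((norm (h k z - f z))\<^sup>2)"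
      by (simp add: ennreal_plus ennreal_mult)
  qed
  also have "\<dots> = 2 * (\<integral>\<^sup>+z. ennreal ((norm (h k z))\<^sup>2) \<partial>gauss) + 2 * (\<integral>\<^sup>+z. ennreal ((norm (h k z - f z))\<^sup>2) \<partial>gauss)"
    by (subst nn_integral_add) (auto simp: nn_integral_cmult)
  also have "\<dots> < \<infinity>"
    using k integrableD(2)[OF hk] by (auto simp: ennreal_mult_eq_top_iff less_top[symmetric])
  finally show ?thesis by (intro integrableI_bounded) auto
qed

lemma polys_square_integrable: "f \<in> polys \<Longrightarrow> integrable gauss (\<lambda>z. (norm (f z))\<^sup>2)"
  for f :: "complex^'n::finite \<Rightarrow> complex"
proof -
  assume "f \<in> polys"
  then have "polybdd (\<lambda>z. f z * f z)" by (intro polybdd_mult polys_polybdd)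
  from integrable_norm[OF integrable_polybdd[OF this]]
  show ?thesis by (simp add: norm_mult power2_eq_square)
qed

lemma integrable_mult_cnj:
  fixes f h :: "'a \<Rightarrow> complex"
  assumes "f \<in> borel_measurable M" "h \<in> borel_measurable M"
    "integrable M (\<lambda>z. (norm (f z))\<^sup>2)" "integrable M (\<lambda>z. (norm (h z))\<^sup>2)"
  shows "integrable M (\<lambda>z. f z * cnj (h z))"
proof (rule Bochner_Integration.integrable_bound)
  show "integrable M (\<lambda>z. (norm (f z))\<^sup>2 + (norm (h z))\<^sup>2)" using assms by simp
  show "AE z in M. norm (f z * cnj (h z)) \<le> norm ((norm (f z))\<^sup>2 + (norm (h z))\<^sup>2)"
  proof (rule AE_I2)
    fix z
    have "0 \<le> norm (f z) * norm (h z)" by simp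
    then have "norm (f z) * norm (h z) \<le> (norm (f z))\<^sup>2 + (norm (h z))\<^sup>2"
      using sum_squares_bound[of "norm (f z)" "norm (h z)"] by linarith
    then show "norm (f z * cnj (h z)) \<le> norm ((norm (f z))\<^sup>2 + (norm (h z))\<^sup>2)" by (simp add: norm_mult)
  qed
qed (use assms in measurable)

lemma fock_inner_integrable:
  "f \<in> fock \<Longrightarrow> h \<in> polys \<Longrightarrow> integrable gauss (\<lambda>z. f z * cnj (h z))"
  "f \<in> fock \<Longrightarrow> h \<in> polys \<Longrightarrow> integrable gauss (\<lambda>z. h z * cnj (f z))"
  by (intro integrable_mult_cnj fock_square_integrable polys_square_integrable;
      simp add: fock_measurable polys_measurable measurable_cong_sets[OF sets_gauss refl])+

lemma fock_inner_add:
  assumes "f \<in> fock" "g \<in> fock" "h \<in> polys"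
  shows "fock_inner (\<lambda>z. f z + g z) h = fock_inner f h + fock_inner g h"
    "fock_inner h (\<lambda>z. f z + g z) = fock_inner h f + fock_inner h g"
  using assms by (simp_all add: fock_inner_def distrib_left distrib_right fock_inner_integrable)

lemma fock_inner_add_polys:
  assumes "f \<in> polys" "g \<in> polys" "h \<in> fock"
  shows "fock_inner (\<lambda>z. f z + g z) h = fock_inner f h + fock_inner g h"
    "fock_inner h (\<lambda>z. f z + g z) = fock_inner h f + fock_inner h g"
  using assms by (simp_all add: fock_inner_def distrib_left distrib_right fock_inner_integrable)

lemma fock_inner_cmult:
  "fock_inner (\<lambda>z. c * f z) h = c * fock_inner f h"
  "fock_inner f (\<lambda>z. c * h z) = cnj c * fock_inner f h"
proof -
  show "fock_inner (\<lambda>z. c * f z) h = c * fock_inner f h"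
    unfolding fock_inner_def by (subst integral_mult_right_zero[symmetric]) (simp add: mult_ac)
  show "fock_inner f (\<lambda>z. c * h z) = cnj c * fock_inner f h"
    unfolding fock_inner_def by (subst integral_mult_right_zero[symmetric]) (simp add: mult_ac)
qed

lemma cnj_fock_inner: "cnj (fock_inner f h) = fock_inner h f"
proof -
  have "cnj (fock_inner f h) = (\<integral>z. cnj (f z * cnj (h z)) \<partial>gauss)"
    unfolding fock_inner_def by (rule Bochner_Integration.integral_cnj[symmetric])
  then show ?thesis by (simp add: fock_inner_def mult.commute)
qed

section \<open>Matrix coefficients of the oscillator representation\<close>

text \<open>The bound for the exponential kernel is a function of \<open>z\<close> times a function
  of \<open>w\<close>, uniformly in \<open>g\<close>. The double integral factors into
  \<open>C1 * C2\<close>, and \<open>x\<close> enters only through its scalar.\<close>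

lemma fock_inner_omega_bound:
  fixes f h :: "complex^'n::finite \<Rightarrow> complex"
  assumes f: "f \<in> polys" and h: "h \<in> polys"
  obtains C where "\<And>x. x \<in> Mp \<Longrightarrow> cmod (fock_inner (omega x f) h) \<le> C * cmod (fst x)"
proof -
  have i: "integrable gauss (\<lambda>w. exp ((norm w)\<^sup>2 / 4) * cmod (q w))" if "q \<in> polys" for q :: "complex^'n \<Rightarrow> complex"
  proof -
    have "integrable gauss (\<lambda>w. complex_of_real (exp ((norm w)\<^sup>2 / 4)) * q w)"
      by (intro integrable_polybdd_exp[where c = "1/4" and K = 1] polys_polybdd that) auto
    from integrable_norm[OF this] show ?thesis by (simp add: norm_mult)
  qed
  define C1 C2 where "C1 = (\<integral>w. exp ((norm w)\<^sup>2 / 4) * cmod (f w) \<partial>gauss)"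
    and "C2 = (\<integral>w. exp ((norm w)\<^sup>2 / 4) * cmod (h w) \<partial>gauss)"
  have "cmod (fock_inner (omega x f) h) \<le> (C1 * C2) * cmod (fst x)" if x: "x \<in> Mp" for x
  proof -
    have om: "cmod (omega x f z) \<le> cmod (fst x) * exp ((norm z)\<^sup>2 / 4) * C1" for z
    proof -
      have "cmod (omega x f z) \<le> (\<integral>w. cmod (fst x) * exp ((norm z)\<^sup>2 / 4) * (exp ((norm w)\<^sup>2 / 4) * cmod (f w)) \<partial>gauss)"
        unfolding omega_def
      proof (rule order_trans[OF integral_norm_bound integral_mono])
        fix w :: "complex^'n"
        have "cmod (fst x * exp (1/4 * bilin (calH (snd x)) (stack (\<chi> i. \<i> * z $ i) (\<chi> i. cnj (w $ i)))) * f w)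
          \<le> cmod (fst x) * (exp ((norm z)\<^sup>2 / 4) * exp ((norm w)\<^sup>2 / 4)) * cmod (f w)"
          unfolding norm_mult[of _ "f w"] norm_mult[of "fst x"]
          by (intro mult_right_mono mult_left_mono cmod_exp_calH_le x) auto
        then show "cmod (fst x * exp (1/4 * bilin (calH (snd x)) (stack (\<chi> i. \<i> * z $ i) (\<chi> i. cnj (w $ i)))) * f w)
          \<le> cmod (fst x) * exp ((norm z)\<^sup>2 / 4) * (exp ((norm w)\<^sup>2 / 4) * cmod (f w))"
          by (simp only: mult.assoc)
      qed (use i[OF f] integrable_omega[OF x polys_polybdd[OF f]] in auto)
      then show ?thesis by (simp add: C1_def)
    qed
    have "cmod (fock_inner (omega x f) h) \<le> (\<integral>z. (cmod (fst x) * C1) * (exp ((norm z)\<^sup>2 / 4) * cmod (h z)) \<partial>gauss)"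
      unfolding fock_inner_def
    proof (rule order_trans[OF integral_norm_bound integral_mono])
      fix z :: "complex^'n"
      show "cmod (omega x f z * cnj (h z)) \<le> (cmod (fst x) * C1) * (exp ((norm z)\<^sup>2 / 4) * cmod (h z))"
        using mult_right_mono[OF om[of z], of "cmod (h z)"] by (simp add: norm_mult mult_ac)
    qed (use i[OF h] fock_inner_integrable[OF omega_fock[OF x f] h] in auto)
    then show ?thesis by (simp add: C2_def mult_ac)
  qed
  then show ?thesis using that by blast
qed

lemma fock_inner_omega_measurable:
  fixes f h :: "complex^'n::finite \<Rightarrow> complex"
  assumes f: "f \<in> polys" and h: "h \<in> polys"
  shows "(\<lambda>x. fock_inner (omega x f) h) \<in> borel_measurable (restrict_space borel Mp)"
proof -
  interpret g: sigma_finite_measure "gauss :: (complex^'n) measure"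
  proof
    have "emeasure (gauss :: (complex^'n) measure) UNIV < \<infinity>"
      using nn_integral_gauss_finite[of 0 0, where 'n = 'n] by simp
    then show "\<exists>A. countable A \<and> A \<subseteq> sets (gauss :: (complex^'n) measure) \<and> \<Union> A = space gauss \<and> (\<forall>a\<in>A. emeasure gauss a \<noteq> \<infinity>)"
      by (intro exI[of _ "{UNIV}"]) auto
  qed
  let ?R = "restrict_space borel Mp :: 'n mpair measure"
  \<comment> \<open>Naming separately what depends on \<open>g\<close>, on the scalar and on
    \<open>(z, w)\<close> lets joint measurability of the kernel be derived factor by
    factor.\<close>
  define H where "H i j x = calH (snd x) $ i $ j" for i j and x :: "'n mpair"
  define l where "l x = fst x" for x :: "'n mpair"
  define S where "S z w a = stack (\<chi> i. \<i> * z $ i) (\<chi> i. cnj (w $ i)) $ a" for z w :: "complex^'n" and a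
  have [measurable]: "H i j \<in> borel_measurable ?R" for i j
  proof (rule borel_measurable_continuous_on_restrict)
    show "continuous_on Mp (H i j)"
      unfolding H_def
      by (rule continuous_on_compose2[OF continuous_on_calH]) (auto intro!: continuous_intros simp: Mp_def)
  qed
  have [measurable]: "l \<in> borel_measurable ?R"
    unfolding l_def by (intro borel_measurable_continuous_on_restrict continuous_intros)
  have [measurable]: "f \<in> borel_measurable borel" "h \<in> borel_measurable borel"
    using f h polys_measurable by auto
  have [measurable]: "(\<lambda>(z, w). S z w a) \<in> borel_measurable (borel \<Otimes>\<^sub>M borel)" for a
    unfolding S_def by (cases a) simp_all
  have S2[measurable]: "(\<lambda>p. S (snd (fst p)) (snd p) a) \<in> borel_measurable ((?R \<Otimes>\<^sub>M borel) \<Otimes>\<^sub>M gauss)" for a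
  proof -
    have "(\<lambda>p. (snd (fst p), snd p)) \<in> ((?R \<Otimes>\<^sub>M borel) \<Otimes>\<^sub>M gauss) \<rightarrow>\<^sub>M (borel \<Otimes>\<^sub>M borel)"
      by measurable
    from measurable_compose[OF this, of "\<lambda>(z, w). S z w a"] show ?thesis by simp
  qed
  have om: "omega x f z = (\<integral>w. l x * exp (1/4 * (\<Sum>i\<in>UNIV. \<Sum>j\<in>UNIV. S z w i * H i j x * S z w j)) * f w \<partial>gauss)" for x z
    by (simp add: omega_def l_def H_def S_def bilin_def)
  have "(\<lambda>p. l (fst (fst p)) * exp (1/4 * (\<Sum>i\<in>UNIV. \<Sum>j\<in>UNIV.
       S (snd (fst p)) (snd p) i * H i j (fst (fst p)) * S (snd (fst p)) (snd p) j)) * f (snd p))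
     \<in> borel_measurable ((?R \<Otimes>\<^sub>M borel) \<Otimes>\<^sub>M gauss)"
    by measurable
  then have "(\<lambda>p. \<integral>w. l (fst p) * exp (1/4 * (\<Sum>i\<in>UNIV. \<Sum>j\<in>UNIV.
       S (snd p) w i * H i j (fst p) * S (snd p) w j)) * f w \<partial>gauss) \<in> borel_measurable (?R \<Otimes>\<^sub>M borel)"
    by (intro g.borel_measurable_lebesgue_integral) (simp add: split_beta)
  then have 1[measurable]: "(\<lambda>p. omega (fst p) f (snd p)) \<in> borel_measurable (?R \<Otimes>\<^sub>M borel)"
    by (simp only: om)
  have "(\<lambda>p. omega (fst p) f (snd p) * cnj (h (snd p))) \<in> borel_measurable (?R \<Otimes>\<^sub>M gauss)"
    by measurable
  then show ?thesis
    unfolding fock_inner_def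
    by (intro g.borel_measurable_lebesgue_integral) (simp add: split_beta)
qed

section \<open>Algebra of tensors and their coefficients\<close>

section \<open>Tensor products\<close>

abbreviation smult_pm :: "complex \<Rightarrow> ('x \<Rightarrow>\<^sub>0 complex) \<Rightarrow> ('x \<Rightarrow>\<^sub>0 complex)" where
  "smult_pm c a \<equiv> Poly_Mapping.map ((*) c) a"

lemma lookup_smult_pm [simp]: "Poly_Mapping.lookup (smult_pm c a) x = c * Poly_Mapping.lookup a x"
  by (simp add: Poly_Mapping.map.rep_eq when_def)

lemma smult_pm_minus_one: "smult_pm (- 1) a = - a"
  by (intro poly_mapping_eqI) simp

lemma keys_smult_pm: "Poly_Mapping.keys (smult_pm c a) \<subseteq> Poly_Mapping.keys a"
  by (auto simp: in_keys_iff)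

text \<open>One device for two uses: the functionals \<open>lin_ext\<close> and the map
  \<open>omega_free\<close> between free vector spaces.\<close>

definition pm_sum :: "('x \<Rightarrow> complex \<Rightarrow> 'b::ab_group_add) \<Rightarrow> ('x \<Rightarrow>\<^sub>0 complex) \<Rightarrow> 'b" where
  "pm_sum F a = (\<Sum>x\<in>Poly_Mapping.keys a. F x (Poly_Mapping.lookup a x))"

lemma pm_sum_superset:
  assumes "\<And>x. F x 0 = 0" "finite S" "Poly_Mapping.keys a \<subseteq> S"
  shows "pm_sum F a = (\<Sum>x\<in>S. F x (Poly_Mapping.lookup a x))"
  unfolding pm_sum_def using assms by (intro sum.mono_neutral_left) (auto simp: in_keys_iff)

lemma pm_sum_add:
  assumes add: "\<And>x c d. F x (c + d) = F x c + F x d"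
  shows "pm_sum F (a + b) = pm_sum F a + pm_sum F b"
proof -
  have F0: "F x 0 = 0" for x using add[of x 0 0] by simp
  let ?S = "Poly_Mapping.keys a \<union> Poly_Mapping.keys b"
  have "pm_sum F (a + b) = (\<Sum>x\<in>?S. F x (Poly_Mapping.lookup (a + b) x))"
    by (intro pm_sum_superset F0) (simp_all add: Poly_Mapping.keys_add)
  moreover have "pm_sum F a = (\<Sum>x\<in>?S. F x (Poly_Mapping.lookup a x))"
    "pm_sum F b = (\<Sum>x\<in>?S. F x (Poly_Mapping.lookup b x))"
    by (intro pm_sum_superset F0; simp)+
  ultimately show ?thesis by (simp add: lookup_add add sum.distrib)
qed

lemma pm_sum_single: "F x 0 = 0 \<Longrightarrow> pm_sum F (Poly_Mapping.single x c) = F x c"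
  by (simp add: pm_sum_def)

lemma pm_sum_diff:
  assumes add: "\<And>x c d. F x (c + d) = F x c + F x d"
  shows "pm_sum F (a - b) = pm_sum F a - pm_sum F b"
  using pm_sum_add[of F "a - b" b, OF add] by simp

definition lin_ext :: "('x \<Rightarrow> complex) \<Rightarrow> ('x \<Rightarrow>\<^sub>0 complex) \<Rightarrow> complex" where
  "lin_ext \<phi> = pm_sum (\<lambda>x c. c * \<phi> x)"

lemma lin_ext_add: "lin_ext \<phi> (a + b) = lin_ext \<phi> a + lin_ext \<phi> b"
  unfolding lin_ext_def by (rule pm_sum_add) (simp add: distrib_right)

lemma lin_ext_diff: "lin_ext \<phi> (a - b) = lin_ext \<phi> a - lin_ext \<phi> b"
  unfolding lin_ext_def by (rule pm_sum_diff) (simp add: distrib_right)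

lemma lin_ext_single [simp]: "lin_ext \<phi> (Poly_Mapping.single x c) = c * \<phi> x"
  by (simp add: lin_ext_def pm_sum_single)

lemma lin_ext_zero [simp]: "lin_ext \<phi> 0 = 0"
  by (simp add: lin_ext_def pm_sum_def)

lemma lin_ext_sum: "lin_ext \<phi> (\<Sum>i\<in>I. a i) = (\<Sum>i\<in>I. lin_ext \<phi> (a i))"
  by (induction I rule: infinite_finite_induct) (simp_all add: lin_ext_add)

lemma lin_ext_smult [simp]: "lin_ext \<phi> (smult_pm c a) = c * lin_ext \<phi> a"
proof -
  have "lin_ext \<phi> (smult_pm c a) = (\<Sum>x\<in>Poly_Mapping.keys a. Poly_Mapping.lookup (smult_pm c a) x * \<phi> x)"
    unfolding lin_ext_def by (rule pm_sum_superset) (simp_all add: keys_smult_pm)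
  then show ?thesis by (simp add: lin_ext_def pm_sum_def sum_distrib_left mult.assoc)
qed

lemma lin_ext_cong: "(\<And>x. x \<in> Poly_Mapping.keys a \<Longrightarrow> \<phi> x = \<psi> x) \<Longrightarrow> lin_ext \<phi> a = lin_ext \<psi> a"
  unfolding lin_ext_def pm_sum_def by (intro sum.cong) auto

text \<open>Conjugate linearity in a slot is not a separate case: it is encoded by the
  \<open>vscale\<close> of a factor of the form \<open>conj_space\<close>.\<close>

definition multilinear :: "'i set \<Rightarrow> ('i \<Rightarrow> 'v cspace) \<Rightarrow> (('i \<Rightarrow> 'v) \<Rightarrow> complex) \<Rightarrow> bool" where
  "multilinear I V \<phi> \<longleftrightarrow> (\<forall>x\<in>tuples I V. \<forall>i\<in>I. \<forall>u\<in>vecs (V i).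
     (\<forall>w\<in>vecs (V i). \<phi> (x(i := vadd (V i) u w)) = \<phi> (x(i := u)) + \<phi> (x(i := w))) \<and>
     (\<forall>c. \<phi> (x(i := vscale (V i) c u)) = c * \<phi> (x(i := u))))"

lemma lin_ext_rels: "r \<in> multilinear_rels I V \<Longrightarrow> multilinear I V \<phi> \<Longrightarrow> lin_ext \<phi> r = 0"
  by (induction rule: multilinear_rels.induct)
    (simp_all add: lin_ext_add lin_ext_diff multilinear_def)

lemma rels_uminus: "r \<in> multilinear_rels I V \<Longrightarrow> - r \<in> multilinear_rels I V"
  by (metis multilinear_rels.scale smult_pm_minus_one)

lemma rels_diff: "r \<in> multilinear_rels I V \<Longrightarrow> s \<in> multilinear_rels I V \<Longrightarrow> r - s \<in> multilinear_rels I V"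
  by (metis diff_conv_add_uminus multilinear_rels.plus rels_uminus)

lemma free_vecs_add: "a \<in> free_vecs I V \<Longrightarrow> b \<in> free_vecs I V \<Longrightarrow> a + b \<in> free_vecs I V"
  unfolding free_vecs_def using Poly_Mapping.keys_add[of a b] by auto

lemma free_vecs_smult: "a \<in> free_vecs I V \<Longrightarrow> smult_pm c a \<in> free_vecs I V"
  unfolding free_vecs_def using keys_smult_pm[of c a] by auto

lemma free_vecs_single: "x \<in> tuples I V \<Longrightarrow> Poly_Mapping.single x c \<in> free_vecs I V"
  by (simp add: free_vecs_def)

lemma free_vecs_zero: "0 \<in> free_vecs I V"
  by (simp add: free_vecs_def)

lemma free_vecs_sum: "(\<And>i. i \<in> J \<Longrightarrow> a i \<in> free_vecs I V) \<Longrightarrow> (\<Sum>i\<in>J. a i) \<in> free_vecs I V"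
  by (induction J rule: infinite_finite_induct) (auto intro: free_vecs_add free_vecs_zero)

lemma tensor_class_self: "a \<in> free_vecs I V \<Longrightarrow> a \<in> tensor_class I V a"
  by (simp add: tensor_class_def multilinear_rels.zero)

lemma tensor_class_eqI: "a - b \<in> multilinear_rels I V \<Longrightarrow> tensor_class I V a = tensor_class I V b"
proof -
  assume r: "a - b \<in> multilinear_rels I V"
  have "a - c \<in> multilinear_rels I V \<longleftrightarrow> b - c \<in> multilinear_rels I V" for c
    using multilinear_rels.plus[OF r, of "b - c"] rels_diff[OF _ r, of "a - c"] by auto
  then show ?thesis by (simp add: tensor_class_def)
qed

text \<open>The representative picked by \<open>tensor_lift\<close> differs from \<open>a\<close> by
  an element of \<open>multilinear_rels\<close>, which the linear extension of a multilinear map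
  annihilates.\<close>

lemma tensor_lift_class:
  assumes "multilinear I V \<phi>" "a \<in> free_vecs I V"
  shows "tensor_lift \<phi> (tensor_class I V a) = lin_ext \<phi> a"
proof -
  define b where "b = (SOME b. b \<in> tensor_class I V a)"
  have "b \<in> tensor_class I V a"
    unfolding b_def by (rule someI[of "\<lambda>b. b \<in> tensor_class I V a"], rule tensor_class_self[OF assms(2)])
  then have "a - b \<in> multilinear_rels I V" by (simp add: tensor_class_def)
  then have "lin_ext \<phi> a = lin_ext \<phi> b"
    using lin_ext_rels[OF _ assms(1)] lin_ext_diff[of \<phi> a b] by simp
  then show ?thesis by (simp add: tensor_lift_def Let_def b_def lin_ext_def pm_sum_def)
qed

lemma vecs_tensor_space: "vecs (tensor_space I V) = tensor_class I V ` free_vecs I V"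
  by (simp add: tensor_space_def)

text \<open>Addition is a union over all representatives; the classes in it coincide, and as the
  index sets are nonempty the union is that one class.\<close>

lemma vadd_tensor_space:
  assumes "a \<in> free_vecs I V" "b \<in> free_vecs I V"
  shows "vadd (tensor_space I V) (tensor_class I V a) (tensor_class I V b) = tensor_class I V (a + b)"
proof -
  have "tensor_class I V (a' + b') = tensor_class I V (a + b)"
    if "a' \<in> tensor_class I V a" "b' \<in> tensor_class I V b" for a' b'
  proof -
    have "(a - a') + (b - b') \<in> multilinear_rels I V"
      using that by (intro multilinear_rels.plus) (auto simp: tensor_class_def)
    then show ?thesis by (intro tensor_class_eqI[symmetric]) (simp add: algebra_simps)
  qed
  then have "vadd (tensor_space I V) (tensor_class I V a) (tensor_class I V b)
      = (\<Union>a'\<in>tensor_class I V a. \<Union>b'\<in>tensor_class I V b. tensor_class I V (a + b))"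
    by (simp add: tensor_space_def cong: SUP_cong)
  moreover have "tensor_class I V a \<noteq> {}" "tensor_class I V b \<noteq> {}"
    using tensor_class_self assms by blast+
  ultimately show ?thesis by simp
qed

lemma vscale_tensor_space:
  assumes "a \<in> free_vecs I V"
  shows "vscale (tensor_space I V) c (tensor_class I V a) = tensor_class I V (smult_pm c a)"
proof -
  have "tensor_class I V (smult_pm c a') = tensor_class I V (smult_pm c a)"
    if "a' \<in> tensor_class I V a" for a'
  proof -
    have "smult_pm c (a - a') \<in> multilinear_rels I V"
      using that by (intro multilinear_rels.scale) (auto simp: tensor_class_def)
    moreover have "smult_pm c (a - a') = smult_pm c a - smult_pm c a'"
      by (intro poly_mapping_eqI) (simp add: lookup_minus right_diff_distrib)
    ultimately show ?thesis by (intro tensor_class_eqI[symmetric]) simp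
  qed
  then have "vscale (tensor_space I V) c (tensor_class I V a)
      = (\<Union>a'\<in>tensor_class I V a. tensor_class I V (smult_pm c a))"
    by (simp add: tensor_space_def cong: SUP_cong)
  moreover have "tensor_class I V a \<noteq> {}" using tensor_class_self assms by blast
  ultimately show ?thesis by simp
qed

section \<open>The tensor powers of the oscillator representation\<close>

lemma conj_space_simps [simp]:
  "vecs (conj_space V) = vecs V" "vadd (conj_space V) = vadd V" "vscale (conj_space V) c = vscale V (cnj c)"
  by (simp_all add: conj_space_def)

lemma fun_space_simps [simp]:
  "vecs (fun_space S) = S" "vadd (fun_space S) f h = (\<lambda>x. f x + h x)" "vscale (fun_space S) c f = (\<lambda>x. c * f x)"
  by (simp_all add: fun_space_def)

lemma factors_simps:
  "vecs (factors p V k) = vecs V" "vadd (factors p V k) = vadd V"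
  "vscale (factors p V k) c = vscale V (if k < p then c else cnj c)"
  by (simp_all add: factors_def)

definition pair_prod :: "nat \<Rightarrow> nat \<Rightarrow> (nat \<Rightarrow> complex^'n::finite \<Rightarrow> complex) \<Rightarrow> (nat \<Rightarrow> complex^'n \<Rightarrow> complex) \<Rightarrow> complex" where
  "pair_prod p N u v = (\<Prod>k<N. if k < p then fock_inner (u k) (v k) else fock_inner (v k) (u k))"

lemma prod_fun_upd:
  "finite I \<Longrightarrow> i \<in> I \<Longrightarrow> (\<Prod>k\<in>I. F k ((x(i := y)) k)) = F i y * (\<Prod>k\<in>I - {i}. F k (x k))"
  for F :: "'i \<Rightarrow> 'v \<Rightarrow> 'c::comm_monoid_mult"
  by (subst prod.remove[of I i]) (auto intro!: arg_cong2[of _ _ _ _ "(*)"] prod.cong)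

lemma multilinear_prod:
  fixes F :: "nat \<Rightarrow> 'v \<Rightarrow> complex"
  assumes "\<And>i u w. i < N \<Longrightarrow> u \<in> vecs (V i) \<Longrightarrow> w \<in> vecs (V i) \<Longrightarrow> F i (vadd (V i) u w) = F i u + F i w"
    "\<And>i u c. i < N \<Longrightarrow> u \<in> vecs (V i) \<Longrightarrow> F i (vscale (V i) c u) = c * F i u"
  shows "multilinear {..<N} V (\<lambda>x. \<Prod>k<N. F k (x k))"
  using assms by (simp add: multilinear_def prod_fun_upd[where F = F] distrib_right mult.assoc del: fun_upd_apply)

lemma multilinear_pair_prod_left:
  assumes v: "v \<in> tuples {..<N} (factors p (fun_space polys))"
  shows "multilinear {..<N} (factors p (fun_space fock)) (\<lambda>u. pair_prod p N u v)"
proof -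
  have "v k \<in> polys" if "k < N" for k
    using v that by (auto simp: tuples_def factors_simps)
  then show ?thesis
    unfolding pair_prod_def
    by (intro multilinear_prod[where F = "\<lambda>k y. if k < p then fock_inner y (v k) else fock_inner (v k) y"])
      (auto simp: factors_simps fock_inner_add fock_inner_cmult)
qed

lemma multilinear_pair_prod_right:
  assumes u: "u \<in> tuples {..<N} (factors p (fun_space fock))"
  shows "multilinear {..<N} (factors p (fun_space polys)) (\<lambda>v. cnj (pair_prod p N u v))"
proof -
  have "u k \<in> fock" if "k < N" for k
    using u that by (auto simp: tuples_def factors_simps)
  then show ?thesis
    unfolding pair_prod_def cnj_prod
    by (intro multilinear_prod[where F = "\<lambda>k y. cnj (if k < p then fock_inner (u k) y else fock_inner y (u k))"])
      (auto simp: factors_simps fock_inner_add_polys fock_inner_cmult)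
qed

lemma multilinear_sum:
  assumes "\<And>j. j \<in> J \<Longrightarrow> multilinear I V (\<phi> j)"
  shows "multilinear I V (\<lambda>x. \<Sum>j\<in>J. c j * \<phi> j x)"
  using assms unfolding multilinear_def
  by (simp add: distrib_left sum.distrib sum_distrib_left mult.left_commute)

text \<open>Two nested lifts, each with its own choice of representative. The outer one is resolved
  while the second tensor is still represented by the chosen \<open>b'\<close>; then
  \<open>b'\<close> is exchanged for \<open>b\<close> for each tuple \<open>u\<close> separately.
  The first tensor comes from Fock space and the second from polynomials, the pairing for which
  products are known to be integrable.\<close>

lemma inner_pq_class:
  assumes a: "a \<in> free_vecs {..<p + q} (factors p (fun_space fock))"
    and b: "b \<in> free_vecs {..<p + q} (factors p (fun_space polys))"
  shows "inner_pq p q (tensor_class {..<p + q} (factors p (fun_space fock)) a)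
      (tensor_class {..<p + q} (factors p (fun_space polys)) b)
    = lin_ext (\<lambda>u. cnj (lin_ext (\<lambda>v. cnj (pair_prod p (p + q) u v)) b)) a"
    (is "inner_pq p q ?U ?V = _")
proof -
  define b' where "b' = (SOME b'. b' \<in> ?V)"
  have b': "b' \<in> ?V"
    unfolding b'_def by (rule someI[of "\<lambda>b'. b' \<in> ?V"], rule tensor_class_self[OF b])
  have lift: "tensor_lift \<psi> ?V = lin_ext \<psi> b'" for \<psi>
    by (simp add: tensor_lift_def Let_def b'_def lin_ext_def pm_sum_def)
  have "inner_pq p q ?U ?V = tensor_lift (\<lambda>u. cnj (lin_ext (\<lambda>v. cnj (pair_prod p (p + q) u v)) b')) ?U"
    unfolding inner_pq_def lift[symmetric] pair_prod_def ..
  also have "\<dots> = lin_ext (\<lambda>u. cnj (lin_ext (\<lambda>v. cnj (pair_prod p (p + q) u v)) b')) a"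
  proof (rule tensor_lift_class[OF _ a])
    have "multilinear {..<p + q} (factors p (fun_space fock))
       (\<lambda>u. \<Sum>v\<in>Poly_Mapping.keys b'. cnj (Poly_Mapping.lookup b' v) * pair_prod p (p + q) u v)"
      using b' by (intro multilinear_sum multilinear_pair_prod_left) (auto simp: tensor_class_def free_vecs_def)
    then show "multilinear {..<p + q} (factors p (fun_space fock))
       (\<lambda>u. cnj (lin_ext (\<lambda>v. cnj (pair_prod p (p + q) u v)) b'))"
      by (simp add: lin_ext_def pm_sum_def)
  qed
  also have "\<dots> = lin_ext (\<lambda>u. cnj (lin_ext (\<lambda>v. cnj (pair_prod p (p + q) u v)) b)) a"
  proof (rule lin_ext_cong, rule arg_cong[where f = cnj])
    fix u assume "u \<in> Poly_Mapping.keys a"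
    then have u: "u \<in> tuples {..<p + q} (factors p (fun_space fock))" using a by (auto simp: free_vecs_def)
    have "lin_ext (\<lambda>v. cnj (pair_prod p (p + q) u v)) (b - b') = 0"
      using b' by (intro lin_ext_rels[OF _ multilinear_pair_prod_right[OF u]]) (simp add: tensor_class_def)
    then show "lin_ext (\<lambda>v. cnj (pair_prod p (p + q) u v)) b' = lin_ext (\<lambda>v. cnj (pair_prod p (p + q) u v)) b"
      by (simp add: lin_ext_diff)
  qed
  finally show ?thesis .
qed

definition omega_tuple :: "nat \<Rightarrow> 'n::finite mpair \<Rightarrow> (nat \<Rightarrow> complex^'n \<Rightarrow> complex) \<Rightarrow> nat \<Rightarrow> complex^'n \<Rightarrow> complex" where
  "omega_tuple N x u = (\<lambda>k\<in>{..<N}. omega x (u k))"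

definition omega_free :: "nat \<Rightarrow> 'n::finite mpair \<Rightarrow> ((nat \<Rightarrow> complex^'n \<Rightarrow> complex) \<Rightarrow>\<^sub>0 complex) \<Rightarrow>
    ((nat \<Rightarrow> complex^'n \<Rightarrow> complex) \<Rightarrow>\<^sub>0 complex)" where
  "omega_free N x = pm_sum (\<lambda>u c. Poly_Mapping.single (omega_tuple N x u) c)"

lemma omega_free_add: "omega_free N x (a + b) = omega_free N x a + omega_free N x b"
  unfolding omega_free_def by (rule pm_sum_add) (simp add: single_add)

lemma omega_free_diff: "omega_free N x (a - b) = omega_free N x a - omega_free N x b"
  unfolding omega_free_def by (rule pm_sum_diff) (simp add: single_add)

lemma omega_free_single: "omega_free N x (Poly_Mapping.single u c) = Poly_Mapping.single (omega_tuple N x u) c"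
  unfolding omega_free_def by (rule pm_sum_single) simp

lemma omega_free_smult: "omega_free N x (smult_pm c a) = smult_pm c (omega_free N x a)"
proof -
  have "omega_free N x (smult_pm c a)
      = (\<Sum>u\<in>Poly_Mapping.keys a. Poly_Mapping.single (omega_tuple N x u) (Poly_Mapping.lookup (smult_pm c a) u))"
    unfolding omega_free_def by (rule pm_sum_superset) (simp_all add: keys_smult_pm)
  also have "\<dots> = smult_pm c (omega_free N x a)"
    by (intro poly_mapping_eqI)
      (simp add: omega_free_def pm_sum_def lookup_sum sum_distrib_left lookup_single when_def if_distrib cong: if_cong)
  finally show ?thesis .
qed

lemma lin_ext_omega_free: "lin_ext \<phi> (omega_free N x a) = lin_ext (\<lambda>u. \<phi> (omega_tuple N x u)) a"
  unfolding omega_free_def pm_sum_def[of "\<lambda>u c. Poly_Mapping.single (omega_tuple N x u) c"]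
  by (simp add: lin_ext_sum) (simp add: lin_ext_def pm_sum_def)

lemma omega_tuple_upd: "i < N \<Longrightarrow> omega_tuple N x (u(i := f)) = (omega_tuple N x u)(i := omega x f)"
  by (auto simp: omega_tuple_def fun_eq_iff)

lemma omega_tuple_tuples:
  assumes "x \<in> Mp" "u \<in> tuples {..<N} (factors p (fun_space polys))"
  shows "omega_tuple N x u \<in> tuples {..<N} (factors p (fun_space fock))"
  using assms by (auto simp: tuples_def factors_simps omega_tuple_def PiE_iff omega_fock)

text \<open>Linearity of \<open>omega x\<close> sends each relation to one of the same kind. On the
  conjugate factors the scalar is conjugated in the source and in the target alike, so the same
  operator serves there.\<close>

lemma omega_free_rels:
  assumes x: "x \<in> Mp" and r: "r \<in> multilinear_rels {..<N} (factors p (fun_space polys))"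
  shows "omega_free N x r \<in> multilinear_rels {..<N} (factors p (fun_space fock))"
  using r
proof induction
  case zero
  then show ?case by (simp add: omega_free_def pm_sum_def multilinear_rels.zero)
next
  case (additive t i u w)
  then have i: "i < N" and uw: "u \<in> polys" "w \<in> polys" by (simp_all add: factors_simps)
  have "omega x (vadd (factors p (fun_space polys) i) u w) = vadd (factors p (fun_space fock) i) (omega x u) (omega x w)"
    using uw x by (simp add: factors_simps omega_add)
  moreover have "Poly_Mapping.single ((omega_tuple N x t)(i := vadd (factors p (fun_space fock) i) (omega x u) (omega x w))) 1
      - Poly_Mapping.single ((omega_tuple N x t)(i := omega x u)) 1
      - Poly_Mapping.single ((omega_tuple N x t)(i := omega x w)) 1
    \<in> multilinear_rels {..<N} (factors p (fun_space fock))"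
    using uw i
    by (intro multilinear_rels.additive omega_tuple_tuples x additive) (simp_all add: factors_simps omega_fock x)
  ultimately show ?case
    unfolding omega_free_diff omega_free_single omega_tuple_upd[OF i] by simp
next
  case (homogeneous t i u c)
  then have i: "i < N" and u: "u \<in> polys" by (simp_all add: factors_simps)
  have "omega x (vscale (factors p (fun_space polys) i) c u) = vscale (factors p (fun_space fock) i) c (omega x u)"
    by (simp add: factors_simps omega_cmult)
  moreover have "Poly_Mapping.single ((omega_tuple N x t)(i := vscale (factors p (fun_space fock) i) c (omega x u))) 1
      - Poly_Mapping.single ((omega_tuple N x t)(i := omega x u)) c
    \<in> multilinear_rels {..<N} (factors p (fun_space fock))"
    using u i
    by (intro multilinear_rels.homogeneous omega_tuple_tuples x homogeneous) (simp_all add: factors_simps omega_fock x)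
  ultimately show ?case
    unfolding omega_free_diff omega_free_single omega_tuple_upd[OF i] by simp
qed (auto simp: omega_free_add omega_free_smult intro: multilinear_rels.plus multilinear_rels.scale)

lemma omega_free_free_vecs:
  assumes "x \<in> Mp" "a \<in> free_vecs {..<N} (factors p (fun_space polys))"
  shows "omega_free N x a \<in> free_vecs {..<N} (factors p (fun_space fock))"
  unfolding omega_free_def pm_sum_def using assms
  by (intro free_vecs_sum free_vecs_single omega_tuple_tuples) (auto simp: free_vecs_def)

lemma omega_pq_class:
  assumes x: "x \<in> Mp" and a: "a \<in> free_vecs {..<p + q} (factors p (fun_space polys))"
  shows "omega_pq p q x (tensor_class {..<p + q} (factors p (fun_space polys)) a)
    = tensor_class {..<p + q} (factors p (fun_space fock)) (omega_free (p + q) x a)"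
proof -
  let ?c = "tensor_class {..<p + q} (factors p (fun_space fock))"
  have "?c (omega_free (p + q) x a') = ?c (omega_free (p + q) x a)"
    if "a' \<in> tensor_class {..<p + q} (factors p (fun_space polys)) a" for a'
    using omega_free_rels[OF x, of "a - a'"] that
    by (intro tensor_class_eqI[symmetric]) (simp add: tensor_class_def omega_free_diff)
  then have "omega_pq p q x (tensor_class {..<p + q} (factors p (fun_space polys)) a)
    = (\<Union>a'\<in>tensor_class {..<p + q} (factors p (fun_space polys)) a. ?c (omega_free (p + q) x a))"
    by (simp add: omega_pq_def omega_free_def pm_sum_def omega_tuple_def cong: SUP_cong)
  moreover have "tensor_class {..<p + q} (factors p (fun_space polys)) a \<noteq> {}"
    using tensor_class_self[OF a] by blast
  ultimately show ?thesis by simp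
qed

text \<open>Linearity of \<open>omega x\<close> and membership of \<open>omega x f\<close> in Fock
  space are available for \<open>x\<close> in \<open>Mp\<close>. With the value 0 elsewhere,
  linearity in \<open>f\<close> and \<open>h\<close> becomes an identity of functions on the whole
  type, as membership in \<open>cspan\<close> requires.\<close>

definition osc_coeff :: "(complex^'n::finite \<Rightarrow> complex) \<Rightarrow> (complex^'n \<Rightarrow> complex) \<Rightarrow> 'n mpair \<Rightarrow> complex" where
  "osc_coeff f h x = (if x \<in> Mp then fock_inner (omega x f) h else 0)"

definition tuple_coeff :: "nat \<Rightarrow> nat \<Rightarrow> (nat \<Rightarrow> complex^'n::finite \<Rightarrow> complex) \<Rightarrow> (nat \<Rightarrow> complex^'n \<Rightarrow> complex) \<Rightarrow> 'n mpair \<Rightarrow> complex" where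
  "tuple_coeff p N u v x = (\<Prod>k<N. if k < p then osc_coeff (u k) (v k) x else cnj (osc_coeff (u k) (v k) x))"

definition free_coeff :: "nat \<Rightarrow> nat \<Rightarrow> ((nat \<Rightarrow> complex^'n::finite \<Rightarrow> complex) \<Rightarrow>\<^sub>0 complex) \<Rightarrow>
    ((nat \<Rightarrow> complex^'n \<Rightarrow> complex) \<Rightarrow>\<^sub>0 complex) \<Rightarrow> 'n mpair \<Rightarrow> complex" where
  "free_coeff p N a b x = lin_ext (\<lambda>u. cnj (lin_ext (\<lambda>v. cnj (tuple_coeff p N u v x)) b)) a"

lemma inner_omega_class:
  assumes x: "x \<in> Mp" and a: "a \<in> free_vecs {..<p + q} (factors p (fun_space polys))"
    and b: "b \<in> free_vecs {..<p + q} (factors p (fun_space polys))"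
  shows "inner_pq p q (omega_pq p q x (tensor_class {..<p + q} (factors p (fun_space polys)) a))
      (tensor_class {..<p + q} (factors p (fun_space polys)) b) = free_coeff p (p + q) a b x"
proof -
  have "pair_prod p N (omega_tuple N x u) v = tuple_coeff p N u v x" for N u v
    unfolding pair_prod_def tuple_coeff_def using x
    by (intro prod.cong) (auto simp: omega_tuple_def osc_coeff_def cnj_fock_inner)
  then show ?thesis
    unfolding omega_pq_class[OF x a] inner_pq_class[OF omega_free_free_vecs[OF x a] b]
      lin_ext_omega_free free_coeff_def by simp
qed

lemma free_coeff_linear:
  "free_coeff p N (a + a') b x = free_coeff p N a b x + free_coeff p N a' b x"
  "free_coeff p N a (b + b') x = free_coeff p N a b x + free_coeff p N a b' x"
  "free_coeff p N (smult_pm c a) b x = c * free_coeff p N a b x"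
  "free_coeff p N a (smult_pm c b) x = cnj c * free_coeff p N a b x"
  by (simp_all add: free_coeff_def lin_ext_add)
    (simp_all add: lin_ext_def pm_sum_def distrib_left sum.distrib sum_distrib_left mult.left_commute)

text \<open>What makes \<open>matcoeff\<close> well defined on \<open>tensor2\<close>: the
  coefficient is conjugate linear in the second tensor, hence linear for the scalar multiplication
  of \<open>conj_space\<close>.\<close>

lemma multilinear_inner_omega:
  fixes p q :: nat and x :: "'n::finite mpair"
  defines "P \<equiv> polys_pq p q :: 'n tens cspace"
  assumes x: "x \<in> Mp"
  shows "multilinear UNIV (\<lambda>i. if i then conj_space P else P)
    (\<lambda>t. inner_pq p q (omega_pq p q x (t False)) (t True))"
proof -
  let ?I = "{..<p + q}" and ?F = "factors p (fun_space polys) :: nat \<Rightarrow> (complex^'n \<Rightarrow> complex) cspace"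
  have P: "P = tensor_space ?I ?F" by (simp add: P_def polys_pq_def mixed_tensors_def)
  have vP: "vecs P = tensor_class ?I ?F ` free_vecs ?I ?F" by (simp add: P vecs_tensor_space)
  let ?g = "\<lambda>U V. inner_pq p q (omega_pq p q x U) V"
  have g: "?g (tensor_class ?I ?F a) (tensor_class ?I ?F b) = free_coeff p (p + q) a b x"
    if "a \<in> free_vecs ?I ?F" "b \<in> free_vecs ?I ?F" for a b
    by (rule inner_omega_class[OF x that])
  have H: "?g (vadd P U U') V = ?g U V + ?g U' V" "?g V (vadd P U U') = ?g V U + ?g V U'"
    "?g (vscale P c U) V = c * ?g U V" "?g V (vscale P c U) = cnj c * ?g V U"
    if "U \<in> vecs P" "U' \<in> vecs P" "V \<in> vecs P" for U U' V c
    using that unfolding vP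
    by (auto simp: P vadd_tensor_space vscale_tensor_space g free_vecs_add free_vecs_smult free_coeff_linear)
  show ?thesis
    unfolding multilinear_def
  proof (intro ballI conjI allI)
    fix t i u
    assume t: "t \<in> tuples UNIV (\<lambda>i. if i then conj_space P else P)"
      and u: "u \<in> vecs (if i then conj_space P else P)"
    have tP: "t j \<in> vecs P" for j
      using t by (cases j) (auto simp: tuples_def PiE_def Pi_def dest: spec[of _ j])
    have uP: "u \<in> vecs P" using u by (cases i) auto
    show "?g ((t(i := vscale (if i then conj_space P else P) c u)) False) ((t(i := vscale (if i then conj_space P else P) c u)) True)
        = c * ?g ((t(i := u)) False) ((t(i := u)) True)" for c
      by (cases i) (simp_all add: H(3,4)[OF uP uP tP])
    fix w assume "w \<in> vecs (if i then conj_space P else P)"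
    then have wP: "w \<in> vecs P" by (cases i) auto
    show "?g ((t(i := vadd (if i then conj_space P else P) u w)) False) ((t(i := vadd (if i then conj_space P else P) u w)) True)
        = ?g ((t(i := u)) False) ((t(i := u)) True) + ?g ((t(i := w)) False) ((t(i := w)) True)"
      by (cases i) (simp_all add: H(1,2)[OF uP wP tP])
  qed
qed

section \<open>Spans and orthonormalisation in square integrable functions\<close>

section \<open>Complex spans\<close>

lemma cspan_base: "h \<in> S \<Longrightarrow> h \<in> cspan S"
  unfolding cspan_def by (auto intro!: exI[of _ "{h}"] exI[of _ "\<lambda>_. 1"])

lemma cspan_zero: "(\<lambda>x. 0) \<in> cspan S"
  unfolding cspan_def by (auto intro!: exI[of _ "{}"])

lemma cspan_add: "f \<in> cspan S \<Longrightarrow> g \<in> cspan S \<Longrightarrow> (\<lambda>x. f x + g x) \<in> cspan S"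
proof -
  assume "f \<in> cspan S" "g \<in> cspan S"
  then obtain A c B d where A: "finite A" "A \<subseteq> S" "f = (\<lambda>x. \<Sum>h\<in>A. c h * h x)"
    and B: "finite B" "B \<subseteq> S" "g = (\<lambda>x. \<Sum>h\<in>B. d h * h x)" by (auto simp: cspan_def)
  have restrict: "(\<Sum>h\<in>A \<union> B. (if h \<in> X then e h else 0) * h x) = (\<Sum>h\<in>X. e h * h x)"
    if "X \<subseteq> A \<union> B" for X e x
    using that A(1) B(1) by (intro sum.mono_neutral_cong_right) auto
  have eq: "(\<lambda>x. f x + g x) = (\<lambda>x. \<Sum>h\<in>A \<union> B.
      ((if h \<in> A then c h else 0) + (if h \<in> B then d h else 0)) * h x)"
    by (simp add: distrib_right sum.distrib restrict A(3) B(3))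
  have fin: "finite (A \<union> B)" "A \<union> B \<subseteq> S" using A B by auto
  show ?thesis
    unfolding cspan_def by (rule CollectI, rule exI, rule exI, rule conjI, rule fin, rule conjI, rule fin, rule eq)
qed

lemma cspan_cmult: "f \<in> cspan S \<Longrightarrow> (\<lambda>x. c * f x) \<in> cspan S"
proof -
  assume "f \<in> cspan S"
  then obtain A d where A: "finite A" "A \<subseteq> S" "f = (\<lambda>x. \<Sum>h\<in>A. d h * h x)" by (auto simp: cspan_def)
  have eq: "(\<lambda>x. c * f x) = (\<lambda>x. \<Sum>h\<in>A. (c * d h) * h x)" by (simp add: A(3) sum_distrib_left mult.assoc)
  show ?thesis
    unfolding cspan_def by (rule CollectI, rule exI, rule exI, rule conjI, rule A, rule conjI, rule A, rule eq)
qed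

lemma cspan_sum: "(\<And>i. i \<in> I \<Longrightarrow> f i \<in> cspan S) \<Longrightarrow> (\<lambda>x. \<Sum>i\<in>I. f i x) \<in> cspan S"
  by (induction I rule: infinite_finite_induct) (auto intro: cspan_add cspan_zero)

lemma cspan_induct [consumes 1, case_names base zero add]:
  assumes "f \<in> cspan S"
    and base: "\<And>c h. h \<in> S \<Longrightarrow> P (\<lambda>x. c * h x)" and zero: "P (\<lambda>x. 0)"
    and add: "\<And>f g. P f \<Longrightarrow> P g \<Longrightarrow> P (\<lambda>x. f x + g x)"
  shows "P f"
proof -
  obtain A d where A: "finite A" "A \<subseteq> S" "f = (\<lambda>x. \<Sum>h\<in>A. d h * h x)" using assms(1) by (auto simp: cspan_def)
  have "P (\<lambda>x. \<Sum>h\<in>A. d h * h x)" using A(1,2)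
    by induction (auto intro: add base zero)
  then show ?thesis by (simp add: A(3))
qed

lemma cspan_mult:
  assumes "f \<in> cspan A" "g \<in> cspan B" "\<And>a b. a \<in> A \<Longrightarrow> b \<in> B \<Longrightarrow> (\<lambda>x. a x * b x) \<in> cspan C"
  shows "(\<lambda>x. f x * g x) \<in> cspan C"
  using assms(1)
proof (induction f rule: cspan_induct)
  case (base c h)
  show ?case using assms(2)
  proof (induction g rule: cspan_induct)
    case (base d k)
    have "(\<lambda>x. c * h x * (d * k x)) = (\<lambda>x. (c * d) * (h x * k x))" by (simp add: mult_ac)
    then show ?case by (simp only:) (intro cspan_cmult assms(3) base \<open>h \<in> A\<close>)
  qed (auto simp: distrib_left cspan_add cspan_zero)
qed (auto simp: distrib_right cspan_add cspan_zero)

section \<open>Gram-Schmidt orthonormalisation\<close>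

lemma L2_measurable: "f \<in> L2 M \<Longrightarrow> f \<in> borel_measurable M"
  by (simp add: L2_def)

lemma integrable_L2_mult: "f \<in> L2 M \<Longrightarrow> h \<in> L2 M \<Longrightarrow> integrable M (\<lambda>x. f x * cnj (h x))"
  unfolding L2_def by (intro integrable_mult_cnj) auto

lemma L2_add: "f \<in> L2 M \<Longrightarrow> h \<in> L2 M \<Longrightarrow> (\<lambda>x. f x + h x) \<in> L2 M"
proof -
  assume f: "f \<in> L2 M" and h: "h \<in> L2 M"
  have [measurable]: "f \<in> borel_measurable M" "h \<in> borel_measurable M"
    using f h by (simp_all add: L2_def)
  have "integrable M (\<lambda>x. (norm (f x + h x))\<^sup>2)"
  proof (rule Bochner_Integration.integrable_bound)
    show "integrable M (\<lambda>x. 2 * (norm (f x))\<^sup>2 + 2 * (norm (h x))\<^sup>2)"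
      using f h by (simp add: L2_def)
    show "AE x in M. norm ((norm (f x + h x))\<^sup>2) \<le> norm (2 * (norm (f x))\<^sup>2 + 2 * (norm (h x))\<^sup>2)"
    proof (rule AE_I2)
      fix x
      have "(norm (f x + h x))\<^sup>2 \<le> (norm (f x) + norm (h x))\<^sup>2" by (intro power_mono norm_triangle_ineq) auto
      then show "norm ((norm (f x + h x))\<^sup>2) \<le> norm (2 * (norm (f x))\<^sup>2 + 2 * (norm (h x))\<^sup>2)"
        using sum_squares_bound[of "norm (f x)" "norm (h x)"] by (simp add: power2_sum)
    qed
  qed measurable
  then show ?thesis by (simp add: L2_def)
qed

lemma L2_cmult: "f \<in> L2 M \<Longrightarrow> (\<lambda>x. c * f x) \<in> L2 M"
  by (auto simp: L2_def norm_mult power_mult_distrib intro: borel_measurable_times)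

lemma L2_zero: "(\<lambda>x. 0) \<in> L2 M"
  by (simp add: L2_def)

lemma L2_cspan:
  assumes "S \<subseteq> L2 M" "f \<in> cspan S" shows "f \<in> L2 M"
  using assms(2)
  by (induction f rule: cspan_induct) (use assms(1) in \<open>auto intro: L2_cmult L2_add L2_zero\<close>)

lemma L2_inner_add_left:
  "f \<in> L2 M \<Longrightarrow> g \<in> L2 M \<Longrightarrow> h \<in> L2 M \<Longrightarrow> L2_inner M (\<lambda>x. f x + g x) h = L2_inner M f h + L2_inner M g h"
  by (simp add: L2_inner_def distrib_right integrable_L2_mult)

lemma L2_inner_cmult_left: "L2_inner M (\<lambda>x. c * f x) h = c * L2_inner M f h"
  by (simp add: L2_inner_def mult.assoc)

lemma cnj_L2_inner: "cnj (L2_inner M f h) = L2_inner M h f"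
proof -
  have "cnj (L2_inner M f h) = (\<integral>x. cnj (f x * cnj (h x)) \<partial>M)"
    unfolding L2_inner_def by (rule Bochner_Integration.integral_cnj[symmetric])
  then show ?thesis by (simp add: L2_inner_def mult.commute)
qed

lemma L2_inner_sum_left:
  assumes "\<And>e. e \<in> E \<Longrightarrow> e \<in> L2 M" "h \<in> L2 M"
  shows "L2_inner M (\<lambda>x. \<Sum>e\<in>E. c e * e x) h = (\<Sum>e\<in>E. c e * L2_inner M e h)"
  using assms
proof (induction E rule: infinite_finite_induct)
  case (insert e E)
  have "(\<lambda>x. \<Sum>e\<in>E. c e * e x) \<in> L2 M"
    using insert by (intro L2_cspan[of E]) (auto simp: cspan_def)
  with insert show ?case by (simp add: L2_inner_add_left L2_inner_cmult_left L2_cmult)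
qed (simp_all add: L2_inner_def)

lemma L2_inner_self:
  assumes "f \<in> L2 M"
  shows "L2_inner M f f = of_real (\<integral>x. (norm (f x))\<^sup>2 \<partial>M)"
    "(\<integral>\<^sup>+x. ennreal ((norm (f x))\<^sup>2) \<partial>M) = ennreal (\<integral>x. (norm (f x))\<^sup>2 \<partial>M)"
proof -
  show "L2_inner M f f = of_real (\<integral>x. (norm (f x))\<^sup>2 \<partial>M)"
    unfolding L2_inner_def by (simp only: complex_norm_square[symmetric] of_real_power[symmetric] integral_complex_of_real)
  show "(\<integral>\<^sup>+x. ennreal ((norm (f x))\<^sup>2) \<partial>M) = ennreal (\<integral>x. (norm (f x))\<^sup>2 \<partial>M)"
    using assms by (intro nn_integral_eq_integral) (auto simp: L2_def)
qed

definition orthonormal_set :: "'x measure \<Rightarrow> ('x \<Rightarrow> complex) set \<Rightarrow> bool" where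
  "orthonormal_set M E \<longleftrightarrow> (\<forall>e\<in>E. \<forall>e'\<in>E. L2_inner M e e' = (if e = e' then 1 else 0))"

text \<open>Functions vanishing almost everywhere force the step to allow for a null function as residual.\<close>

lemma gram_schmidt_step:
  assumes E: "finite E" "E \<subseteq> cspan S" "orthonormal_set M E" and S: "S \<subseteq> L2 M" and f: "f \<in> cspan S"
  shows "\<exists>E'. finite E' \<and> E \<subseteq> E' \<and> E' \<subseteq> cspan S \<and> orthonormal_set M E' \<and>
    (\<exists>h\<in>cspan E'. (\<integral>\<^sup>+x. ennreal ((norm (f x - h x))\<^sup>2) \<partial>M) = 0)"
proof -
  define h where "h x = (\<Sum>e\<in>E. L2_inner M f e * e x)" for x
  define r where "r x = f x - h x" for x
  have EL: "e \<in> L2 M" if "e \<in> E" for e using that E(2) L2_cspan[OF S] by blast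
  have fL: "f \<in> L2 M" using L2_cspan[OF S f] .
  have hE: "h \<in> cspan E" unfolding h_def cspan_def using E(1) by auto
  have hS: "h \<in> cspan S"
    unfolding h_def[abs_def] using E(2) by (intro cspan_sum cspan_cmult) auto
  have rS: "r \<in> cspan S"
    using cspan_add[OF f cspan_cmult[OF hS, of "-1"]] by (simp add: r_def[abs_def])
  have rL: "r \<in> L2 M" using L2_cspan[OF S rS] .
  have r_orth: "L2_inner M r e = 0" if "e \<in> E" for e
  proof -
    have "L2_inner M h e = (\<Sum>e'\<in>E. L2_inner M f e' * L2_inner M e' e)"
      unfolding h_def by (rule L2_inner_sum_left) (auto intro: EL that)
    also have "\<dots> = (\<Sum>e'\<in>E. if e' = e then L2_inner M f e' else 0)"
      using E(3) that by (intro sum.cong) (auto simp: orthonormal_set_def)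
    also have "\<dots> = L2_inner M f e"
      using E(1) that by (simp add: sum.delta)
    finally have "L2_inner M h e = L2_inner M f e" .
    moreover have "L2_inner M (\<lambda>x. f x + (-1) * h x) e = L2_inner M f e + (-1) * L2_inner M h e"
      using EL[OF that] fL L2_cspan[OF S hS]
      by (simp only: L2_inner_add_left L2_cmult L2_inner_cmult_left)
    ultimately show ?thesis by (simp add: r_def[abs_def])
  qed
  define n where "n = (\<integral>x. (norm (r x))\<^sup>2 \<partial>M)"
  show ?thesis
  proof (cases "n = 0")
    case True
    then have "(\<integral>\<^sup>+x. ennreal ((norm (f x - h x))\<^sup>2) \<partial>M) = 0"
      using L2_inner_self(2)[OF rL] by (simp add: n_def r_def)
    then show ?thesis using E hE by blast
  next
    case False
    then have n: "n > 0" unfolding n_def by (simp add: less_le)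
    define e where "e x = of_real (1 / sqrt n) * r x" for x
    have rr: "L2_inner M r r = of_real n" by (simp add: L2_inner_self rL n_def)
    have re: "L2_inner M g e = of_real (1 / sqrt n) * L2_inner M g r" for g
    proof -
      have "L2_inner M e g = of_real (1 / sqrt n) * L2_inner M r g"
        unfolding e_def[abs_def] by (rule L2_inner_cmult_left)
      from arg_cong[OF this, of cnj] show ?thesis by (simp add: cnj_L2_inner)
    qed
    have er: "L2_inner M e g = of_real (1 / sqrt n) * L2_inner M r g" for g
      unfolding e_def[abs_def] by (rule L2_inner_cmult_left)
    have "L2_inner M e e = of_real (1 / sqrt n * (1 / sqrt n) * n)"
      unfolding er re rr by (simp only: of_real_mult mult.assoc)
    moreover have "1 / sqrt n * (1 / sqrt n) * n = 1" using n by (simp add: divide_simps)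
    ultimately have ee: "L2_inner M e e = 1" by (simp only: of_real_1)
    have eE: "L2_inner M e e' = 0" "L2_inner M e' e = 0" if "e' \<in> E" for e'
      using er[of e'] r_orth[OF that] cnj_L2_inner[of M e e'] by auto
    have eS: "e \<in> cspan S" unfolding e_def[abs_def] by (intro cspan_cmult rS)
    have "orthonormal_set M (insert e E)"
      using E(3) eE ee by (auto simp: orthonormal_set_def)
    moreover have "(\<lambda>x. h x + of_real (sqrt n) * e x) \<in> cspan (insert e E)"
    proof (intro cspan_add cspan_cmult)
      show "h \<in> cspan (insert e E)"
        unfolding h_def[abs_def] by (intro cspan_sum cspan_cmult cspan_base) auto
    qed (simp add: cspan_base)
    moreover have "h x + of_real (sqrt n) * e x = f x" for x
    proof -
      have "complex_of_real (sqrt n) * of_real (1 / sqrt n) = 1" using n by (simp flip: of_real_mult)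
      then have "complex_of_real (sqrt n) * e x = r x"
        unfolding e_def mult.assoc[symmetric] by (simp only: mult_1_left)
      then show ?thesis by (simp add: r_def)
    qed
    ultimately show ?thesis
      using E eS by (intro exI[of _ "insert e E"]) (auto intro!: bexI[of _ "\<lambda>x. h x + of_real (sqrt n) * e x"])
  qed
qed

text \<open>Dependent choice builds an increasing chain of finite orthonormal sets; two elements of
  the union lie in a common stage, and \<open>f k\<close> is reached at stage \<open>Suc k\<close>.
  The orthonormal functions lie exactly in \<open>cspan S\<close>, whereas \<open>f k\<close> is
  recovered up to a null function.\<close>

lemma gram_schmidt:
  assumes S: "S \<subseteq> L2 M" and f: "\<And>k::nat. f k \<in> cspan S"
  shows "\<exists>E. E \<subseteq> cspan S \<and> orthonormal_set M E \<and>
    (\<forall>k. \<exists>h\<in>cspan E. (\<integral>\<^sup>+x. ennreal ((norm (f k x - h x))\<^sup>2) \<partial>M) = 0)"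
proof -
  define ok where "ok E \<longleftrightarrow> finite E \<and> E \<subseteq> cspan S \<and> orthonormal_set M E" for E
  have step: "\<exists>E'. ok E' \<and> E \<subseteq> E' \<and> (\<exists>h\<in>cspan E'. (\<integral>\<^sup>+x. ennreal ((norm (f k x - h x))\<^sup>2) \<partial>M) = 0)"
    if "ok E" for E k
    using gram_schmidt_step[OF _ _ _ S f[of k], of E] that unfolding ok_def by metis
  have "\<exists>F. \<forall>k. ok (F k) \<and> (F k \<subseteq> F (Suc k) \<and>
      (\<exists>h\<in>cspan (F (Suc k)). (\<integral>\<^sup>+x. ennreal ((norm (f k x - h x))\<^sup>2) \<partial>M) = 0))"
  proof (rule dependent_nat_choice)
    show "\<exists>E. ok E" by (rule exI[of _ "{}"]) (simp add: ok_def orthonormal_set_def)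
  qed (use step in blast)
  then obtain F where F: "\<And>k. ok (F k)" "\<And>k. F k \<subseteq> F (Suc k)"
    "\<And>k. \<exists>h\<in>cspan (F (Suc k)). (\<integral>\<^sup>+x. ennreal ((norm (f k x - h x))\<^sup>2) \<partial>M) = 0" by blast
  have mono: "F j \<subseteq> F k" if "j \<le> k" for j k
    using lift_Suc_mono_le[of F, OF F(2) that] .
  define E where "E = (\<Union>k. F k)"
  have "E \<subseteq> cspan S" using F(1) by (auto simp: E_def ok_def)
  moreover have "orthonormal_set M E"
    unfolding orthonormal_set_def
  proof (intro ballI)
    fix e e' assume "e \<in> E" "e' \<in> E"
    then obtain j k where "e \<in> F j" "e' \<in> F k" by (auto simp: E_def)
    then have "e \<in> F (max j k)" "e' \<in> F (max j k)" using mono[of j "max j k"] mono[of k "max j k"] by auto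
    then show "L2_inner M e e' = (if e = e' then 1 else 0)"
      using F(1)[of "max j k"] by (auto simp: ok_def orthonormal_set_def)
  qed
  moreover have "\<exists>h\<in>cspan E. (\<integral>\<^sup>+x. ennreal ((norm (f k x - h x))\<^sup>2) \<partial>M) = 0" for k
  proof -
    have "cspan (F (Suc k)) \<subseteq> cspan E" unfolding cspan_def E_def by blast
    then show ?thesis using F(3)[of k] by blast
  qed
  ultimately show ?thesis by blast
qed

section \<open>The Siegel disc and integrability on the metaplectic group\<close>

section \<open>Lebesgue measure on complex matrices\<close>

definition symm :: "complex^'n^'n \<Rightarrow> complex^'n^'n" where
  "symm x = (\<chi> i j. (x $ i $ j + x $ j $ i) / 2)"

definition skewm :: "complex^'n^'n \<Rightarrow> complex^'n^'n" where
  "skewm x = (\<chi> i j. (x $ i $ j - x $ j $ i) / 2)"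

lemma bilin_symm: "bilin (symm x) z = bilin x z" for x :: "complex^'n::finite^'n"
proof -
  have "(\<Sum>i\<in>UNIV. \<Sum>j\<in>UNIV. z $ i * x $ j $ i * z $ j) = (\<Sum>i\<in>UNIV. \<Sum>j\<in>UNIV. z $ i * x $ i $ j * z $ j)"
    by (subst sum.swap) (simp add: mult_ac)
  moreover have "z $ i * symm x $ i $ j * z $ j = z $ i * x $ i $ j * z $ j / 2 + z $ i * x $ j $ i * z $ j / 2" for i j
    by (simp add: symm_def distrib_left distrib_right add_divide_distrib)
  ultimately show ?thesis
    unfolding bilin_def by (simp only: sum.distrib sum_divide_distrib[symmetric]) simp
qed

lemma matrix_mult_distribs:
  "A ** (B + C) = A ** B + A ** C" "(D + E) ** F = D ** F + E ** F"
  "A ** (B - C) = A ** B - A ** C" "(D - E) ** F = D ** F - E ** F"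
  for A D E :: "complex^'n::finite^'m" and B C :: "complex^'k^'n" and F :: "complex^'k^'n"
  by (simp_all add: vec_eq_iff matrix_matrix_mult_def distrib_left distrib_right sum.distrib
      left_diff_distrib right_diff_distrib sum_subtractf)

lemma matrix_mult_scaleR:
  "A ** (c *\<^sub>R B) = c *\<^sub>R (A ** B)" "(c *\<^sub>R A) ** B = c *\<^sub>R (A ** B)" "A *v (c *\<^sub>R v) = c *\<^sub>R (A *v v)"
  for A :: "complex^'n::finite^'m" and B :: "complex^'k^'n"
  by (simp_all add: vec_eq_iff matrix_matrix_mult_def matrix_vector_mult_def scaleR_sum_right)

lemma symm_eq: "symm x = (1/2) *\<^sub>R (x + transpose x)" "skewm x = (1/2) *\<^sub>R (x - transpose x)"
  by (simp_all add: vec_eq_iff symm_def skewm_def transpose_def scaleR_conv_of_real[where 'a = complex])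

lemma symm_congruence: "symm (u ** x ** transpose u) = u ** symm x ** transpose u"
  "skewm (u ** x ** transpose u) = u ** skewm x ** transpose u" for u :: "complex^'n::finite^'n"
proof -
  have "transpose (u ** x ** transpose u) = u ** transpose x ** transpose u"
    by (simp add: matrix_transpose_mul matrix_mul_assoc)
  then show "symm (u ** x ** transpose u) = u ** symm x ** transpose u"
    "skewm (u ** x ** transpose u) = u ** skewm x ** transpose u"
    by (simp_all add: symm_eq matrix_mult_scaleR matrix_mult_distribs)
qed

text \<open>A unitary congruence is an isometry for the Hilbert-Schmidt norm, so it preserves
  Lebesgue measure without any Jacobian.\<close>

lemma nn_integral_congruence:
  fixes u :: "complex^'n::finite^'n"
  assumes "unitarym u" "f \<in> borel_measurable borel"
  shows "(\<integral>\<^sup>+x. f (u ** x ** transpose u) \<partial>lborel) = (\<integral>\<^sup>+x. f x \<partial>lborel)"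
proof (rule nn_integral_lborel_isometry[OF _ _ assms(2)])
  show "linear (\<lambda>x. u ** x ** transpose u)"
    by (rule linearI) (simp_all add: matrix_mult_distribs matrix_mult_scaleR)
  show "norm (u ** x ** transpose u) = norm x" for x
    using assms(1) by (simp add: norm_unitarym_mult_left norm_unitarym_mult_right unitarym_transpose)
qed

lemma nn_integral_unitary_vector:
  fixes u :: "complex^'n::finite^'n"
  assumes "unitarym u" "f \<in> borel_measurable borel"
  shows "(\<integral>\<^sup>+z. f (u *v z) \<partial>lborel) = (\<integral>\<^sup>+z. f z \<partial>lborel)"
proof (rule nn_integral_lborel_isometry[OF _ _ assms(2)])
  show "linear (\<lambda>z. u *v z)" by (rule linearI) (simp_all add: matrix_vector_right_distrib matrix_mult_scaleR)
  show "norm (u *v z) = norm z" for z by (rule unitarym_norm_vector[OF assms(1)])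
qed

lemma Basis_complex_vec: "(Basis :: (complex^'n::finite) set) = (\<lambda>(j, c). axis j c) ` (UNIV \<times> {1, \<i>})"
  unfolding Basis_vec_def Basis_complex_def by force

lemma Basis_complex_matrix: "(Basis :: (complex^'n::finite^'n) set) = (\<lambda>(i, j, c). axis i (axis j c)) ` (UNIV \<times> UNIV \<times> {1, \<i>})"
  unfolding Basis_vec_def[where 'a = "complex^'n"] Basis_complex_vec by force

lemma axis_eq_iff_nz: "c \<noteq> 0 \<Longrightarrow> axis i c = axis j d \<longleftrightarrow> i = j \<and> c = d"
  by (auto simp: axis_eq_axis)

lemma axis_nz: "c \<noteq> 0 \<Longrightarrow> axis i c \<noteq> 0"
  by (auto simp: vec_eq_iff axis_def)

lemma emeasure_cbox_complex_vec:
  fixes l u :: "complex^'n::finite"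
  assumes "\<And>i. Re (l $ i) \<le> Re (u $ i)" "\<And>i. Im (l $ i) \<le> Im (u $ i)"
  shows "emeasure lborel (cbox l u) = ennreal (\<Prod>i\<in>UNIV. (Re (u $ i) - Re (l $ i)) * (Im (u $ i) - Im (l $ i)))"
proof -
  have "emeasure lborel (cbox l u) = ennreal (\<Prod>b\<in>Basis. (u - l) \<bullet> b)"
    by (rule emeasure_lborel_cbox) (use assms in \<open>auto simp: Basis_complex_vec inner_axis inner_complex_def\<close>)
  also have "(\<Prod>b\<in>Basis. (u - l) \<bullet> b) = (\<Prod>(j, c)\<in>UNIV \<times> {1, \<i>}. (u $ j - l $ j) \<bullet> c)"
    unfolding Basis_complex_vec
    by (subst prod.reindex) (auto simp: inj_on_def axis_eq_iff_nz inner_axis intro!: prod.cong)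
  also have "\<dots> = (\<Prod>j\<in>UNIV. \<Prod>c\<in>{1, \<i>}. (u $ j - l $ j) \<bullet> c)"
    by (subst prod.Sigma[symmetric]) auto
  also have "\<dots> = (\<Prod>i\<in>UNIV. (Re (u $ i) - Re (l $ i)) * (Im (u $ i) - Im (l $ i)))"
    by (simp add: inner_complex_def complex_eq_iff)
  finally show ?thesis .
qed

lemma emeasure_cbox_complex_matrix:
  fixes l u :: "complex^'n::finite^'n"
  assumes "\<And>i j. Re (l $ i $ j) \<le> Re (u $ i $ j)" "\<And>i j. Im (l $ i $ j) \<le> Im (u $ i $ j)"
  shows "emeasure lborel (cbox l u) = ennreal (\<Prod>i\<in>UNIV. \<Prod>j\<in>UNIV.
    (Re (u $ i $ j) - Re (l $ i $ j)) * (Im (u $ i $ j) - Im (l $ i $ j)))"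
proof -
  have "emeasure lborel (cbox l u) = ennreal (\<Prod>b\<in>Basis. (u - l) \<bullet> b)"
    by (rule emeasure_lborel_cbox) (use assms in \<open>auto simp: Basis_complex_matrix inner_axis inner_complex_def\<close>)
  also have "(\<Prod>b\<in>Basis. (u - l) \<bullet> b) = (\<Prod>(i, j, c)\<in>UNIV \<times> UNIV \<times> {1, \<i>}. (u $ i $ j - l $ i $ j) \<bullet> c)"
    unfolding Basis_complex_matrix
    by (subst prod.reindex) (auto simp: inj_on_def axis_eq_iff_nz axis_nz inner_axis intro!: prod.cong)
  also have "\<dots> = (\<Prod>i\<in>UNIV. \<Prod>j\<in>UNIV. \<Prod>c\<in>{1, \<i>}. (u $ i $ j - l $ i $ j) \<bullet> c)"
    by (subst prod.Sigma, simp, simp, subst prod.Sigma) auto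
  also have "\<dots> = (\<Prod>i\<in>UNIV. \<Prod>j\<in>UNIV. (Re (u $ i $ j) - Re (l $ i $ j)) * (Im (u $ i $ j) - Im (l $ i $ j)))"
    by (simp add: inner_complex_def complex_eq_iff)
  finally show ?thesis .
qed

lemma mem_cbox_complex_vec:
  "z \<in> cbox l u \<longleftrightarrow> (\<forall>i. Re (l $ i) \<le> Re (z $ i) \<and> Re (z $ i) \<le> Re (u $ i) \<and>
     Im (l $ i) \<le> Im (z $ i) \<and> Im (z $ i) \<le> Im (u $ i))" for z :: "complex^'n::finite"
  by (auto simp: mem_box Basis_complex_vec inner_axis inner_complex_def)

lemma mem_cbox_complex_matrix:
  "x \<in> cbox l u \<longleftrightarrow> (\<forall>i j. Re (l $ i $ j) \<le> Re (x $ i $ j) \<and> Re (x $ i $ j) \<le> Re (u $ i $ j) \<and>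
     Im (l $ i $ j) \<le> Im (x $ i $ j) \<and> Im (x $ i $ j) \<le> Im (u $ i $ j))" for x :: "complex^'n::finite^'n"
  by (auto simp: mem_box Basis_complex_matrix inner_axis inner_complex_def)

text \<open>An isometry separating the symmetric part, stored in the entries \<open>(i, j)\<close> with
  \<open>\<iota> i \<le> \<iota> j\<close>, from the antisymmetric part.\<close>

definition sym_coords :: "('n \<Rightarrow> nat) \<Rightarrow> complex^'n^'n \<Rightarrow> complex^'n^'n" where
  "sym_coords \<iota> y = (\<chi> i j. if i = j then y $ i $ i
     else if \<iota> i < \<iota> j then (y $ i $ j + y $ j $ i) / of_real (sqrt 2)
     else (y $ j $ i - y $ i $ j) / of_real (sqrt 2))"

text \<open>When the entries (i, j) and (j, i) are taken together, the isometry is the parallelogram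
  law; the factor \<open>sqrt 2\<close> normalises it.\<close>

lemma nn_integral_sym_coords:
  fixes \<iota> :: "'n::finite \<Rightarrow> nat"
  assumes "inj \<iota>" "f \<in> borel_measurable borel"
  shows "(\<integral>\<^sup>+y. f (sym_coords \<iota> y) \<partial>lborel) = (\<integral>\<^sup>+x. f x \<partial>lborel)"
proof (rule nn_integral_lborel_isometry[OF _ _ assms(2)])
  show "linear (sym_coords \<iota> :: complex^'n^'n \<Rightarrow> _)"
    by (rule linearI) (auto simp: vec_eq_iff sym_coords_def add_divide_distrib diff_divide_distrib
        scaleR_conv_of_real[where 'a = complex] distrib_left right_diff_distrib)
  show "norm (sym_coords \<iota> y) = norm y" for y :: "complex^'n^'n"
  proof -
    have nsq: "2 * (norm x)\<^sup>2 = (\<Sum>i\<in>UNIV. \<Sum>j\<in>UNIV. (cmod (x $ i $ j))\<^sup>2 + (cmod (x $ j $ i))\<^sup>2)" for x :: "complex^'n^'n"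
      by (simp add: norm_vec_sq sum.distrib) (subst (2) sum.swap, simp)
    have p: "(cmod ((a + b) / of_real (sqrt 2)))\<^sup>2 + (cmod ((a - b) / of_real (sqrt 2)))\<^sup>2 = (cmod a)\<^sup>2 + (cmod b)\<^sup>2" for a b
      unfolding norm_divide power_divide cmod_power2 by (simp add: power2_eq_square field_simps)
    have "(cmod (sym_coords \<iota> y $ i $ j))\<^sup>2 + (cmod (sym_coords \<iota> y $ j $ i))\<^sup>2 = (cmod (y $ i $ j))\<^sup>2 + (cmod (y $ j $ i))\<^sup>2" for i j
    proof -
      consider "i = j" | "\<iota> i < \<iota> j" | "\<iota> j < \<iota> i" using injD[OF assms(1)] by (metis linorder_neqE_nat)
      then show ?thesis
        using p[of "y $ i $ j" "y $ j $ i"] p[of "y $ j $ i" "y $ i $ j"]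
        by cases (auto simp: sym_coords_def add.commute)
    qed
    then have "2 * (norm (sym_coords \<iota> y))\<^sup>2 = 2 * (norm y)\<^sup>2" unfolding nsq by simp
    then show ?thesis by simp
  qed
qed

lemma symm_sym_coords:
  fixes \<iota> :: "'n::finite \<Rightarrow> nat"
  assumes "inj \<iota>"
  shows "symm (sym_coords \<iota> y) $ i $ j = (if i = j then y $ i $ i
     else (if \<iota> i < \<iota> j then y $ i $ j else y $ j $ i) / of_real (sqrt 2))"
proof -
  consider "i = j" | "i \<noteq> j" "\<iota> i < \<iota> j" "\<not> \<iota> j < \<iota> i" | "i \<noteq> j" "\<iota> j < \<iota> i" "\<not> \<iota> i < \<iota> j"
    using injD[OF assms(1)] by (metis linorder_neqE_nat not_less_iff_gr_or_eq)
  then show ?thesis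
    by cases (simp_all add: symm_def sym_coords_def field_simps)
qed

lemma skewm_sym_coords:
  fixes \<iota> :: "'n::finite \<Rightarrow> nat"
  assumes "inj \<iota>"
  shows "skewm (sym_coords \<iota> y) $ i $ j = (if i = j then 0
     else (if \<iota> i < \<iota> j then y $ j $ i else - y $ i $ j) / of_real (sqrt 2))"
proof -
  consider "i = j" | "i \<noteq> j" "\<iota> i < \<iota> j" "\<not> \<iota> j < \<iota> i" | "i \<noteq> j" "\<iota> j < \<iota> i" "\<not> \<iota> i < \<iota> j"
    using injD[OF assms(1)] by (metis linorder_neqE_nat not_less_iff_gr_or_eq)
  then show ?thesis
    by cases (simp_all add: skewm_def sym_coords_def field_simps)
qed

section \<open>The action on symmetric matrices\<close>

text \<open>The closed Siegel disc in the symmetric part. The bound on the antisymmetric part keeps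
  the volume finite and leaves \<open>gauss_norm\<close> alone, which depends on
  \<open>symm x\<close> only.\<close>

definition symdisc :: "(complex^'n::finite^'n) set" where
  "symdisc = {x. (\<forall>v. norm (symm x *v v) \<le> norm v) \<and> norm (skewm x) \<le> 1}"

text \<open>Here \<open>g\<close> maps some \<open>E\<close> of norm at most \<open>1/4\<close> to \<open>symm x\<close> under
  \<open>E \<mapsto> (P E + Q) (Q\<^sup>* E + P\<^sup>*)\<^sup>-\<^sup>1\<close>, where \<open>P = cpart g\<close> and \<open>Q = apart g\<close>.\<close>

definition near :: "'n::finite symat \<Rightarrow> complex^'n^'n \<Rightarrow> bool" where
  "near g x \<longleftrightarrow> (\<exists>E. norm E \<le> 1 / 4 \<and>
     cpart g ** E + apart g = symm x ** (conjm (apart g) ** E + conjm (cpart g)))"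

text \<open>For the denominator \<open>\<beta>\<close> of the fractional linear map and
  \<open>S = symm x\<close>, pseudo-unitarity gives
  \<open>|\<beta> w|^2 - |S \<beta> w|^2 = |w|^2 - |E w|^2\<close>. As \<open>E\<close> contracts
  strictly, this shows both that \<open>\<beta>\<close> is injective and that \<open>S\<close> is a
  contraction.\<close>

lemma near_symm_le:
  fixes g :: "'n::finite symat"
  assumes g: "g \<in> Sp" and "near g x" shows "norm (symm x *v v) \<le> norm v"
proof -
  obtain E where E: "norm E \<le> 1 / 4"
    "cpart g ** E + apart g = symm x ** (conjm (apart g) ** E + conjm (cpart g))"
    using assms(2) by (auto simp: near_def)
  define \<beta> where "\<beta> = conjm (apart g) ** E + conjm (cpart g)"
  have form: "(norm (\<beta> *v w))\<^sup>2 - (norm (symm x *v (\<beta> *v w)))\<^sup>2 = (norm w)\<^sup>2 - (norm (E *v w))\<^sup>2" for w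
  proof -
    have "symm x *v (\<beta> *v w) = (cpart g ** E + apart g) *v w"
      by (simp only: matrix_vector_mul_assoc E(2) \<beta>_def)
    then show ?thesis
      using pseudounitary_form[OF g, of "E *v w" w]
      by (simp add: \<beta>_def matrix_vector_mult_add_rdistrib matrix_vector_mul_assoc)
  qed
  have Ew: "norm (E *v w) \<le> norm w / 4" for w
    using norm_matrix_vector_mult_le[of E w] mult_right_mono[OF E(1), of "norm w"] by simp
  have "w = 0" if "\<beta> *v w = 0" for w
  proof -
    have "(norm w)\<^sup>2 = (norm (E *v w))\<^sup>2" using form[of w] that by simp
    then show ?thesis using Ew[of w] by simp
  qed
  then have "invertible \<beta>" by (simp add: invertible_left_inverse matrix_left_invertible_ker)
  then obtain \<gamma> where "\<beta> ** \<gamma> = mat 1" by (auto simp: invertible_def)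
  then have \<beta>\<gamma>: "\<beta> *v (\<gamma> *v v) = v" by (simp add: matrix_vector_mul_assoc)
  have "(norm (E *v (\<gamma> *v v)))\<^sup>2 \<le> (norm (\<gamma> *v v))\<^sup>2"
    using Ew[of "\<gamma> *v v"] norm_ge_zero[of "\<gamma> *v v"] by (intro power_mono) (linarith, simp)
  then have "(norm (symm x *v v))\<^sup>2 \<le> (norm v)\<^sup>2" using form[of "\<gamma> *v v"] unfolding \<beta>\<gamma> by linarith
  then show ?thesis by (rule power2_le_imp_le) simp
qed

text \<open>Properness of the action in quantitative form: an element that moves one point of the
  small ball to another has an antilinear part that is small relative to its linear part, and
  \<open>norm_cpart_apart\<close> then bounds both.\<close>

lemma small_orbit_bound:
  fixes g :: "'n::finite symat"
  assumes g: "g \<in> Sp" and E: "norm E0 \<le> 1 / 4" "norm E1 \<le> 1 / 4"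
    and eq: "cpart g ** E1 + apart g = E0 ** (conjm (apart g) ** E1 + conjm (cpart g))"
  shows "norm (cpart g) \<le> 2 * real CARD('n)" "norm (apart g) \<le> 2 * real CARD('n)"
proof -
  let ?P = "cpart g" and ?Q = "apart g"
  have "norm ?Q = norm (E0 ** (conjm ?Q ** E1 + conjm ?P) - ?P ** E1)"
    by (simp add: eq[symmetric])
  also have "\<dots> \<le> norm E0 * (norm ?Q * norm E1 + norm ?P) + norm ?P * norm E1"
  proof (rule order_trans[OF norm_triangle_ineq4 add_mono])
    have "norm (conjm ?Q ** E1 + conjm ?P) \<le> norm ?Q * norm E1 + norm ?P"
      using norm_matrix_mult_le[of "conjm ?Q" E1] norm_triangle_ineq[of "conjm ?Q ** E1" "conjm ?P"] by simp
    then show "norm (E0 ** (conjm ?Q ** E1 + conjm ?P)) \<le> norm E0 * (norm ?Q * norm E1 + norm ?P)"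
      by (intro order_trans[OF norm_matrix_mult_le] mult_left_mono) auto
  qed (rule norm_matrix_mult_le)
  also have "\<dots> \<le> 1 / 4 * (norm ?Q * (1 / 4) + norm ?P) + norm ?P * (1 / 4)"
    by (intro add_mono mult_mono mult_left_mono E) auto
  finally have "norm ?Q \<le> 1 / 4 * (norm ?Q * (1 / 4) + norm ?P) + norm ?P * (1 / 4)" .
  \<comment> \<open>Collecting \<open>b\<close> gives \<open>15/16 * b \<le> 1/2 * a\<close>. The
    square 64/225 of the ratio is below 1/2, so in \<open>norm_cpart_apart\<close> the antilinear
    part can be absorbed into the left-hand side.\<close>
  moreover have "b \<le> 8 / 15 * a" if "b \<le> 1 / 4 * (b * (1 / 4) + a) + a * (1 / 4)" for a b :: real
    using that by (simp add: field_simps)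
  ultimately have "norm ?Q \<le> 8 / 15 * norm ?P" by blast
  then have "(norm ?Q)\<^sup>2 \<le> (8 / 15 * norm ?P)\<^sup>2" by (intro power_mono) auto
  moreover have "(8 / 15 * norm ?P)\<^sup>2 = 64 / 225 * (norm ?P)\<^sup>2" by (simp add: power_mult_distrib power_divide)
  ultimately have "(norm ?Q)\<^sup>2 \<le> 1 / 2 * (norm ?P)\<^sup>2"
    using zero_le_power2[of "norm ?P"] by linarith
  moreover note norm_cpart_apart[OF g]
  ultimately have "(norm ?P)\<^sup>2 \<le> 2 * real CARD('n)" "(norm ?Q)\<^sup>2 \<le> 2 * real CARD('n)" by auto
  moreover have "2 * real CARD('n) \<le> (2 * real CARD('n))\<^sup>2"
  proof (rule self_le_power)
    show "1 \<le> 2 * real CARD('n)" using zero_less_card_finite[where 'a = 'n] by linarith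
  qed simp
  ultimately have "(norm ?P)\<^sup>2 \<le> (2 * real CARD('n))\<^sup>2" "(norm ?Q)\<^sup>2 \<le> (2 * real CARD('n))\<^sup>2" by linarith+
  then show "norm ?P \<le> 2 * real CARD('n)" "norm ?Q \<le> 2 * real CARD('n)"
    by (auto intro: power2_le_imp_le)
qed

text \<open>If \<open>g0\<close> and \<open>g0 ** g\<close> both bring a point of the ball to
  \<open>symm x\<close>, then \<open>g\<close> maps the second point to the first, and
  \<open>small_orbit_bound\<close> applies. \<open>g0\<close> is cancelled on vectors, without
  inverting denominators: the defect \<open>d\<close> satisfies \<open>P d = S Q' d\<close>, where
  \<open>P\<close> is the linear part of \<open>g0\<close>, \<open>Q'\<close> the conjugate of its
  antilinear part and \<open>S\<close> a contraction, which pseudo-unitarity permits only for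
  \<open>d = 0\<close>.\<close>

lemma near_bounded:
  fixes g0 g :: "'n::finite symat"
  assumes g0: "g0 \<in> Sp" and g: "g \<in> Sp" and near: "near g0 x" "near (g0 ** g) x"
  shows "norm g \<le> 16 * (real CARD('n)) ^ 3"
proof -
  let ?P = "cpart g" and ?Q = "apart g" and ?PA = "cpart g0" and ?QA = "apart g0" and ?S = "symm x"
  obtain E0 where E0: "norm E0 \<le> 1 / 4" "?PA ** E0 + ?QA = ?S ** (conjm ?QA ** E0 + conjm ?PA)"
    using near(1) by (auto simp: near_def)
  obtain E1 where E1: "norm E1 \<le> 1 / 4" "cpart (g0 ** g) ** E1 + apart (g0 ** g)
      = ?S ** (conjm (apart (g0 ** g)) ** E1 + conjm (cpart (g0 ** g)))"
    using near(2) by (auto simp: near_def)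
  have "(?P ** E1 + ?Q) *v w = E0 *v ((conjm ?Q ** E1 + conjm ?P) *v w)" for w
  proof -
    define a b where "a = (?P ** E1 + ?Q) *v w" and "b = (conjm ?Q ** E1 + conjm ?P) *v w"
    define d where "d = a - E0 *v b"
    have c: "conjm (X + Y) = conjm X + conjm Y" for X Y :: "complex^'n^'n" by (simp add: vec_eq_iff)
    have "?PA *v a + ?QA *v b = (cpart (g0 ** g) ** E1 + apart (g0 ** g)) *v w"
      by (simp add: a_def b_def cpart_mult apart_mult matrix_vector_mul_assoc matrix_vector_mult_add_rdistrib
          matrix_vector_right_distrib matrix_mult_distribs matrix_mul_assoc algebra_simps)
    also have "\<dots> = ?S *v ((conjm (apart (g0 ** g)) ** E1 + conjm (cpart (g0 ** g))) *v w)"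
      by (simp only: E1(2) matrix_vector_mul_assoc)
    also have "(conjm (apart (g0 ** g)) ** E1 + conjm (cpart (g0 ** g))) *v w = conjm ?QA *v a + conjm ?PA *v b"
      by (simp add: a_def b_def cpart_mult apart_mult c conjm_mult matrix_vector_mul_assoc matrix_vector_mult_add_rdistrib
          matrix_vector_right_distrib matrix_mult_distribs matrix_mul_assoc algebra_simps)
    finally have 1: "?PA *v a + ?QA *v b = ?S *v (conjm ?QA *v a + conjm ?PA *v b)" .
    have "(?PA ** E0 + ?QA) *v b = ?S *v ((conjm ?QA ** E0 + conjm ?PA) *v b)"
      by (simp only: E0(2) matrix_vector_mul_assoc)
    then have 2: "?PA *v (E0 *v b) + ?QA *v b = ?S *v (conjm ?QA *v (E0 *v b) + conjm ?PA *v b)"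
      by (simp add: matrix_vector_mul_assoc matrix_vector_mult_add_rdistrib)
    have "?PA *v d = ?S *v (conjm ?QA *v d)"
      using arg_cong2[OF 1 2, of "(-)"]
      by (simp add: d_def matrix_vector_mult_diff_distrib matrix_vector_right_distrib)
    then have "norm (?PA *v d) \<le> norm (conjm ?QA *v d)"
      using near_symm_le[OF g0 near(1)] by metis
    then have "(norm (?PA *v d))\<^sup>2 \<le> (norm (conjm ?QA *v d))\<^sup>2" by (intro power_mono) auto
    moreover have "(norm (conjm ?QA *v d))\<^sup>2 - (norm (?PA *v d))\<^sup>2 = - (norm d)\<^sup>2"
      using pseudounitary_form[OF g0, of d 0] by simp
    ultimately have "(norm d)\<^sup>2 \<le> 0" by linarith
    then have "d = 0" by simp
    then show ?thesis by (simp add: d_def a_def b_def)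
  qed
  then have "?P ** E1 + ?Q = E0 ** (conjm ?Q ** E1 + conjm ?P)"
    by (simp add: matrix_eq matrix_vector_mul_assoc)
  from small_orbit_bound[OF g E0(1) E1(1) this]
  \<comment> \<open>The constant \<open>16 n^3\<close> is \<open>4 n^2\<close> from
    \<open>norm_symat_le\<close> times \<open>2 n + 2 n\<close>.\<close>
  have "4 * (real CARD('n))\<^sup>2 * (norm ?P + norm ?Q) \<le> 4 * (real CARD('n))\<^sup>2 * (4 * real CARD('n))"
    by (intro mult_left_mono) auto
  from order_trans[OF norm_symat_le[of g] this]
  show ?thesis by (simp add: power2_eq_square power3_eq_cube)
qed

lemma Sp_eq: "Sp = {g :: 'n::finite symat. transpose g ** Jmat ** g = Jmat}"
proof -
  have "invertible g" if "transpose g ** Jmat ** g = Jmat" for g :: "'n symat"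
  proof -
    have "(- Jmat ** transpose g ** Jmat) ** g = - (Jmat ** (transpose g ** Jmat ** g))"
      by (simp add: matrix_mult_uminus matrix_mul_assoc)
    then have "(- Jmat ** transpose g ** Jmat) ** g = mat 1" by (simp add: that Jmat_square)
    then show ?thesis by (metis invertible_left_inverse)
  qed
  then show ?thesis by (auto simp: Sp_def)
qed

lemma closed_Mp: "closed (Mp :: 'n::finite mpair set)"
proof -
  have eq: "Mp = {x :: 'n mpair. (\<forall>i j. (\<Sum>k\<in>UNIV. (\<Sum>l\<in>UNIV. snd x $ l $ i * Jmat $ l $ k) * snd x $ k $ j) = Jmat $ i $ j) \<and>
      (fst x)\<^sup>2 * det (cpart (snd x)) = 1}"
    by (auto simp: Mp_def Sp_eq vec_eq_iff matrix_matrix_mult_def transpose_def)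
  have "continuous_on UNIV (\<lambda>x :: 'n mpair. det (cpart (snd x)))"
    by (intro continuous_on_det continuous_on_compose2[OF continuous_on_cpart] continuous_intros) auto
  then show ?thesis
    unfolding eq by (intro closed_Collect_conj closed_Collect_all closed_Collect_eq continuous_intros)
qed

text \<open>The matrix controls the scalar: \<open>cmod_det_cpart\<close> forces
  \<open>cmod (fst x) \<le> 1\<close>.\<close>

lemma compact_Mp_norm_le: "compact {x \<in> Mp :: 'n::finite mpair set. norm (snd x) \<le> R}"
proof -
  have "norm x \<le> 1 + R" if "x \<in> Mp" "norm (snd x) \<le> R" for x :: "'n mpair"
  proof -
    have "(cmod (fst x))\<^sup>2 * cmod (det (cpart (snd x))) = 1"
      using Mp_D(2)[OF that(1)] by (metis norm_mult norm_one norm_power)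
    moreover have "(cmod (fst x))\<^sup>2 * 1 \<le> (cmod (fst x))\<^sup>2 * cmod (det (cpart (snd x)))"
      by (intro mult_left_mono cmod_det_cpart Mp_D(1) that) auto
    ultimately have "(cmod (fst x))\<^sup>2 \<le> 1\<^sup>2" by simp
    then have "cmod (fst x) \<le> 1" by (rule power2_le_imp_le) simp
    then show ?thesis using that(2) norm_Pair_le[of "fst x" "snd x"] by simp
  qed
  then have "bounded {x \<in> Mp :: 'n mpair set. norm (snd x) \<le> R}"
    unfolding bounded_iff by (intro exI[of _ "1 + R"]) blast
  moreover have "closed {x \<in> Mp :: 'n mpair set. norm (snd x) \<le> R}"
  proof -
    have "closed {x :: 'n mpair. norm (snd x) \<le> R}" by (intro closed_Collect_le continuous_intros)
    then have "closed (Mp \<inter> {x :: 'n mpair. norm (snd x) \<le> R})" by (rule closed_Int[OF closed_Mp])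
    then show ?thesis by (simp only: Int_def mem_Collect_eq)
  qed
  ultimately show ?thesis by (simp add: compact_eq_bounded_closed)
qed

text \<open>The equation in \<open>near\<close> contains no inverse, so it is a closed condition on
  \<open>E\<close>, the group element and \<open>x\<close> together; projecting along the compact
  ball of all \<open>E\<close> keeps the set closed.\<close>

lemma closed_near: "closed {p :: 'n::finite mpair \<times> (complex^'n^'n). near (snd (fst p)) (snd p)}"
proof -
  have c: "continuous_on UNIV (\<lambda>q :: (complex^'n^'n) \<times> 'n mpair \<times> (complex^'n^'n). cpart (snd (fst (snd q))) $ i $ j)"
    for i j by (rule continuous_on_compose2[OF continuous_on_cpart[of UNIV]]) (auto intro!: continuous_intros)
  have d: "continuous_on UNIV (\<lambda>q :: (complex^'n^'n) \<times> 'n mpair \<times> (complex^'n^'n). apart (snd (fst (snd q))) $ i $ j)"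
    for i j by (rule continuous_on_compose2[OF continuous_on_apart[of UNIV]]) (auto intro!: continuous_intros)
  have "closed {q :: (complex^'n^'n) \<times> 'n mpair \<times> (complex^'n^'n). \<forall>i j.
      (\<Sum>k\<in>UNIV. cpart (snd (fst (snd q))) $ i $ k * fst q $ k $ j) + apart (snd (fst (snd q))) $ i $ j
      = (\<Sum>k\<in>UNIV. symm (snd (snd q)) $ i $ k * ((\<Sum>l\<in>UNIV. cnj (apart (snd (fst (snd q))) $ k $ l) * fst q $ l $ j)
          + cnj (cpart (snd (fst (snd q))) $ k $ j)))}"
    unfolding symm_def vec_lambda_beta by (intro closed_Collect_all closed_Collect_eq continuous_intros c d) auto
  from closed_compact_projection[OF compact_cball[of 0 "1/4"] this]
  show ?thesis
    by (simp add: near_def vec_eq_iff matrix_matrix_mult_def conj_commute dist_norm)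
qed

text \<open>A Householder reflection, preceded by multiplication with a phase.\<close>

lemma unitarym_to_axis:
  fixes z :: "complex^'n::finite"
  obtains w where "unitarym w" "w *v z = axis i0 (of_real (norm z))"
proof (cases "z = 0")
  case True
  have "unitarym (mat 1 :: complex^'n^'n)" by (simp add: unitarym_def)
  moreover have "axis i0 0 = (0 :: complex^'n)" by (simp add: vec_eq_iff axis_def)
  ultimately show ?thesis using that[of "mat 1"] True by simp
next
  case False
  \<comment> \<open>The phase makes the entry at \<open>i0\<close> real and nonnegative. The inner
    product of \<open>d\<close> and \<open>a\<close> is then real and equal to half of
    \<open>(norm d)\<^sup>2\<close>, as the reflection needs.\<close>
  define e where "e = (if z $ i0 = 0 then 1 else cnj (sgn (z $ i0)))"
  have e1: "cmod e = 1" by (simp add: e_def norm_sgn)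
  define a where "a = (\<chi> i. e * z $ i)"
  define r where "r = cmod (z $ i0)"
  have a0: "a $ i0 = of_real r"
  proof (cases "z $ i0 = 0")
    case False
    have "cnj (sgn (z $ i0)) * z $ i0 = cnj (z $ i0) * z $ i0 / of_real r"
      by (simp add: sgn_eq r_def)
    also have "cnj (z $ i0) * z $ i0 = (of_real r)\<^sup>2"
      using complex_norm_square[of "z $ i0"] by (simp add: r_def mult.commute)
    finally show ?thesis using False by (simp add: a_def e_def r_def power2_eq_square)
  qed (simp add: a_def r_def)
  have na: "norm a = norm z" by (simp add: a_def norm_vec_def norm_mult e1)
  define \<rho> where "\<rho> = norm z"
  define d where "d = a - axis i0 (of_real \<rho>)"
  have cip: "of_real ((norm v)\<^sup>2) = (\<Sum>i\<in>UNIV. cnj (v $ i) * v $ i)" for v :: "complex^'n"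
    by (simp add: norm_vec_sq complex_norm_square[symmetric] mult.commute[of "cnj _"])
  have da: "(\<Sum>k\<in>UNIV. cnj (d $ k) * a $ k) = of_real (\<rho>\<^sup>2 - \<rho> * r)"
  proof -
    have "(\<Sum>k\<in>UNIV. cnj (d $ k) * a $ k) = (\<Sum>k\<in>UNIV. cnj (a $ k) * a $ k) - (\<Sum>k\<in>UNIV. (if k = i0 then of_real \<rho> * a $ k else 0))"
      by (simp add: d_def left_diff_distrib sum_subtractf axis_def if_distrib[of cnj] if_distrib[of "\<lambda>y. y * _"] cong: if_cong)
    then show ?thesis using cip[of a] by (simp add: sum.delta a0 na \<rho>_def)
  qed
  have dd: "(norm d)\<^sup>2 = 2 * (\<rho>\<^sup>2 - \<rho> * r)"
  proof -
    have "complex_of_real ((norm d)\<^sup>2) = (\<Sum>k\<in>UNIV. cnj (d $ k) * a $ k) - (\<Sum>k\<in>UNIV. (if k = i0 then cnj (d $ k) * of_real \<rho> else 0))"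
      unfolding cip sum_subtractf[symmetric] by (rule sum.cong) (auto simp: d_def axis_def algebra_simps)
    also have "\<dots> = of_real (2 * (\<rho>\<^sup>2 - \<rho> * r))"
      by (simp add: sum.delta da) (simp add: d_def axis_def a0 power2_eq_square algebra_simps)
    finally show ?thesis using of_real_eq_iff by blast
  qed
  \<comment> \<open>The value 0 turns the reflection into the identity when \<open>a\<close> already
    lies on the axis.\<close>
  define c where "c = (if d = 0 then 0 else complex_of_real (2 / (norm d)\<^sup>2))"
  have cc: "c * c * of_real ((norm d)\<^sup>2) = 2 * c" "cnj c = c"
    by (auto simp: c_def power2_eq_square)
  define H where "H = (\<chi> i j. (if i = j then 1 else 0) - c * d $ i * cnj (d $ j))"
  have "unitarym H"
  proof -
    have "(\<Sum>k\<in>UNIV. cnj (H $ k $ i) * H $ k $ j) = (if i = j then 1 else 0)" for i j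
    proof -
      have "(\<Sum>k\<in>UNIV. cnj (H $ k $ i) * H $ k $ j)
         = (\<Sum>k\<in>UNIV. (if k = i then (if k = j then 1 else 0) else 0)
            - (if k = i then c * d $ k * cnj (d $ j) else 0) - (if k = j then c * cnj (d $ k) * d $ i else 0)
            + c * c * d $ i * cnj (d $ j) * (cnj (d $ k) * d $ k))"
        by (intro sum.cong) (auto simp: H_def cc algebra_simps)
      also have "\<dots> = (if i = j then 1 else 0) - 2 * c * d $ i * cnj (d $ j) + c * c * d $ i * cnj (d $ j) * of_real ((norm d)\<^sup>2)"
        unfolding cip by (simp add: sum.distrib sum_subtractf sum.delta sum_distrib_left)
      also have "c * c * d $ i * cnj (d $ j) * of_real ((norm d)\<^sup>2) = (c * c * of_real ((norm d)\<^sup>2)) * d $ i * cnj (d $ j)"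
        by (simp add: mult_ac)
      finally show ?thesis unfolding cc(1) by simp
    qed
    then show ?thesis by (simp add: unitarym_def vec_eq_iff matrix_matrix_mult_def transpose_def mat_def)
  qed
  moreover have "H *v a = axis i0 (of_real \<rho>)"
  proof -
    have "H *v a = (\<chi> i. a $ i - c * of_real (\<rho>\<^sup>2 - \<rho> * r) * d $ i)"
    proof -
      have *: "(H *v a) $ i = a $ i - c * d $ i * (\<Sum>k\<in>UNIV. cnj (d $ k) * a $ k)" for i
      proof -
        have "(H *v a) $ i = (\<Sum>j\<in>UNIV. (if i = j then a $ j else 0) - c * d $ i * (cnj (d $ j) * a $ j))"
          unfolding matrix_vector_mult_def vec_lambda_beta by (rule sum.cong) (auto simp: H_def algebra_simps)
        then show ?thesis by (simp add: sum_subtractf sum.delta sum_distrib_left)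
      qed
      show ?thesis by (simp add: vec_eq_iff *[unfolded da] mult_ac)
    qed
    moreover have "c * of_real (\<rho>\<^sup>2 - \<rho> * r) * d $ i = d $ i" for i
    proof (cases "d = 0")
      case False
      then have "2 * (\<rho>\<^sup>2 - \<rho> * r) \<noteq> 0" using dd by (metis norm_eq_zero power_eq_0_iff)
      then have 1: "2 / (norm d)\<^sup>2 * (\<rho>\<^sup>2 - \<rho> * r) = 1" unfolding dd by simp
      have "c = of_real (2 / (norm d)\<^sup>2)" using False by (simp only: c_def if_False)
      then have "c * of_real (\<rho>\<^sup>2 - \<rho> * r) = 1" by (simp only: of_real_mult[symmetric] 1 of_real_1)
      then show ?thesis by simp
    qed simp
    ultimately have "H *v a = (\<chi> i. a $ i - d $ i)" by (simp only:)
    then show ?thesis by (simp add: vec_eq_iff d_def)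
  qed
  moreover have "unitarym (\<chi> i j. e * H $ i $ j)" if "unitarym H"
  proof -
    have "cnj e * e = 1" using e1 by (metis complex_norm_square mult.commute of_real_1 one_power2)
    moreover have "cnj e * cnj a * (e * b) = cnj e * e * (cnj a * b)" for a b by (simp only: mult_ac)
    ultimately have *: "cnj e * cnj a * (e * b) = cnj a * b" for a b by simp
    show ?thesis
      using that by (simp add: unitarym_def vec_eq_iff matrix_matrix_mult_def transpose_def *)
  qed
  moreover have "(\<chi> i j. e * H $ i $ j) *v z = H *v a"
    by (simp add: vec_eq_iff matrix_vector_mult_def a_def mult_ac)
  ultimately show ?thesis using that by (simp add: \<rho>_def)
qed

lemma linear_symm: "linear (\<lambda>x. symm x *v v)" for v :: "complex^'n::finite"
  by (rule linearI) (simp_all add: symm_eq vec_eq_iff matrix_vector_mult_def transpose_def sum.distrib[symmetric]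
      scaleR_sum_right distrib_right scaleR_add_right add_ac)

lemma linear_skewm: "linear (skewm :: complex^'n::finite^'n \<Rightarrow> _)"
  by (rule linearI) (simp_all add: symm_eq vec_eq_iff transpose_def scaleR_add_right scaleR_diff_right)

lemma closed_symdisc: "closed (symdisc :: (complex^'n::finite^'n) set)"
proof -
  note c = linear_continuous_on[OF linear_conv_bounded_linear[THEN iffD1]]
  show ?thesis
    unfolding symdisc_def
    by (intro closed_Collect_conj closed_Collect_all closed_Collect_le continuous_intros c linear_symm linear_skewm)
qed

lemma symdisc_measurable [measurable]: "symdisc \<in> sets borel"
  by (rule borel_closed[OF closed_symdisc])

lemma symdisc_congruence:
  fixes u :: "complex^'n::finite^'n"
  assumes u: "unitarym u" and x: "x \<in> symdisc" shows "u ** x ** transpose u \<in> symdisc"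
proof -
  have "norm ((u ** symm x ** transpose u) *v v) \<le> norm v" for v
  proof -
    have "(u ** symm x ** transpose u) *v v = u *v (symm x *v (transpose u *v v))"
      by (simp only: matrix_vector_mul_assoc matrix_mul_assoc)
    then have "norm ((u ** symm x ** transpose u) *v v) = norm (symm x *v (transpose u *v v))"
      by (simp only: unitarym_norm_vector[OF u])
    also have "\<dots> \<le> norm (transpose u *v v)" using x by (simp only: symdisc_def mem_Collect_eq)
    also have "\<dots> = norm v" by (simp only: unitarym_norm_vector[OF unitarym_transpose[OF u]])
    finally show ?thesis .
  qed
  moreover have "norm (u ** skewm x ** transpose u) = norm (skewm x)"
    using u by (simp add: norm_unitarym_mult_left norm_unitarym_mult_right unitarym_transpose)
  ultimately show ?thesis using x by (simp add: symdisc_def symm_congruence)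
qed

text \<open>The squared norm of the Gaussian \<open>exp (z\<^sup>T x z / 4)\<close> in Fock space, that is
  \<open>det (1 - S S\<^sup>*)\<^sup>-\<^sup>1\<^sup>/\<^sup>2\<close> for \<open>S = symm x\<close>, up to a constant.\<close>

definition gauss_norm :: "complex^'n::finite^'n \<Rightarrow> ennreal" where
  "gauss_norm x = (\<integral>\<^sup>+z. ennreal (exp (Re (bilin x z) - (norm z)\<^sup>2)) \<partial>lborel)"

lemma gauss_kernel_measurable [measurable]:
  "(\<lambda>(x :: complex^'n::finite^'n, z). ennreal (exp (Re (bilin x z) - (norm z)\<^sup>2))) \<in> borel_measurable (borel \<Otimes>\<^sub>M borel)"
proof -
  have "continuous_on UNIV (\<lambda>p :: (complex^'n^'n) \<times> (complex^'n). exp (Re (bilin (fst p) (snd p)) - (norm (snd p))\<^sup>2))"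
    unfolding bilin_def by (intro continuous_intros)
  then have "(\<lambda>p :: (complex^'n^'n) \<times> (complex^'n). exp (Re (bilin (fst p) (snd p)) - (norm (snd p))\<^sup>2)) \<in> borel_measurable borel"
    by (rule borel_measurable_continuous_onI)
  then show ?thesis unfolding borel_prod by (simp add: split_beta)
qed

lemma gauss_norm_measurable [measurable]: "gauss_norm \<in> borel_measurable borel"
  unfolding gauss_norm_def[abs_def] by measurable

lemma gauss_norm_congruence:
  assumes u: "unitarym u" shows "gauss_norm (u ** x ** transpose u) = gauss_norm x"
proof -
  have "gauss_norm (u ** x ** transpose u)
      = (\<integral>\<^sup>+z. ennreal (exp (Re (bilin x (transpose u *v z)) - (norm (transpose u *v z))\<^sup>2)) \<partial>lborel)"
    unfolding gauss_norm_def bilin_congruence[of "transpose u" x, unfolded transpose_transpose]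
      unitarym_norm_vector[OF unitarym_transpose[OF u]] ..
  also have "\<dots> = gauss_norm x"
    unfolding gauss_norm_def by (rule nn_integral_unitary_vector[OF unitarym_transpose[OF u]]) measurable
  finally show ?thesis .
qed

section \<open>A lower bound for the kernel\<close>

lemma norm_le_card_sq: "(\<And>i j. cmod (A $ i $ j) \<le> c) \<Longrightarrow> norm A \<le> (real CARD('n))\<^sup>2 * c"
  for A :: "complex^'n::finite^'n"
proof -
  assume c: "\<And>i j. cmod (A $ i $ j) \<le> c"
  have "norm A \<le> (\<Sum>i\<in>UNIV. norm (A $ i))" unfolding norm_vec_def by (rule L2_set_le_sum) auto
  also have "\<dots> \<le> (\<Sum>i\<in>UNIV. \<Sum>j\<in>UNIV. cmod (A $ i $ j))"
    by (intro sum_mono) (simp add: norm_vec_def L2_set_le_sum)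
  also have "\<dots> \<le> (\<Sum>i\<in>(UNIV :: 'n set). \<Sum>j\<in>(UNIV :: 'n set). c)" by (intro sum_mono c)
  finally show ?thesis by (simp add: power2_eq_square)
qed

lemma diagm_nth: "diagm d $ i $ j = (if i = j then d i else 0)"
  by (simp add: diagm_def)

lemma norm_matrix_sq: "(norm A)\<^sup>2 = (\<Sum>i\<in>UNIV. \<Sum>j\<in>UNIV. (cmod (A $ i $ j))\<^sup>2)"
  for A :: "complex^'n::finite^'m::finite"
  by (simp add: norm_vec_sq)

text \<open>For diagonal \<open>g\<close> the point \<open>tanh t + sech t ** E ** sech t\<close> is
  the image of the solution \<open>E1\<close> of \<open>E1 = E + E ** tanh t ** E1\<close>, by the
  identity \<open>cosh = tanh * sinh + 1 / cosh\<close>. Since \<open>norm E \<le> 1 / 8\<close> and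
  \<open>tanh t\<close> contracts, a solution exists and has norm at most 1/7. The unitary factors
  are then carried along.\<close>

lemma nearI:
  fixes g :: "'n::finite symat" and t :: "real^'n"
  assumes uv: "unitarym u" "unitarym v"
    and P: "cpart g = u ** diagm (\<lambda>i. complex_of_real (cosh (t $ i))) ** v"
    and Q: "apart g = u ** diagm (\<lambda>i. complex_of_real (sinh (t $ i))) ** conjm v"
    and S: "symm x = (\<chi> i j. (if i = j then of_real (tanh (t $ i)) else 0) + E $ i $ j / of_real (cosh (t $ i) * cosh (t $ j)))"
    and E: "norm E \<le> 1 / 8"
  shows "near g (u ** x ** transpose u)"
proof -
  let ?c = "diagm (\<lambda>i. complex_of_real (cosh (t $ i)))" and ?s = "diagm (\<lambda>i. complex_of_real (sinh (t $ i)))"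
    and ?t = "diagm (\<lambda>i. complex_of_real (tanh (t $ i)))"
  have th: "norm (?t ** A) \<le> norm A" for A :: "complex^'n^'n"
  proof -
    have *: "cmod ((?t ** A) $ i $ j) \<le> cmod (A $ i $ j)" for i j
      using tanh_real_bounds[of "t $ i"] by (simp add: diagm_mult_left norm_mult mult_left_le_one_le abs_le_iff)
    have "(norm (?t ** A))\<^sup>2 \<le> (norm A)\<^sup>2"
      unfolding norm_matrix_sq by (intro sum_mono power_mono *) auto
    then show ?thesis by (rule power2_le_imp_le) simp
  qed
  have "w = 0" if "(mat 1 - E ** ?t) *v w = 0" for w
  proof -
    have 1: "E *v (?t *v w) = w"
      using that by (simp add: matrix_vector_mult_diff_rdistrib matrix_vector_mul_assoc)
    have 2: "norm (?t *v w) \<le> norm w"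
    proof (rule power2_le_imp_le)
      have *: "cmod ((?t *v w) $ i) \<le> cmod (w $ i)" for i
        using tanh_real_bounds[of "t $ i"] by (simp add: diagm_vector_mult norm_mult mult_left_le_one_le abs_le_iff)
      show "(norm (?t *v w))\<^sup>2 \<le> (norm w)\<^sup>2"
        unfolding norm_vec_sq by (intro sum_mono power_mono *) auto
    qed simp
    have 3: "norm (E *v (?t *v w)) \<le> 1 / 8 * norm (?t *v w)"
      by (rule order_trans[OF norm_matrix_vector_mult_le]) (intro mult_right_mono E; simp)
    have "norm w \<le> 0" using 2 3[unfolded 1] by linarith
    then show ?thesis by simp
  qed
  then have "invertible (mat 1 - E ** ?t)" by (simp add: invertible_left_inverse matrix_left_invertible_ker)
  then obtain B where B: "(mat 1 - E ** ?t) ** B = mat 1" by (auto simp: invertible_def)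
  define E1 where "E1 = B ** E"
  have "(mat 1 - E ** ?t) ** E1 = E" by (simp add: E1_def matrix_mul_assoc B)
  then have E1: "E1 = E + E ** (?t ** E1)"
    by (simp add: matrix_mult_distribs matrix_mul_assoc algebra_simps)
  have "norm E1 \<le> norm E + norm E * norm E1"
    using norm_triangle_ineq[of E "E ** (?t ** E1)"] norm_matrix_mult_le[of E "?t ** E1"]
      mult_left_mono[OF th[of E1], of "norm E"] E1 by simp
  also have "\<dots> \<le> 1 / 8 + 1 / 8 * norm E1" by (intro add_mono mult_right_mono E) auto
  finally have nE1: "norm E1 \<le> 1 / 4" by simp
  have key: "?c ** E1 + ?s = symm x ** (?s ** E1 + ?c)"
  proof -
    have S': "symm x ** A = ?t ** A + (\<chi> i j. (\<Sum>k\<in>UNIV. E $ i $ k * (A $ k $ j / of_real (cosh (t $ k)))) / of_real (cosh (t $ i)))" for A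
      unfolding S by (simp add: vec_eq_iff matrix_matrix_mult_def diagm_def distrib_right distrib_left sum.distrib sum_divide_distrib mult_ac)
    have c0: "complex_of_real (cosh (t $ i)) \<noteq> 0" for i using cosh_real_pos[of "t $ i"] by simp
    have cs: "complex_of_real (cosh (t $ i)) = of_real (tanh (t $ i)) * of_real (sinh (t $ i)) + 1 / of_real (cosh (t $ i))" for i
    proof -
      have "cosh (t $ i) = tanh (t $ i) * sinh (t $ i) + 1 / cosh (t $ i)"
        using cosh_real_pos[of "t $ i"] cosh_square_eq[of "t $ i"] by (simp add: tanh_def power2_eq_square field_simps)
      from arg_cong[OF this, of complex_of_real] show ?thesis by simp
    qed
    have E1': "E1 $ i $ j = (\<Sum>k\<in>UNIV. E $ i $ k * ((if k = j then 1 else 0) + of_real (tanh (t $ k)) * E1 $ k $ j))" for i j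
    proof -
      have tE: "(?t ** E1) $ k $ j = of_real (tanh (t $ k)) * E1 $ k $ j" for k
        by (simp add: diagm_mult_left)
      have "E1 $ i $ j = E $ i $ j + (E ** (?t ** E1)) $ i $ j"
        using arg_cong[OF E1, of "\<lambda>A. A $ i $ j"] by (simp only: vector_add_component)
      also have "(E ** (?t ** E1)) $ i $ j = (\<Sum>k\<in>UNIV. E $ i $ k * (?t ** E1) $ k $ j)"
        by (simp only: matrix_matrix_mult_def[of E] vec_lambda_beta)
      finally show ?thesis
        unfolding tE by (simp add: distrib_left sum.distrib if_distrib[of "\<lambda>y. _ * y"] sum.delta cong: if_cong)
    qed
    have "(?s ** E1 + ?c) $ k $ j / of_real (cosh (t $ k)) = (if k = j then 1 else 0) + of_real (tanh (t $ k)) * E1 $ k $ j" for k j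
      using c0[of k] by (simp add: diagm_mult_left diagm_nth tanh_def add_divide_distrib)
    then have "(symm x ** (?s ** E1 + ?c)) $ i $ j = (?t ** (?s ** E1 + ?c)) $ i $ j + E1 $ i $ j / of_real (cosh (t $ i))" for i j
      unfolding S' by (simp add: E1'[symmetric])
    moreover have "(?t ** (?s ** E1 + ?c)) $ i $ j + E1 $ i $ j / of_real (cosh (t $ i)) = (?c ** E1 + ?s) $ i $ j" for i j
    proof -
      have tc: "complex_of_real (tanh (t $ i)) * of_real (cosh (t $ i)) = of_real (sinh (t $ i))"
        using c0[of i] by (simp add: tanh_def)
      have "(?t ** (?s ** E1 + ?c)) $ i $ j + E1 $ i $ j / of_real (cosh (t $ i))
          = (of_real (tanh (t $ i)) * of_real (sinh (t $ i)) + 1 / of_real (cosh (t $ i))) * E1 $ i $ j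
            + (if i = j then of_real (tanh (t $ i)) * of_real (cosh (t $ i)) else 0)"
        by (simp add: diagm_mult_left diagm_nth distrib_left distrib_right)
      also have "\<dots> = (?c ** E1 + ?s) $ i $ j"
        unfolding tc cs[symmetric] by (simp add: diagm_mult_left diagm_nth)
      finally show ?thesis .
    qed
    ultimately show ?thesis by (simp add: vec_eq_iff)
  qed
  \<comment> \<open>The required point of the ball for \<open>g\<close> itself: \<open>E1\<close>
    transported by the unitary factor \<open>v\<close>, with the same norm.\<close>
  define F where "F = transpose (conjm v) ** E1 ** conjm v"
  have vF: "v ** F = E1 ** conjm v"
    unfolding F_def matrix_mul_assoc unitarym_right[OF uv(2)] by simp
  have uT: "transpose u ** conjm u = mat 1"
    using unitarym_conjm[OF uv(1)] by (simp add: unitarym_def)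
  have uT': "transpose u ** (conjm u ** A) = A" for A :: "complex^'n^'n"
    by (simp add: matrix_mul_assoc uT)
  have Pc: "conjm (cpart g) = conjm u ** ?c ** conjm v" and Qc: "conjm (apart g) = conjm u ** ?s ** v"
    by (simp_all add: P Q conjm_mult conjm_diagm)
  have "cpart g ** F + apart g = u ** ((?c ** E1 + ?s) ** conjm v)"
    by (simp only: P Q matrix_mult_distribs matrix_mul_assoc[symmetric] vF)
  also have "\<dots> = u ** (symm x ** ((?s ** E1 + ?c) ** conjm v))"
    by (simp only: key matrix_mul_assoc)
  also have "\<dots> = (u ** symm x ** transpose u) ** (conjm u ** ((?s ** E1 + ?c) ** conjm v))"
    by (simp only: matrix_mul_assoc[symmetric] uT')
  also have "conjm u ** ((?s ** E1 + ?c) ** conjm v) = conjm (apart g) ** F + conjm (cpart g)"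
    by (simp only: Pc Qc matrix_mult_distribs matrix_mul_assoc[symmetric] vF)
  finally have "cpart g ** F + apart g
    = symm (u ** x ** transpose u) ** (conjm (apart g) ** F + conjm (cpart g))"
    by (simp only: symm_congruence)
  moreover have "norm F \<le> 1 / 4"
    using uv nE1 by (simp add: F_def norm_unitarym_mult_left norm_unitarym_mult_right unitarym_conjm unitarym_adjoint)
  ultimately show ?thesis unfolding near_def by blast
qed

lemma closed_near_section: "closed {x :: complex^'n::finite^'n. near g x}"
proof -
  have "closed ((\<lambda>x. ((1, g), x)) -` {p :: 'n mpair \<times> (complex^'n^'n). near (snd (fst p)) (snd p)})"
    by (intro continuous_closed_vimage closed_near continuous_intros)
  then show ?thesis by (simp add: vimage_def)
qed

text \<open>Up to the perturbation the exponent is the sum over \<open>i\<close> of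
  \<open>- (1 - tanh) Re^2 - (1 + tanh) Im^2\<close>. In the box with half sides \<open>a i\<close>
  and \<open>b i\<close> both terms are at least -1, and since
  \<open>a i * b i = cosh (t $ i)\<close> the volume of the box is \<open>4^n\<close> times the
  product of the hyperbolic cosines.\<close>

lemma gauss_norm_lower:
  fixes x :: "complex^'n::finite^'n" and t :: "real^'n"
  assumes S: "\<And>i j. cmod (of_real (cosh (t $ i) * cosh (t $ j)) * (symm x $ i $ j - (if i = j then of_real (tanh (t $ i)) else 0))) \<le> \<delta>"
    and \<delta>: "2 * (real CARD('n))\<^sup>2 * \<delta> \<le> 1"
  shows "ennreal (exp (- (2 * real CARD('n) + 1)) * (4 ^ CARD('n) * (\<Prod>i\<in>UNIV. cosh (t $ i)))) \<le> gauss_norm x"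
proof -
  define th where "th i = tanh (t $ i)" for i
  have th: "1 - th i > 0" "1 + th i > 0" for i using tanh_real_bounds[of "t $ i"] by (auto simp: th_def)
  define a b where "a i = 1 / sqrt (1 - th i)" and "b i = 1 / sqrt (1 + th i)" for i
  have a0: "a i \<ge> 0" "b i \<ge> 0" for i using th[of i] by (auto simp: a_def b_def)
  have asq: "(a i)\<^sup>2 = 1 / (1 - th i)" "(b i)\<^sup>2 = 1 / (1 + th i)" for i
    using th[of i] by (auto simp: a_def b_def power_divide)
  have prod1: "(1 - th i) * (1 + th i) = 1 / (cosh (t $ i))\<^sup>2" for i
    using one_minus_tanh_sq[of "t $ i"] by (simp add: th_def power2_eq_square algebra_simps)
  have ab: "a i * b i = cosh (t $ i)" for i
    by (simp add: a_def b_def real_sqrt_mult[symmetric] prod1 real_sqrt_divide)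
  have ab2: "(a i)\<^sup>2 + (b i)\<^sup>2 = 2 * (cosh (t $ i))\<^sup>2" for i
  proof -
    have "1 / (1 - th i) + 1 / (1 + th i) = 2 / ((1 - th i) * (1 + th i))"
      using th[of i] by (simp add: field_simps)
    then show ?thesis by (simp add: asq prod1)
  qed
  define u l where "u = (\<chi> i. Complex (a i) (b i))" and "l = (\<chi> i. Complex (- a i) (- b i))"
  have exponent: "- (2 * real CARD('n) + 1) \<le> Re (bilin x z) - (norm z)\<^sup>2" if z: "z \<in> cbox l u" for z
  proof -
    define A where "A i j = symm x $ i $ j - (if i = j then of_real (th i) else 0)" for i j
    have z': "\<bar>Re (z $ i)\<bar> \<le> a i" "\<bar>Im (z $ i)\<bar> \<le> b i" for i
      using z by (auto simp: mem_cbox_complex_vec u_def l_def abs_le_iff minus_le_iff)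
    have zsq: "(Re (z $ i))\<^sup>2 \<le> (a i)\<^sup>2" "(Im (z $ i))\<^sup>2 \<le> (b i)\<^sup>2" for i
      using z'[of i] a0[of i] by (auto intro: power2_le_iff_abs_le[THEN iffD2])
    have zn: "cmod (z $ i) \<le> sqrt 2 * cosh (t $ i)" for i
    proof (rule power2_le_imp_le)
      show "(cmod (z $ i))\<^sup>2 \<le> (sqrt 2 * cosh (t $ i))\<^sup>2"
        unfolding cmod_power2 power_mult_distrib using zsq[of i] ab2[of i] by simp
    qed (simp add: cosh_real_nonneg)
    \<comment> \<open>The perturbation is measured in units of
      \<open>1 / (cosh (t $ i) * cosh (t $ j))\<close>, which the size of \<open>z\<close> in the
      box cancels; the \<open>n^2\<close> terms together are at most 1.\<close>
    have off: "cmod (z $ i * A i j * z $ j) \<le> 2 * \<delta>" for i j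
    proof -
      have "cmod (z $ i * A i j * z $ j) \<le> (sqrt 2 * cosh (t $ i)) * cmod (A i j) * (sqrt 2 * cosh (t $ j))"
        unfolding norm_mult by (intro mult_mono zn) (auto simp: cosh_real_nonneg)
      also have "\<dots> = 2 * cmod (of_real (cosh (t $ i) * cosh (t $ j)) * A i j)"
        using cosh_real_pos[of "t $ i"] cosh_real_pos[of "t $ j"]
        by (simp add: norm_mult)
      also have "\<dots> \<le> 2 * \<delta>" using S[of i j] by (simp only: A_def th_def)
      finally show ?thesis .
    qed
    have "bilin x z = (\<Sum>i\<in>UNIV. of_real (th i) * (z $ i)\<^sup>2) + (\<Sum>i\<in>UNIV. \<Sum>j\<in>UNIV. z $ i * A i j * z $ j)"
    proof -
      have "bilin x z = (\<Sum>i\<in>UNIV. \<Sum>j\<in>UNIV. (if i = j then of_real (th i) * (z $ i)\<^sup>2 else 0) + z $ i * A i j * z $ j)"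
        unfolding bilin_symm[of x z, symmetric] unfolding bilin_def
        by (intro sum.cong) (auto simp: A_def power2_eq_square algebra_simps)
      then show ?thesis by (simp add: sum.distrib sum.delta)
    qed
    moreover have "\<bar>Re (\<Sum>i\<in>UNIV. \<Sum>j\<in>UNIV. z $ i * A i j * z $ j)\<bar> \<le> 1"
    proof -
      have "\<bar>Re (\<Sum>i\<in>UNIV. \<Sum>j\<in>UNIV. z $ i * A i j * z $ j)\<bar> \<le> cmod (\<Sum>i\<in>UNIV. \<Sum>j\<in>UNIV. z $ i * A i j * z $ j)"
        by (rule abs_Re_le_cmod)
      also have "\<dots> \<le> (\<Sum>i\<in>(UNIV :: 'n set). \<Sum>j\<in>(UNIV :: 'n set). 2 * \<delta>)"
        by (intro order_trans[OF norm_sum] sum_mono off)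
      also have "\<dots> \<le> 1" using \<delta> by (simp add: power2_eq_square)
      finally show ?thesis .
    qed
    moreover have "- (2 * real CARD('n)) \<le> Re (\<Sum>i\<in>UNIV. of_real (th i) * (z $ i)\<^sup>2) - (norm z)\<^sup>2"
    proof -
      have "- 2 \<le> Re (of_real (th i) * (z $ i)\<^sup>2) - (cmod (z $ i))\<^sup>2" for i
      proof -
        have "Re (of_real (th i) * (z $ i)\<^sup>2) - (cmod (z $ i))\<^sup>2 = - ((1 - th i) * (Re (z $ i))\<^sup>2 + (1 + th i) * (Im (z $ i))\<^sup>2)"
          unfolding cmod_power2 by (simp add: power2_eq_square algebra_simps)
        moreover have "(1 - th i) * (Re (z $ i))\<^sup>2 \<le> (1 - th i) * (a i)\<^sup>2" "(1 + th i) * (Im (z $ i))\<^sup>2 \<le> (1 + th i) * (b i)\<^sup>2"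
          using th[of i] zsq[of i] by (auto intro: mult_left_mono)
        moreover have "(1 - th i) * (a i)\<^sup>2 = 1" "(1 + th i) * (b i)\<^sup>2 = 1" using th[of i] by (auto simp: asq)
        ultimately show ?thesis by linarith
      qed
      then have "(\<Sum>i\<in>(UNIV :: 'n set). - 2) \<le> (\<Sum>i\<in>UNIV. Re (of_real (th i) * (z $ i)\<^sup>2) - (cmod (z $ i))\<^sup>2)"
        by (intro sum_mono)
      then show ?thesis by (simp add: norm_vec_sq sum_subtractf)
    qed
    ultimately show ?thesis by (simp add: abs_le_iff)
  qed
  have "emeasure lborel (cbox l u) = ennreal (4 ^ CARD('n) * (\<Prod>i\<in>UNIV. cosh (t $ i)))"
  proof -
    have "emeasure lborel (cbox l u) = ennreal (\<Prod>i\<in>UNIV. (a i - - a i) * (b i - - b i))"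
      by (subst emeasure_cbox_complex_vec) (use a0 in \<open>auto simp: u_def l_def intro: order_trans[OF _ a0(1)] order_trans[OF _ a0(2)]\<close>)
    also have "(\<Prod>i\<in>UNIV. (a i - - a i) * (b i - - b i)) = (\<Prod>i\<in>(UNIV :: 'n set). 4 * cosh (t $ i))"
      by (intro prod.cong) (auto simp: ab[symmetric])
    finally show ?thesis by (simp add: prod.distrib)
  qed
  then have "ennreal (exp (- (2 * real CARD('n) + 1)) * (4 ^ CARD('n) * (\<Prod>i\<in>UNIV. cosh (t $ i))))
     = ennreal (exp (- (2 * real CARD('n) + 1))) * emeasure lborel (cbox l u)"
    by (simp add: ennreal_mult' prod_nonneg cosh_real_nonneg)
  also have "\<dots> = (\<integral>\<^sup>+z. ennreal (exp (- (2 * real CARD('n) + 1))) * indicator (cbox l u) z \<partial>lborel)"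
    by (subst nn_integral_cmult_indicator) auto
  also have "\<dots> \<le> gauss_norm x"
    unfolding gauss_norm_def
  proof (rule nn_integral_mono)
    fix z
    show "ennreal (exp (- (2 * real CARD('n) + 1))) * indicator (cbox l u) z \<le> ennreal (exp (Re (bilin x z) - (norm z)\<^sup>2))"
    proof (cases "z \<in> cbox l u")
      case True
      then have "exp (- (2 * real CARD('n) + 1)) \<le> exp (Re (bilin x z) - (norm z)\<^sup>2)"
        using exponent by (simp only: exp_le_cancel_iff)
      then show ?thesis using True by (simp add: ennreal_leI)
    qed simp
  qed
  finally show ?thesis .
qed

text \<open>The square covers every ordered pair once and the diagonal once more: with
  \<open>D\<close> the product of all \<open>c i\<close>, the pairs give \<open>D^(2n)\<close> and
  the diagonal \<open>D^2\<close>. The square is what a volume contains, as a complex entry has two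
  real directions.\<close>

lemma prod_upper_pairs:
  fixes \<iota> :: "'n::finite \<Rightarrow> nat" and c :: "'n \<Rightarrow> real"
  assumes "inj \<iota>"
  shows "(\<Prod>i\<in>UNIV. \<Prod>j\<in>UNIV. if \<iota> i \<le> \<iota> j then c i * c j else 1)\<^sup>2 = (\<Prod>i\<in>UNIV. c i) ^ (2 * CARD('n) + 2)"
proof -
  let ?D = "\<Prod>i\<in>UNIV. c i" and ?W = "\<Prod>i\<in>UNIV. \<Prod>j\<in>UNIV. if \<iota> i \<le> \<iota> j then c i * c j else 1"
  have W: "?W = (\<Prod>i\<in>UNIV. \<Prod>j\<in>UNIV. if \<iota> j \<le> \<iota> i then c i * c j else 1)"
    by (subst prod.swap, intro prod.cong refl) (auto simp: mult.commute)
  have "?W\<^sup>2 = ?W * (\<Prod>i\<in>UNIV. \<Prod>j\<in>UNIV. if \<iota> j \<le> \<iota> i then c i * c j else 1)"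
    unfolding W[symmetric] by (simp add: power2_eq_square)
  also have "\<dots> = (\<Prod>i\<in>UNIV. \<Prod>j\<in>UNIV. c i * c j * (if j = i then c i * c j else 1))"
    unfolding prod.distrib[symmetric] using injD[OF assms]
    by (intro prod.cong refl) (auto simp: not_le intro: order.antisym)
  also have "\<dots> = (\<Prod>i\<in>UNIV. \<Prod>j\<in>UNIV. c i * c j) * (\<Prod>i\<in>UNIV. c i * c i)"
    by (simp add: prod.distrib prod.delta)
  also have "\<dots> = ?D ^ (2 * CARD('n) + 2)"
    by (simp add: prod.distrib prod_power_distrib[symmetric] power_add power_mult power2_eq_square power_mult_distrib mult_ac)
  finally show ?thesis .
qed

lemma cmod_le_abs_sum: "\<bar>Re z\<bar> \<le> s / 2 \<Longrightarrow> \<bar>Im z\<bar> \<le> s / 2 \<Longrightarrow> cmod z \<le> s"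
  using cmod_le[of z] by simp

text \<open>After conjugation by \<open>u\<close> the image of the ball contains a neighbourhood
  \<open>V\<close> of \<open>tanh t\<close> of size \<open>\<delta> / (c i * c j)\<close> in the
  symmetric entry (i, j). Its volume is at least of order \<open>D^-(2n+2)\<close> and the weight on
  it at least of order \<open>D = cmod (det (cpart g))\<close>. The choice of
  \<open>\<delta>\<close> gives \<open>n^2 * \<delta> = 1 / 8\<close>, the radius that
  \<open>nearI\<close> demands.\<close>

lemma near_lower_bound:
  fixes g :: "'n::finite symat"
  assumes g: "g \<in> Sp" and \<iota>: "inj (\<iota> :: 'n \<Rightarrow> nat)"
  defines "\<delta> \<equiv> 1 / (8 * (real CARD('n))\<^sup>2)"
  shows "ennreal (exp (- (2 * real CARD('n) + 1)) * 4 ^ CARD('n) * \<delta> ^ (2 * CARD('n) * CARD('n)) / cmod (det (cpart g)) ^ (2 * CARD('n) + 1))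
    \<le> (\<integral>\<^sup>+x. gauss_norm x * (indicator {x. near g x} x * indicator symdisc x) \<partial>lborel)"
proof -
  obtain u v and t :: "real^'n" where uv: "unitarym u" "unitarym v"
    and P: "cpart g = u ** diagm (\<lambda>i. complex_of_real (cosh (t $ i))) ** v"
    and Q: "apart g = u ** diagm (\<lambda>i. complex_of_real (sinh (t $ i))) ** conjm v"
    using Sp_unitary_form[OF g] by metis
  define c where "c i = cosh (t $ i)" for i
  have c0: "c i > 0" for i by (simp add: c_def cosh_real_pos)
  define D where "D = (\<Prod>i\<in>UNIV. c i)"
  have D: "D > 0" unfolding D_def by (intro prod_pos) (simp add: c0)
  have det: "cmod (det (cpart g)) = D"
    using uv by (simp add: P det_mul det_diagm norm_mult cmod_det_unitarym prod_norm[symmetric] D_def c_def)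
  have n1: "1 \<le> real CARD('n)" using zero_less_card_finite[where 'a = 'n] by linarith
  have \<delta>: "\<delta> > 0" "8 * (real CARD('n))\<^sup>2 * \<delta> = 1" using n1 by (auto simp: \<delta>_def)
  define T :: "complex^'n^'n" where "T = diagm (\<lambda>i. of_real (tanh (t $ i)))"
  define V where "V = {x. (\<forall>i j. cmod (of_real (c i * c j) * ((x $ i $ j + x $ j $ i) / 2 - T $ i $ j)) \<le> \<delta>) \<and>
     (\<forall>i j. cmod ((x $ i $ j - x $ j $ i) / 2) \<le> \<delta>)}"
  have "closed V"
    unfolding V_def by (intro closed_Collect_conj closed_Collect_all closed_Collect_le continuous_intros) auto
  then have V[measurable]: "V \<in> sets borel" by (rule borel_closed)
  have near[measurable]: "{x :: complex^'n^'n. near g x} \<in> sets borel" by (rule borel_closed[OF closed_near_section])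
  have VD: "cmod (of_real (c i * c j) * (symm x $ i $ j - T $ i $ j)) \<le> \<delta>" "cmod (skewm x $ i $ j) \<le> \<delta>"
    if "x \<in> V" for x i j
    using that by (auto simp: V_def symm_def skewm_def)
  define \<kappa> where "\<kappa> = exp (- (2 * real CARD('n) + 1)) * (4 ^ CARD('n) * D)"
  have pointwise: "ennreal \<kappa> * indicator V x
      \<le> gauss_norm (u ** x ** transpose u) * (indicator {x. near g x} (u ** x ** transpose u) * indicator symdisc (u ** x ** transpose u))" for x
  proof (cases "x \<in> V")
    case True
    have Tij: "T $ i $ j = (if i = j then of_real (tanh (t $ i)) else 0)" for i j by (simp add: T_def diagm_def)
    define E where "E = (\<chi> i j. of_real (c i * c j) * (symm x $ i $ j - T $ i $ j))"
    have "norm E \<le> (real CARD('n))\<^sup>2 * \<delta>"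
      by (rule norm_le_card_sq) (simp only: E_def vec_lambda_beta VD(1)[OF True])
    then have E: "norm E \<le> 1 / 8" using \<delta>(2) by simp
    have "symm x = (\<chi> i j. (if i = j then of_real (tanh (t $ i)) else 0) + E $ i $ j / of_real (cosh (t $ i) * cosh (t $ j)))"
      using c0 by (simp add: vec_eq_iff E_def Tij c_def less_imp_neq[symmetric])
    from nearI[OF uv P Q this E] have nr: "near g (u ** x ** transpose u)" .
    have "norm (skewm x) \<le> (real CARD('n))\<^sup>2 * \<delta>"
      by (rule norm_le_card_sq) (simp only: VD(2)[OF True])
    then have "norm (skewm (u ** x ** transpose u)) \<le> 1"
      using \<delta>(2) uv by (simp add: symm_congruence norm_unitarym_mult_left norm_unitarym_mult_right unitarym_transpose)
    then have "u ** x ** transpose u \<in> symdisc"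
      using near_symm_le[OF g nr] by (simp add: symdisc_def)
    moreover have "ennreal \<kappa> \<le> gauss_norm x"
      unfolding \<kappa>_def D_def c_def
    proof (rule gauss_norm_lower[where \<delta> = \<delta>])
      show "cmod (of_real (cosh (t $ i) * cosh (t $ j)) * (symm x $ i $ j - (if i = j then of_real (tanh (t $ i)) else 0))) \<le> \<delta>" for i j
        using VD(1)[OF True, of i j] by (simp only: c_def Tij)
      show "2 * (real CARD('n))\<^sup>2 * \<delta> \<le> 1" using \<delta>(2) by linarith
    qed
    ultimately show ?thesis using nr True by (simp add: gauss_norm_congruence[OF uv(1)])
  qed simp
  have vol: "ennreal (\<delta> ^ (2 * CARD('n) * CARD('n)) / D ^ (2 * CARD('n) + 2)) \<le> emeasure lborel V"
  proof -
    \<comment> \<open>Side lengths in the coordinates of \<open>sym_coords\<close>: entries with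
      \<open>\<iota> i \<le> \<iota> j\<close> store the symmetric part and have to shrink, the
      others store the antisymmetric part and keep the size \<open>\<delta>\<close>.\<close>
    define s where "s i j = \<delta> / (if \<iota> i \<le> \<iota> j then c i * c j else 1)" for i j
    have s0: "s i j > 0" for i j using \<delta>(1) c0 by (simp add: s_def)
    define b l :: "complex^'n^'n" where "b = (\<chi> i j. Complex (s i j / 2) (s i j / 2))" and "l = (\<chi> i j. Complex (- s i j / 2) (- s i j / 2))"
    have "T + sym_coords \<iota> y \<in> V" if y: "y \<in> cbox l b" for y
    proof -
      have ys: "cmod (y $ i $ j) \<le> s i j" for i j
      proof -
        have "- s i j / 2 \<le> Re (y $ i $ j)" "Re (y $ i $ j) \<le> s i j / 2"
          "- s i j / 2 \<le> Im (y $ i $ j)" "Im (y $ i $ j) \<le> s i j / 2"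
          using y by (simp_all add: mem_cbox_complex_matrix b_def l_def)
        then show ?thesis by (intro cmod_le_abs_sum) linarith+
      qed
      have ys2: "cmod (y $ i $ j / of_real (sqrt 2)) \<le> s i j" for i j
        using order_trans[OF _ ys[of i j], of "cmod (y $ i $ j / of_real (sqrt 2))"]
        by (simp add: norm_divide divide_le_eq mult_le_cancel_left1)
      have 1: "((T + x) $ i $ j + (T + x) $ j $ i) / 2 - T $ i $ j = symm x $ i $ j"
        "((T + x) $ i $ j - (T + x) $ j $ i) / 2 = skewm x $ i $ j" for x i j
        by (auto simp: T_def diagm_def symm_def skewm_def field_simps)
      have cs: "c i * c j * s i j \<le> \<delta>" "c j * c i * s i j \<le> \<delta>" if "\<iota> i \<le> \<iota> j" for i j
        using that c0[of i] c0[of j] by (auto simp: s_def less_imp_neq[symmetric])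
      have sm: "s i j = \<delta>" if "\<iota> j < \<iota> i" for i j using that by (simp add: s_def)
      have "cmod (of_real (c i * c j) * symm (sym_coords \<iota> y) $ i $ j) \<le> \<delta>" for i j
      proof -
        consider "i = j" | "i \<noteq> j" "\<iota> i < \<iota> j" | "i \<noteq> j" "\<not> \<iota> i < \<iota> j" "\<iota> j < \<iota> i"
          using injD[OF \<iota>] by (metis linorder_neqE_nat)
        then show ?thesis
        proof cases
          case 1
          have "c i * c i * cmod (y $ i $ i) \<le> c i * c i * s i i" using c0[of i] by (intro mult_left_mono ys) auto
          from order_trans[OF this cs(1)] 1 c0[of i] show ?thesis by (simp add: symm_sym_coords[OF \<iota>] norm_mult)
        next
          case 2
          have "c i * c j * cmod (y $ i $ j / of_real (sqrt 2)) \<le> c i * c j * s i j" using c0[of i] c0[of j] by (intro mult_left_mono ys2) auto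
          from order_trans[OF this cs(1)] 2 c0[of i] c0[of j] show ?thesis by (simp add: symm_sym_coords[OF \<iota>] norm_mult norm_divide)
        next
          case 3
          have "c i * c j * cmod (y $ j $ i / of_real (sqrt 2)) \<le> c i * c j * s j i" using c0[of i] c0[of j] by (intro mult_left_mono ys2) auto
          from order_trans[OF this cs(2)] 3 c0[of i] c0[of j] show ?thesis by (simp add: symm_sym_coords[OF \<iota>] norm_mult norm_divide)
        qed
      qed
      moreover have "cmod (skewm (sym_coords \<iota> y) $ i $ j) \<le> \<delta>" for i j
      proof -
        consider "i = j" | "i \<noteq> j" "\<iota> i < \<iota> j" | "i \<noteq> j" "\<not> \<iota> i < \<iota> j" "\<iota> j < \<iota> i"
          using injD[OF \<iota>] by (metis linorder_neqE_nat)
        then show ?thesis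
          using ys2[of j i] ys2[of i j] sm[of j i] sm[of i j] \<delta>(1)
          by cases (simp_all add: skewm_sym_coords[OF \<iota>] norm_divide)
      qed
      ultimately show ?thesis unfolding V_def mem_Collect_eq 1 by blast
    qed
    then have "emeasure lborel (cbox l b) \<le> (\<integral>\<^sup>+y. indicator V (T + sym_coords \<iota> y) \<partial>lborel)"
    proof -
      assume V': "\<And>y. y \<in> cbox l b \<Longrightarrow> T + sym_coords \<iota> y \<in> V"
      have "(\<integral>\<^sup>+y. indicator (cbox l b) y \<partial>lborel) \<le> (\<integral>\<^sup>+y. indicator V (T + sym_coords \<iota> y) \<partial>lborel)"
        by (intro nn_integral_mono) (auto simp: indicator_def dest: V')
      then show ?thesis by simp
    qed
    also have "\<dots> = (\<integral>\<^sup>+x. indicator V (T + x) \<partial>lborel)"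
      by (rule nn_integral_sym_coords[OF \<iota>]) measurable
    also have "\<dots> = (\<integral>\<^sup>+x. indicator V x \<partial>lborel)"
      by (rule nn_integral_lborel_translate) measurable
    finally have "emeasure lborel (cbox l b) \<le> emeasure lborel V" by simp
    moreover have "emeasure lborel (cbox l b) = ennreal (\<delta> ^ (2 * CARD('n) * CARD('n)) / D ^ (2 * CARD('n) + 2))"
    proof -
      have "emeasure lborel (cbox l b) = ennreal (\<Prod>i\<in>UNIV. \<Prod>j\<in>UNIV. (s i j)\<^sup>2)"
        by (subst emeasure_cbox_complex_matrix)
          (auto simp: b_def l_def power2_eq_square less_imp_le[OF s0] intro: order_trans[of _ 0])
      also have "(\<Prod>i\<in>UNIV. \<Prod>j\<in>UNIV. (s i j)\<^sup>2)
         = (\<Prod>i\<in>(UNIV :: 'n set). \<Prod>j\<in>(UNIV :: 'n set). \<delta>\<^sup>2) / (\<Prod>i\<in>UNIV. \<Prod>j\<in>UNIV. if \<iota> i \<le> \<iota> j then c i * c j else 1)\<^sup>2"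
        by (simp only: s_def power_divide prod_dividef prod_power_distrib)
      also have "\<dots> = \<delta> ^ (2 * CARD('n) * CARD('n)) / D ^ (2 * CARD('n) + 2)"
        unfolding prod_upper_pairs[OF \<iota>] D_def by (simp add: power_mult)
      finally show ?thesis .
    qed
    ultimately show ?thesis by simp
  qed
  have "exp (- (2 * real CARD('n) + 1)) * 4 ^ CARD('n) * \<delta> ^ (2 * CARD('n) * CARD('n)) / D ^ (2 * CARD('n) + 1)
     = \<kappa> * (\<delta> ^ (2 * CARD('n) * CARD('n)) / D ^ (2 * CARD('n) + 2))"
    using D by (simp add: \<kappa>_def power_add)
  then have "ennreal (exp (- (2 * real CARD('n) + 1)) * 4 ^ CARD('n) * \<delta> ^ (2 * CARD('n) * CARD('n)) / cmod (det (cpart g)) ^ (2 * CARD('n) + 1))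
     = ennreal \<kappa> * ennreal (\<delta> ^ (2 * CARD('n) * CARD('n)) / D ^ (2 * CARD('n) + 2))"
    using D \<delta>(1) by (simp only: det) (subst ennreal_mult[symmetric], auto simp: \<kappa>_def)
  also have "\<dots> \<le> ennreal \<kappa> * emeasure lborel V" by (intro mult_left_mono vol) simp
  also have "\<dots> = (\<integral>\<^sup>+x. ennreal \<kappa> * indicator V x \<partial>lborel)"
    by (subst nn_integral_cmult_indicator) auto
  also have "\<dots> \<le> (\<integral>\<^sup>+x. gauss_norm (u ** x ** transpose u) * (indicator {x. near g x} (u ** x ** transpose u) * indicator symdisc (u ** x ** transpose u)) \<partial>lborel)"
    by (intro nn_integral_mono pointwise)
  also have "\<dots> = (\<integral>\<^sup>+x. gauss_norm x * (indicator {x. near g x} x * indicator symdisc x) \<partial>lborel)"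
    by (rule nn_integral_congruence[OF uv(1)]) measurable
  finally show ?thesis .
qed

section \<open>An upper bound for the kernel\<close>

text \<open>Apply the contraction to a coordinate vector: its image is a column of the
  matrix.\<close>

lemma symm_entry_le:
  assumes "x \<in> symdisc"
  shows "(\<Sum>k\<in>UNIV. (cmod (symm x $ k $ j))\<^sup>2) \<le> 1" "cmod (symm x $ i $ j) \<le> 1" "cmod (skewm x $ i $ j) \<le> 1"
proof -
  have c: "symm x *v axis j 1 = column j (symm x)" by (simp add: vec_eq_iff matrix_vector_mult_def axis_def column_def if_distrib cong: if_cong)
  have "norm (symm x *v axis j 1) \<le> norm (axis j (1 :: complex))"
    using assms by (simp only: symdisc_def mem_Collect_eq)
  then have n: "norm (column j (symm x)) \<le> 1" unfolding c by simp
  then have "(norm (column j (symm x)))\<^sup>2 \<le> 1\<^sup>2" by (intro power_mono) auto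
  then show "(\<Sum>k\<in>UNIV. (cmod (symm x $ k $ j))\<^sup>2) \<le> 1" by (simp add: norm_vec_sq column_def)
  show "cmod (symm x $ i $ j) \<le> 1"
    using order_trans[OF Finite_Cartesian_Product.norm_nth_le[of "column j (symm x)" i] n] by (simp add: column_def)
  have "cmod (skewm x $ i $ j) \<le> norm (skewm x)"
    by (rule order_trans[OF Finite_Cartesian_Product.norm_nth_le Finite_Cartesian_Product.norm_nth_le])
  then show "cmod (skewm x $ i $ j) \<le> 1" using assms by (simp add: symdisc_def)
qed

text \<open>If the real part of the corner entry \<open>x $ i0 $ i0\<close> is at least
  \<open>1 - s\<close>, the column bound leaves room of order \<open>sqrt s\<close> for its
  imaginary part and for the other symmetric entries of that row. The corner contributes
  \<open>s * sqrt s\<close> and each of the n - 1 others \<open>(sqrt s)^2\<close>, in total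
  \<open>s^(n + 1/2)\<close>; the remaining coordinates are merely bounded.\<close>

lemma emeasure_symdisc_slice:
  fixes \<iota> :: "'n::finite \<Rightarrow> nat"
  assumes \<iota>: "inj \<iota>" and i0: "\<And>j. \<iota> i0 \<le> \<iota> j" and s: "0 < s" "s \<le> 2"
  shows "emeasure lborel {x \<in> symdisc. 1 - Re (x $ i0 $ i0) \<le> s}
    \<le> ennreal (2 * sqrt 2 * 16 ^ (CARD('n) * CARD('n)) * (s ^ CARD('n) * sqrt s))"
proof -
  define A where "A = {x :: complex^'n^'n. x \<in> symdisc \<and> 1 - Re (x $ i0 $ i0) \<le> s}"
  have "closed A"
  proof -
    have "A = symdisc \<inter> {x. 1 - Re (x $ i0 $ i0) \<le> s}" by (auto simp: A_def)
    then show ?thesis by (simp only:) (intro closed_Int closed_symdisc closed_Collect_le continuous_intros)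
  qed
  then have A[measurable]: "A \<in> sets borel" by (rule borel_closed)
  define b :: "complex^'n^'n" where "b = (\<chi> i j. if i = i0 then if j = i0 then Complex 1 (sqrt (2 * s)) else Complex (2 * sqrt s) (2 * sqrt s) else Complex 2 2)"
  define l :: "complex^'n^'n" where "l = (\<chi> i j. if i = i0 then if j = i0 then Complex (1 - s) (- sqrt (2 * s)) else Complex (- 2 * sqrt s) (- 2 * sqrt s) else Complex (- 2) (- 2))"
  have ReIm: "- r \<le> Re z \<and> Re z \<le> r \<and> - r \<le> Im z \<and> Im z \<le> r" if "cmod z \<le> r" for z r
    using abs_Re_le_cmod[of z] abs_Im_le_cmod[of z] that by linarith
  have box: "y \<in> cbox l b" if y: "sym_coords \<iota> y \<in> A" for y
  proof -
    define x where "x = sym_coords \<iota> y"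
    have xd: "x \<in> symdisc" and xs: "1 - Re (x $ i0 $ i0) \<le> s" using y by (auto simp: A_def x_def)
    have sx: "symm x $ i $ j = (if i = j then y $ i $ i else (if \<iota> i < \<iota> j then y $ i $ j else y $ j $ i) / of_real (sqrt 2))" for i j
      unfolding x_def by (rule symm_sym_coords[OF \<iota>])
    have kx: "skewm x $ i $ j = (if i = j then 0 else (if \<iota> i < \<iota> j then y $ j $ i else - y $ i $ j) / of_real (sqrt 2))" for i j
      unfolding x_def by (rule skewm_sym_coords[OF \<iota>])
    have x00: "x $ i0 $ i0 = y $ i0 $ i0" by (simp add: x_def sym_coords_def)
    define r where "r = Re (y $ i0 $ i0)"
    have y00: "cmod (y $ i0 $ i0) \<le> 1" using symm_entry_le(2)[OF xd, of i0 i0] by (simp add: sx)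
    have r: "1 - s \<le> r" "r \<le> 1" "- 1 \<le> r" using xs ReIm[OF y00] by (simp_all add: x00 r_def)
    have r2: "1 - r\<^sup>2 \<le> 2 * s"
    proof -
      have "1 - r\<^sup>2 = (1 - r) * (1 + r)" by (simp add: power2_eq_square algebra_simps)
      also have "\<dots> \<le> s * 2" using r s by (intro mult_mono) auto
      finally show ?thesis by simp
    qed
    have im: "\<bar>Im (y $ i0 $ i0)\<bar> \<le> sqrt (2 * s)"
    proof -
      have "(cmod (y $ i0 $ i0))\<^sup>2 \<le> 1\<^sup>2" using y00 by (intro power_mono) auto
      then have "(Im (y $ i0 $ i0))\<^sup>2 \<le> 1 - r\<^sup>2" by (simp add: cmod_power2 r_def)
      then show ?thesis using r2 by (intro real_le_rsqrt) auto
    qed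
    have row: "cmod (y $ i0 $ j) \<le> 2 * sqrt s" if "j \<noteq> i0" for j
    proof -
      \<comment> \<open>As \<open>i0\<close> comes first in the enumeration, the symmetric entry of
        the pair \<open>{i0, j}\<close> is stored in row \<open>i0\<close>.\<close>
      have lt: "\<iota> i0 < \<iota> j" using i0[of j] injD[OF \<iota>] that by (metis le_neq_implies_less)
      have "(\<Sum>k\<in>{i0, j}. (cmod (symm x $ k $ i0))\<^sup>2) \<le> (\<Sum>k\<in>UNIV. (cmod (symm x $ k $ i0))\<^sup>2)"
        by (intro sum_mono2) auto
      then have "(cmod (symm x $ i0 $ i0))\<^sup>2 + (cmod (symm x $ j $ i0))\<^sup>2 \<le> 1"
        using symm_entry_le(1)[OF xd, of i0] that by simp
      moreover have "r\<^sup>2 \<le> (cmod (symm x $ i0 $ i0))\<^sup>2" by (simp add: sx cmod_power2 r_def)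
      moreover have "symm x $ j $ i0 = y $ i0 $ j / of_real (sqrt 2)" using that lt by (simp add: sx)
      then have "(cmod (symm x $ j $ i0))\<^sup>2 = (cmod (y $ i0 $ j))\<^sup>2 / 2" by (simp add: norm_divide power_divide)
      ultimately have "(cmod (y $ i0 $ j))\<^sup>2 \<le> (2 * sqrt s)\<^sup>2" using r2 s by (simp add: power_mult_distrib)
      then show ?thesis by (rule power2_le_imp_le) (use s in auto)
    qed
    have other: "cmod (y $ i $ j) \<le> 2" for i j
    proof -
      have sq: "cmod w \<le> 2" if "cmod (w / of_real (sqrt 2)) \<le> 1" for w
      proof -
        have "cmod w \<le> sqrt 2" using that by (simp add: norm_divide)
        also have "sqrt 2 \<le> 2" by (rule real_le_lsqrt) auto
        finally show ?thesis .
      qed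
      show ?thesis
      proof (cases "i = j")
        case True
        then show ?thesis using symm_entry_le(2)[OF xd, of i i] by (simp add: sx)
      next
        case False
        then show ?thesis
          using symm_entry_le(2)[OF xd, of i j] symm_entry_le(3)[OF xd, of j i] injD[OF \<iota>, of i j]
          by (intro sq) (auto simp: sx kx norm_divide split: if_splits)
      qed
    qed
    show ?thesis
      unfolding mem_cbox_complex_matrix
    proof (intro allI)
      fix i j
      show "Re (l $ i $ j) \<le> Re (y $ i $ j) \<and> Re (y $ i $ j) \<le> Re (b $ i $ j) \<and> Im (l $ i $ j) \<le> Im (y $ i $ j) \<and> Im (y $ i $ j) \<le> Im (b $ i $ j)"
      proof (cases "i = i0")
        case True
        show ?thesis
        proof (cases "j = i0")
          case jt: True
          have "- sqrt (2 * s) \<le> Im (y $ i0 $ i0)" "Im (y $ i0 $ i0) \<le> sqrt (2 * s)" using im by linarith+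
          then show ?thesis using True jt r by (simp add: b_def l_def r_def)
        next
          case False
          then show ?thesis using True ReIm[OF row[OF False]] by (simp add: b_def l_def)
        qed
      next
        case False
        then show ?thesis using ReIm[OF other[of i j]] by (simp add: b_def l_def)
      qed
    qed
  qed
  have "emeasure lborel A = (\<integral>\<^sup>+x. indicator A x \<partial>lborel)" by simp
  also have "\<dots> = (\<integral>\<^sup>+y. indicator A (sym_coords \<iota> y) \<partial>lborel)"
    by (rule nn_integral_sym_coords[OF \<iota>, symmetric]) measurable
  also have "\<dots> \<le> (\<integral>\<^sup>+y. indicator (cbox l b) y \<partial>lborel)"
    by (intro nn_integral_mono) (auto simp: indicator_def box)
  also have "\<dots> = emeasure lborel (cbox l b)" by simp
  also have "\<dots> = ennreal (\<Prod>i\<in>UNIV. \<Prod>j\<in>UNIV. (Re (b $ i $ j) - Re (l $ i $ j)) * (Im (b $ i $ j) - Im (l $ i $ j)))"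
    by (rule emeasure_cbox_complex_matrix) (use s in \<open>auto simp: b_def l_def intro: order_trans[of _ 0]\<close>)
  also have "\<dots> \<le> ennreal (2 * sqrt 2 * 16 ^ (CARD('n) * CARD('n)) * (s ^ CARD('n) * sqrt s))"
  proof (rule ennreal_leI)
    define n where "n = CARD('n)"
    have n0: "n \<noteq> 0" by (simp add: n_def)
    have "(\<Prod>i\<in>UNIV. \<Prod>j\<in>UNIV. (Re (b $ i $ j) - Re (l $ i $ j)) * (Im (b $ i $ j) - Im (l $ i $ j)))
      = (\<Prod>j\<in>UNIV. (Re (b $ i0 $ j) - Re (l $ i0 $ j)) * (Im (b $ i0 $ j) - Im (l $ i0 $ j))) * (\<Prod>i\<in>UNIV - {i0}. \<Prod>j\<in>(UNIV :: 'n set). 16)"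
      by (subst prod.remove[of UNIV i0]) (auto simp: b_def l_def intro!: arg_cong2[of _ _ _ _ "(*)"] prod.cong)
    also have "(\<Prod>j\<in>UNIV. (Re (b $ i0 $ j) - Re (l $ i0 $ j)) * (Im (b $ i0 $ j) - Im (l $ i0 $ j)))
      = s * (2 * sqrt (2 * s)) * (\<Prod>j\<in>UNIV - {i0}. 16 * s)"
      by (subst prod.remove[of UNIV i0]) (use s in \<open>auto simp: b_def l_def intro!: arg_cong2[of _ _ _ _ "(*)"] prod.cong\<close>)
    also have "\<dots> * (\<Prod>i\<in>UNIV - {i0}. \<Prod>j\<in>(UNIV :: 'n set). 16) = 2 * sqrt 2 * 16 ^ (n - 1 + n * (n - 1)) * ((s * s ^ (n - 1)) * sqrt s)"
    proof -
      obtain k where k: "CARD('n) = Suc k" by (metis n0 n_def not0_implies_Suc)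
      show ?thesis
        by (simp add: n_def k card_Diff_singleton power_mult_distrib power_add power_mult real_sqrt_mult mult_ac)
    qed
    also have "s * s ^ (n - 1) = s ^ n" using n0 by (cases n) auto
    also have "2 * sqrt 2 * 16 ^ (n - 1 + n * (n - 1)) * (s ^ n * sqrt s) \<le> 2 * sqrt 2 * 16 ^ (n * n) * (s ^ n * sqrt s)"
    proof -
      have "n - 1 + n * (n - 1) \<le> n * n" using n0 by (cases n) auto
      then show ?thesis using s by (intro mult_right_mono mult_left_mono power_increasing) auto
    qed
    finally show "(\<Prod>i\<in>UNIV. \<Prod>j\<in>UNIV. (Re (b $ i $ j) - Re (l $ i $ j)) * (Im (b $ i $ j) - Im (l $ i $ j)))
      \<le> 2 * sqrt 2 * 16 ^ (CARD('n) * CARD('n)) * (s ^ CARD('n) * sqrt s)" by (simp add: n_def)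
  qed
  finally show ?thesis by (simp add: A_def)
qed

text \<open>Replaces a power by a sum of indicators, to which the slice estimate applies termwise.
  For \<open>a > 0\<close> a single term suffices; for \<open>a = 0\<close>, where nothing is
  assumed about \<open>K\<close>, all indicators are 1 and the sum is infinite.\<close>

lemma ennreal_power_le_dyadic_sum:
  fixes a :: real
  assumes "0 \<le> a" "a \<le> 2" "0 < a \<Longrightarrow> K \<le> ennreal (c / a ^ n)" "0 < c" "n > 0"
  shows "K \<le> (suminf (\<lambda>m. ennreal (c * (2 ^ m) ^ n) * indicator {b. b \<le> 2 * (1 / 2) ^ m} a))"
proof (cases "a = 0")
  case False
  then have a: "a > 0" using assms by simp
  \<comment> \<open>The dyadic scale of \<open>a\<close>:
    \<open>2^-m < a \<le> 2^(1-m)\<close>.\<close>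
  define m where "m = (LEAST m. 2 * (1 / 2) ^ Suc m < a)"
  have "\<exists>m. 2 * (1 / 2 :: real) ^ Suc m < a"
  proof -
    obtain k where "(1 / 2 :: real) ^ k < a" using real_arch_pow_inv[of a "1/2"] a by auto
    then show ?thesis by (intro exI[of _ k]) simp
  qed
  then have m: "2 * (1 / 2) ^ Suc m < a" unfolding m_def by (rule LeastI_ex)
  have le: "a \<le> 2 * (1 / 2) ^ m"
  proof (cases m)
    case (Suc k)
    then have "\<not> 2 * (1 / 2) ^ Suc k < a" unfolding m_def by (metis lessI not_less_Least)
    then show ?thesis by (simp only: Suc not_less)
  qed (use assms in simp)
  have "1 / a \<le> 2 ^ m" using m a by (simp add: field_simps power_one_over)
  then have "(1 / a) ^ n \<le> (2 ^ m) ^ n" using a by (intro power_mono) auto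
  then have "c / a ^ n \<le> c * (2 ^ m) ^ n" using assms(4) by (simp add: divide_inverse power_inverse mult_left_mono)
  then have "K \<le> ennreal (c * (2 ^ m) ^ n)" using assms(3)[OF a] by (meson ennreal_leI order_trans)
  also have "\<dots> = ennreal (c * (2 ^ m) ^ n) * indicator {b. b \<le> 2 * (1 / 2) ^ m} a" using le by simp
  also have "\<dots> \<le> suminf (\<lambda>m. ennreal (c * (2 ^ m) ^ n) * indicator {b. b \<le> 2 * (1 / 2) ^ m} a)"
  proof -
    have "f m \<le> suminf f" for f :: "nat \<Rightarrow> ennreal"
      using sum_le_suminf[of f "{m}"] by simp
    then show ?thesis .
  qed
  finally show ?thesis .
next
  case True
  have "(suminf (\<lambda>m. ennreal (c * (2 ^ m) ^ n))) = \<infinity>"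
  proof (rule ccontr)
    assume "(suminf (\<lambda>m. ennreal (c * (2 ^ m) ^ n))) \<noteq> \<infinity>"
    then have "summable (\<lambda>m. c * (2 ^ m) ^ n)"
      using assms(4) by (intro summable_suminf_not_top) (auto simp: infinity_ennreal_def)
    then have "(\<lambda>m. c * (2 ^ m) ^ n) \<longlonglongrightarrow> 0" by (rule summable_LIMSEQ_zero)
    then have "\<forall>\<^sub>F m in sequentially. c * (2 ^ m) ^ n < c" using assms(4) by (rule order_tendstoD(2))
    then obtain m where "c * (2 ^ m) ^ n < c" by (meson eventually_happens sequentially_bot)
    moreover have "c * 1 \<le> c * (2 ^ m) ^ n" using assms(4) by (intro mult_left_mono) auto
    ultimately show False by simp
  qed
  then show ?thesis using True by simp
qed

lemma inj_nat_with_min: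
  obtains \<iota> :: "'n::finite \<Rightarrow> nat" and i0 where "inj \<iota>" "\<And>j. \<iota> i0 \<le> \<iota> j"
proof -
  obtain \<iota> :: "'n \<Rightarrow> nat" where "inj \<iota>" using finite_imp_inj_to_nat_seg[of "UNIV :: 'n set"] by auto
  moreover obtain i0 where "\<And>j. \<iota> i0 \<le> \<iota> j" using ex_has_least_nat[of "\<lambda>_. True" undefined \<iota>] by auto
  ultimately show ?thesis using that by blast
qed

text \<open>With the integrals exchanged, a unitary congruence moves \<open>z\<close> to the axis
  \<open>i0\<close> and preserves both the disc and Lebesgue measure. Only the corner entry is left
  in the exponent, and the integral over \<open>z\<close> becomes \<open>(pi / a x)^n\<close>. On
  the slice of size \<open>s\<close> this is of order \<open>s^-n\<close> against a volume of order
  \<open>s^(n + 1/2)\<close>, so the dyadic sum is geometric with ratio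
  \<open>sqrt (1/2)\<close>.\<close>

lemma nn_integral_gauss_norm_symdisc:
  "(\<integral>\<^sup>+x. gauss_norm x * indicator symdisc (x :: complex^'n::finite^'n) \<partial>lborel) < \<infinity>"
proof -
  obtain \<iota> :: "'n \<Rightarrow> nat" and i0 where \<iota>: "inj \<iota>" and i0: "\<And>j. \<iota> i0 \<le> \<iota> j" using inj_nat_with_min by blast
  let ?n = "CARD('n)"
  define a where "a x = 1 - Re (x $ i0 $ i0)" for x :: "complex^'n^'n"
  have [measurable]: "a \<in> borel_measurable borel"
    unfolding a_def by (intro borel_measurable_continuous_onI continuous_intros)
  have "(\<integral>\<^sup>+x. gauss_norm x * indicator symdisc (x :: complex^'n^'n) \<partial>lborel)
      = (\<integral>\<^sup>+x. (\<integral>\<^sup>+z. ennreal (exp (Re (bilin x z) - (norm z)\<^sup>2)) * indicator symdisc x \<partial>lborel) \<partial>(lborel :: (complex^'n^'n) measure))"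
    unfolding gauss_norm_def by (intro nn_integral_cong nn_integral_multc[symmetric]) measurable
  also have "\<dots> = (\<integral>\<^sup>+z. (\<integral>\<^sup>+x. ennreal (exp (Re (bilin x z) - (norm z)\<^sup>2)) * indicator symdisc x \<partial>(lborel :: (complex^'n^'n) measure)) \<partial>lborel)"
    by (rule lborel_pair.Fubini') measurable
  also have "\<dots> = (\<integral>\<^sup>+z. (\<integral>\<^sup>+x. ennreal (exp (- a x * (norm (z :: complex^'n))\<^sup>2)) * indicator symdisc x \<partial>(lborel :: (complex^'n^'n) measure)) \<partial>lborel)"
  proof (rule nn_integral_cong)
    fix z :: "complex^'n"
    obtain w where w: "unitarym w" "w *v z = axis i0 (of_real (norm z))" using unitarym_to_axis by blast
    define u where "u = transpose w"
    have u: "unitarym u" "transpose u = w" using w(1) by (auto simp: u_def unitarym_transpose)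
    \<comment> \<open>The disc is preserved in both directions because the congruence by
      \<open>conjm w\<close> inverts the one by \<open>u\<close>.\<close>
    have ind: "indicator symdisc (u ** x ** transpose u) = (indicator symdisc x :: ennreal)" for x
    proof -
      have "x = conjm w ** (u ** x ** transpose u) ** transpose (conjm w)"
      proof -
        have "conjm w ** u = mat 1"
          using unitarym_conjm[OF w(1)] unitarym_right[OF unitarym_conjm[OF w(1)]] by (simp add: u_def)
        moreover have "w ** transpose (conjm w) = mat 1" by (rule unitarym_right[OF w(1)])
        ultimately have "conjm w ** u ** x ** (w ** transpose (conjm w)) = x" by simp
        then show ?thesis by (simp only: u(2) matrix_mul_assoc)
      qed
      then have "u ** x ** transpose u \<in> symdisc \<longleftrightarrow> x \<in> symdisc"
        using symdisc_congruence[OF u(1), of x] symdisc_congruence[OF unitarym_conjm[OF w(1)], of "u ** x ** transpose u"] by metis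
      then show ?thesis by (simp add: indicator_def)
    qed
    have b: "bilin (u ** x ** transpose u) z = (of_real (norm z))\<^sup>2 * x $ i0 $ i0" for x
    proof -
      have "bilin (u ** x ** transpose u) z = bilin x (axis i0 (of_real (norm z)))"
        using bilin_congruence[of w x z] by (simp add: u_def w(2))
      also have "\<dots> = (of_real (norm z))\<^sup>2 * x $ i0 $ i0"
      proof -
        have "(\<Sum>j\<in>UNIV. axis i0 (of_real (norm z)) $ i * x $ i $ j * axis i0 (of_real (norm z)) $ j)
          = (if i = i0 then (of_real (norm z))\<^sup>2 * x $ i0 $ i0 else 0)" for i
          by (cases "i = i0") (simp_all add: axis_def if_distrib power2_eq_square mult_ac cong: if_cong)
        then show ?thesis by (simp add: bilin_def)
      qed
      finally show ?thesis .
    qed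
    have "(\<integral>\<^sup>+x. ennreal (exp (Re (bilin x z) - (norm z)\<^sup>2)) * indicator symdisc x \<partial>lborel)
       = (\<integral>\<^sup>+x. ennreal (exp (Re (bilin (u ** x ** transpose u) z) - (norm z)\<^sup>2)) * indicator symdisc (u ** x ** transpose u) \<partial>lborel)"
      by (rule nn_integral_congruence[OF u(1), symmetric]) measurable
    also have "\<dots> = (\<integral>\<^sup>+x. ennreal (exp (- a x * (norm z)\<^sup>2)) * indicator symdisc x \<partial>lborel)"
      unfolding ind b by (intro nn_integral_cong) (simp add: a_def algebra_simps flip: of_real_power)
    finally show "(\<integral>\<^sup>+x. ennreal (exp (Re (bilin x z) - (norm z)\<^sup>2)) * indicator symdisc x \<partial>lborel) = \<dots>" .
  qed
  also have "\<dots> = (\<integral>\<^sup>+x. (\<integral>\<^sup>+z. ennreal (exp (- a x * (norm (z :: complex^'n))\<^sup>2)) * indicator symdisc x \<partial>lborel) \<partial>(lborel :: (complex^'n^'n) measure))"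
    by (rule lborel_pair.Fubini') measurable
  also have "\<dots> = (\<integral>\<^sup>+x. (\<integral>\<^sup>+z. ennreal (exp (- a x * (norm (z :: complex^'n))\<^sup>2)) \<partial>lborel) * indicator symdisc x \<partial>(lborel :: (complex^'n^'n) measure))"
    by (intro nn_integral_cong nn_integral_multc) measurable
  also have "\<dots> \<le> (\<integral>\<^sup>+x. (suminf (\<lambda>m. ennreal (pi ^ ?n * (2 ^ m) ^ ?n) * indicator {x \<in> symdisc. 1 - Re (x $ i0 $ i0) \<le> 2 * (1 / 2) ^ m} x)) \<partial>(lborel :: (complex^'n^'n) measure))"
  proof (rule nn_integral_mono)
    fix x :: "complex^'n^'n"
    show "(\<integral>\<^sup>+z. ennreal (exp (- a x * (norm (z :: complex^'n))\<^sup>2)) \<partial>lborel) * indicator symdisc x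
      \<le> (suminf (\<lambda>m. ennreal (pi ^ ?n * (2 ^ m) ^ ?n) * indicator {x \<in> symdisc. 1 - Re (x $ i0 $ i0) \<le> 2 * (1 / 2) ^ m} x))"
    proof (cases "x \<in> symdisc")
      case True
      have "cmod (x $ i0 $ i0) \<le> 1" using symm_entry_le(2)[OF True, of i0 i0] by (simp add: symm_def)
      then have a: "0 \<le> a x" "a x \<le> 2" using abs_Re_le_cmod[of "x $ i0 $ i0"] by (auto simp: a_def)
      have "(\<integral>\<^sup>+z. ennreal (exp (- a x * (norm (z :: complex^'n))\<^sup>2)) \<partial>lborel)
         \<le> (suminf (\<lambda>m. ennreal (pi ^ ?n * (2 ^ m) ^ ?n) * indicator {b. b \<le> 2 * (1 / 2) ^ m} (a x)))"
      proof (rule ennreal_power_le_dyadic_sum[OF a])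
        assume "0 < a x"
        then show "(\<integral>\<^sup>+z. ennreal (exp (- a x * (norm (z :: complex^'n))\<^sup>2)) \<partial>lborel) \<le> ennreal (pi ^ ?n / a x ^ ?n)"
          by (subst nn_integral_exp_norm_sq) (simp_all add: mult.commute[of _ 2] power_mult power_divide)
      qed auto
      then show ?thesis using True by (simp add: a_def indicator_def)
    qed simp
  qed
  also have "\<dots> = (suminf (\<lambda>m. ennreal (pi ^ ?n * (2 ^ m) ^ ?n) * emeasure lborel {x \<in> symdisc :: (complex^'n^'n) set. 1 - Re (x $ i0 $ i0) \<le> 2 * (1 / 2) ^ m}))"
  proof -
    have [measurable]: "{x \<in> symdisc :: (complex^'n^'n) set. 1 - Re (x $ i0 $ i0) \<le> c} \<in> sets borel" for c
    proof -
      have "{x \<in> symdisc :: (complex^'n^'n) set. 1 - Re (x $ i0 $ i0) \<le> c} = symdisc \<inter> {x. 1 - Re (x $ i0 $ i0) \<le> c}" by auto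
      moreover have "closed (symdisc \<inter> {x :: complex^'n^'n. 1 - Re (x $ i0 $ i0) \<le> c})"
        by (intro closed_Int closed_symdisc closed_Collect_le continuous_intros)
      ultimately show ?thesis by (simp only: borel_closed)
    qed
    show ?thesis
      by (subst nn_integral_suminf, measurable) (simp add: nn_integral_cmult_indicator)
  qed
  also have "\<dots> \<le> (suminf (\<lambda>m. ennreal (pi ^ ?n * (2 * sqrt 2 * 16 ^ (?n * ?n)) * 2 ^ ?n * sqrt 2 * sqrt (1 / 2) ^ m)))"
  proof (rule suminf_le)
    fix m :: nat
    define s :: real where "s = 2 * (1 / 2) ^ m"
    have s: "0 < s" "s \<le> 2" by (auto simp: s_def power_le_one)
    have "ennreal (pi ^ ?n * (2 ^ m) ^ ?n) * emeasure lborel {x \<in> symdisc :: (complex^'n^'n) set. 1 - Re (x $ i0 $ i0) \<le> s}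
      \<le> ennreal (pi ^ ?n * (2 ^ m) ^ ?n) * ennreal (2 * sqrt 2 * 16 ^ (?n * ?n) * (s ^ ?n * sqrt s))"
      by (intro mult_left_mono emeasure_symdisc_slice[OF \<iota> i0 s]) simp
    also have "\<dots> = ennreal (pi ^ ?n * (2 ^ m) ^ ?n * (2 * sqrt 2 * 16 ^ (?n * ?n) * (s ^ ?n * sqrt s)))"
      using s by (subst ennreal_mult) auto
    also have "pi ^ ?n * (2 ^ m) ^ ?n * (2 * sqrt 2 * 16 ^ (?n * ?n) * (s ^ ?n * sqrt s))
       = pi ^ ?n * (2 * sqrt 2 * 16 ^ (?n * ?n)) * ((2 ^ m) ^ ?n * s ^ ?n) * sqrt s" by (simp only: mult_ac)
    also have "(2 ^ m) ^ ?n * s ^ ?n = 2 ^ ?n"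
      unfolding power_mult_distrib[symmetric] by (simp add: s_def power_one_over)
    also have "sqrt s = sqrt 2 * sqrt (1 / 2) ^ m" by (simp add: s_def real_sqrt_mult real_sqrt_power)
    finally show "ennreal (pi ^ ?n * (2 ^ m) ^ ?n) * emeasure lborel {x \<in> symdisc :: (complex^'n^'n) set. 1 - Re (x $ i0 $ i0) \<le> 2 * (1 / 2) ^ m}
      \<le> ennreal (pi ^ ?n * (2 * sqrt 2 * 16 ^ (?n * ?n)) * 2 ^ ?n * sqrt 2 * sqrt (1 / 2) ^ m)"
      by (simp only: s_def mult.assoc)
  qed auto
  also have "\<dots> < \<infinity>"
  proof -
    have "sqrt (1 / 2) < 1" by simp
    then have "summable (\<lambda>m. pi ^ ?n * (2 * sqrt 2 * 16 ^ (?n * ?n)) * 2 ^ ?n * sqrt 2 * sqrt (1 / 2) ^ m)"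
      by (intro summable_mult summable_geometric) auto
    then show ?thesis by (subst suminf_ennreal2) auto
  qed
  finally show ?thesis .
qed

section \<open>Integrability on the metaplectic group\<close>

lemma haar_measure_space:
  assumes "haar_measure m M" shows "space M = Mp" "A \<in> sets borel \<Longrightarrow> A \<subseteq> Mp \<Longrightarrow> A \<in> sets M"
  "f \<in> borel_measurable (restrict_space borel Mp) \<Longrightarrow> f \<in> borel_measurable M"
proof -
  have s: "sets M = sets (restrict_space borel Mp)" using assms by (simp add: haar_measure_def)
  show "space M = Mp" using sets_eq_imp_space_eq[OF s] by (simp add: space_restrict_space)
  show "A \<in> sets M" if "A \<in> sets borel" "A \<subseteq> Mp"
    using that borel_closed[OF closed_Mp] by (auto simp: s sets_restrict_space)
  show "f \<in> borel_measurable (restrict_space borel Mp) \<Longrightarrow> f \<in> borel_measurable M"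
    using measurable_cong_sets[OF s refl] by blast
qed

theorem nn_integral_haar_finite:
  fixes m :: "'n::finite mpair \<Rightarrow> 'n mpair \<Rightarrow> 'n mpair" and M :: "'n mpair measure"
  assumes law: "metaplectic_law m" and haar: "haar_measure m M"
  shows "(\<integral>\<^sup>+y. ennreal (cmod (fst y) ^ (2 * (2 * CARD('n) + 1))) \<partial>M) < \<infinity>"
proof -
  note spM = haar_measure_space[OF haar]
  have finK: "emeasure M K < \<infinity>" if "compact K" "K \<subseteq> Mp" for K
    using haar that by (simp add: haar_measure_def)
  define K where "K R = {y \<in> Mp :: 'n mpair set. norm (snd y) \<le> R}" for R
  have K: "compact (K R)" "K R \<subseteq> Mp" "K R \<in> sets M" for R
    using compact_Mp_norm_le[of R] by (auto simp: K_def intro!: spM(2) borel_compact)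
  interpret M: sigma_finite_measure M
  proof
    \<comment> \<open>Exhaustion by compact sets makes \<open>M\<close> sigma-finite, as Fubini's
      theorem requires.\<close>
    have "\<Union> (range (\<lambda>k. K (real k))) = Mp"
      using real_arch_simple by (auto simp: K_def)
    then show "\<exists>A. countable A \<and> A \<subseteq> sets M \<and> \<Union> A = space M \<and> (\<forall>a\<in>A. emeasure M a \<noteq> \<infinity>)"
      using K finK[OF K(1,2)] by (intro exI[of _ "range (\<lambda>k. K (real k))"]) (auto simp: spM(1) less_top)
  qed
  interpret P: pair_sigma_finite M "lborel :: (complex^'n^'n) measure" ..
  define k where "k y x = (indicator {x. near (snd y) x} x :: ennreal)" for y :: "'n mpair" and x :: "complex^'n^'n"
  have id: "(\<lambda>y. y) \<in> M \<rightarrow>\<^sub>M borel"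
    by (rule spM(3)) (intro measurable_restrict_space1 measurable_ident_sets refl)
  have k[measurable]: "(\<lambda>p. k (fst p) (snd p)) \<in> borel_measurable (M \<Otimes>\<^sub>M borel)"
  proof -
    have "(\<lambda>p. (fst p, snd p)) \<in> M \<Otimes>\<^sub>M borel \<rightarrow>\<^sub>M (borel :: ('n mpair \<times> (complex^'n^'n)) measure)"
    proof -
      have "(\<lambda>p. (fst p, snd p)) \<in> M \<Otimes>\<^sub>M borel \<rightarrow>\<^sub>M (borel :: 'n mpair measure) \<Otimes>\<^sub>M (borel :: (complex^'n^'n) measure)"
        by (intro measurable_Pair measurable_compose[OF measurable_fst id] measurable_snd)
      then show ?thesis unfolding borel_prod .
    qed
    moreover have "(indicator {p :: 'n mpair \<times> (complex^'n^'n). near (snd (fst p)) (snd p)} :: _ \<Rightarrow> ennreal) \<in> borel_measurable borel"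
      by (intro borel_measurable_indicator borel_closed closed_near)
    ultimately have "(\<lambda>p. indicator {p :: 'n mpair \<times> (complex^'n^'n). near (snd (fst p)) (snd p)} (fst p, snd p) :: ennreal) \<in> borel_measurable (M \<Otimes>\<^sub>M borel)"
      by (rule measurable_compose)
    moreover have "(\<lambda>p. indicator {p :: 'n mpair \<times> (complex^'n^'n). near (snd (fst p)) (snd p)} (fst p, snd p) :: ennreal) = (\<lambda>p. k (fst p) (snd p))"
      by (simp add: fun_eq_iff k_def indicator_def)
    ultimately show ?thesis by simp
  qed
  define T where "T x = (\<integral>\<^sup>+y. k y x \<partial>M)" for x
  define R where "R = 16 * (real CARD('n)) ^ 3"
  have T: "T x \<le> emeasure M (K R)" for x
  proof -
    define Z where "Z = {y \<in> Mp :: 'n mpair set. near (snd y) x}"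
    have near_set: "{y :: 'n mpair. near (snd y) x} \<in> sets borel" for x
    proof -
      have "closed ((\<lambda>y. (y, x)) -` {p :: 'n mpair \<times> (complex^'n^'n). near (snd (fst p)) (snd p)})"
        by (intro continuous_closed_vimage closed_near continuous_intros)
      then show ?thesis by (intro borel_closed) (simp add: vimage_def)
    qed
    have ZM: "Z \<in> sets M"
    proof (rule spM(2))
      have "Z = Mp \<inter> {y. near (snd y) x}" by (auto simp: Z_def)
      then show "Z \<in> sets borel" using near_set borel_closed[OF closed_Mp] by auto
    qed (auto simp: Z_def)
    have "T x = (\<integral>\<^sup>+y. indicator Z y \<partial>M)"
      unfolding T_def by (intro nn_integral_cong) (auto simp: k_def Z_def spM(1) indicator_def)
    then have TZ: "T x = emeasure M Z" using ZM by simp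
    show ?thesis
    proof (cases "Z = {}")
      case False
      then obtain y0 where y0: "y0 \<in> Mp" "near (snd y0) x" by (auto simp: Z_def)
      let ?G = "\<lparr>carrier = Mp, monoid.mult = m, one = (1, mat 1)\<rparr>"
      have grp: "group ?G" and snd_m: "\<And>x y. x \<in> Mp \<Longrightarrow> y \<in> Mp \<Longrightarrow> snd (m x y) = snd x ** snd y"
        using law by (auto simp: metaplectic_law_def)
      \<comment> \<open>The translate of \<open>Z\<close> by the inverse of \<open>y0\<close>. With
        \<open>y0\<close> as base point, \<open>near_bounded\<close> puts it into one compact set
        for all \<open>x\<close>, and left invariance carries the bound back to
        \<open>Z\<close>.\<close>
      define Y where "Y = {y \<in> Mp. near (snd y0 ** snd y) x}"
      have "Y \<subseteq> K R"
        unfolding Y_def K_def R_def using near_bounded[OF Mp_D(1)[OF y0(1)] Mp_D(1) y0(2)] by auto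
      have "Y \<in> sets M"
      proof (rule spM(2))
        have "closed ((\<lambda>y :: 'n mpair. ((1 :: complex, snd y0 ** snd y), x)) -` {p :: 'n mpair \<times> (complex^'n^'n). near (snd (fst p)) (snd p)})"
        proof (intro continuous_closed_vimage closed_near continuous_intros)
          fix y :: "'n mpair"
          have "linear (\<lambda>h :: 'n symat. snd y0 ** h)"
            by (rule linearI) (simp_all add: vec_eq_iff matrix_matrix_mult_def sum.distrib distrib_left sum_distrib_left mult_ac)
          then have "continuous_on UNIV (\<lambda>h :: 'n symat. snd y0 ** h)"
            by (intro linear_continuous_on) (simp add: linear_conv_bounded_linear)
          then show "isCont (\<lambda>y. snd y0 ** snd y) y"
            by (intro continuous_within_compose3[where g = "\<lambda>h. snd y0 ** h" and f = snd]) (auto simp: continuous_on_eq_continuous_at intro!: continuous_intros)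
        qed
        then have "closed {y :: 'n mpair. near (snd y0 ** snd y) x}" by (simp add: vimage_def)
        then have "{y :: 'n mpair. near (snd y0 ** snd y) x} \<in> sets borel" by (rule borel_closed)
        moreover have "Y = Mp \<inter> {y. near (snd y0 ** snd y) x}" by (auto simp: Y_def)
        ultimately show "Y \<in> sets borel" using borel_closed[OF closed_Mp] by auto
      qed (auto simp: Y_def)
      have "Z = m y0 ` Y"
      proof (intro equalityI subsetI)
        fix y assume y: "y \<in> Z"
        then have yM: "y \<in> Mp" by (simp add: Z_def)
        define y' where "y' = m (inv\<^bsub>?G\<^esub> y0) y"
        have "y' \<in> carrier ?G"
          using group.inv_closed[OF grp, of y0] monoid.m_closed[OF group.is_monoid[OF grp], of "inv\<^bsub>?G\<^esub> y0" y] y0 yM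
          by (simp add: y'_def)
        then have y'M: "y' \<in> Mp" by simp
        have "y0 \<otimes>\<^bsub>?G\<^esub> (inv\<^bsub>?G\<^esub> y0 \<otimes>\<^bsub>?G\<^esub> y) = y"
        proof -
          have car: "y0 \<in> carrier ?G" "y \<in> carrier ?G" using y0 yM by simp_all
          have "y0 \<otimes>\<^bsub>?G\<^esub> (inv\<^bsub>?G\<^esub> y0 \<otimes>\<^bsub>?G\<^esub> y) = y0 \<otimes>\<^bsub>?G\<^esub> inv\<^bsub>?G\<^esub> y0 \<otimes>\<^bsub>?G\<^esub> y"
            by (rule monoid.m_assoc[OF group.is_monoid[OF grp] car(1) group.inv_closed[OF grp car(1)] car(2), symmetric])
          also have "\<dots> = y"
            unfolding group.r_inv[OF grp car(1)] by (rule monoid.l_one[OF group.is_monoid[OF grp] car(2)])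
          finally show ?thesis .
        qed
        then have my: "m y0 y' = y" by (simp add: y'_def)
        then have "y' \<in> Y" using y y'M snd_m[OF y0(1) y'M] by (auto simp: Y_def Z_def)
        then show "y \<in> m y0 ` Y" using my by force
      next
        fix y assume "y \<in> m y0 ` Y"
        then obtain y' where y': "y' \<in> Y" "y = m y0 y'" by auto
        then have "y \<in> Mp" using monoid.m_closed[OF group.is_monoid[OF grp], of y0 y'] y0 by (simp add: Y_def)
        then show "y \<in> Z" using y' snd_m[OF y0(1), of y'] by (auto simp: Y_def Z_def)
      qed
      then have "emeasure M Z = emeasure M Y"
        using haar y0(1) \<open>Y \<in> sets M\<close> by (simp add: haar_measure_def)
      also have "\<dots> \<le> emeasure M (K R)" using \<open>Y \<subseteq> K R\<close> K(3) by (rule emeasure_mono)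
      finally show ?thesis by (simp add: TZ)
    qed (simp add: TZ)
  qed
  obtain \<iota> :: "'n \<Rightarrow> nat" and i0 :: 'n where \<iota>: "inj \<iota>" using inj_nat_with_min by blast
  define c where "c = exp (- (2 * real CARD('n) + 1)) * 4 ^ CARD('n) * (1 / (8 * (real CARD('n))\<^sup>2)) ^ (2 * CARD('n) * CARD('n))"
  have c: "c > 0" by (auto simp: c_def)
  define F where "F x = gauss_norm x * indicator symdisc x" for x :: "complex^'n^'n"
  have [measurable]: "F \<in> borel_measurable borel" unfolding F_def by measurable
  have lower: "ennreal c * ennreal (cmod (fst y) ^ (2 * (2 * CARD('n) + 1))) \<le> (\<integral>\<^sup>+x. F x * k y x \<partial>lborel)" if y: "y \<in> Mp" for y
  proof -
    have d0: "cmod (det (cpart (snd y))) > 0" using cmod_det_cpart[OF Mp_D(1)[OF y]] by linarith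
    have "(cmod (fst y))\<^sup>2 * cmod (det (cpart (snd y))) = 1"
      using Mp_D(2)[OF y] by (metis norm_mult norm_one norm_power)
    then have "(cmod (fst y))\<^sup>2 = 1 / cmod (det (cpart (snd y)))" using d0 by (simp add: field_simps)
    then have "cmod (fst y) ^ (2 * (2 * CARD('n) + 1)) = 1 / cmod (det (cpart (snd y))) ^ (2 * CARD('n) + 1)"
      by (simp only: power_mult power_one_over)
    then have "ennreal c * ennreal (cmod (fst y) ^ (2 * (2 * CARD('n) + 1))) = ennreal (c / cmod (det (cpart (snd y))) ^ (2 * CARD('n) + 1))"
      using c by (subst ennreal_mult[symmetric]) auto
    also have "\<dots> \<le> (\<integral>\<^sup>+x. gauss_norm x * (indicator {x. near (snd y) x} x * indicator symdisc x) \<partial>lborel)"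
      unfolding c_def by (rule near_lower_bound[OF Mp_D(1)[OF y] \<iota>])
    also have "\<dots> = (\<integral>\<^sup>+x. F x * k y x \<partial>lborel)" by (simp add: F_def k_def mult_ac)
    finally show ?thesis .
  qed
  have "(\<lambda>y. ennreal (cmod (fst y) ^ (2 * (2 * CARD('n) + 1)))) \<in> borel_measurable M"
    by (intro spM(3) measurable_compose[OF _ measurable_ennreal] borel_measurable_continuous_on_restrict continuous_intros)
  then have "ennreal c * (\<integral>\<^sup>+y. ennreal (cmod (fst y) ^ (2 * (2 * CARD('n) + 1))) \<partial>M)
     = (\<integral>\<^sup>+y. ennreal c * ennreal (cmod (fst y) ^ (2 * (2 * CARD('n) + 1))) \<partial>M)"
    by (rule nn_integral_cmult[symmetric])
  also have "\<dots> \<le> (\<integral>\<^sup>+y. (\<integral>\<^sup>+x. F x * k y x \<partial>lborel) \<partial>M)"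
    by (intro nn_integral_mono lower) (simp add: spM(1))
  also have "\<dots> = (\<integral>\<^sup>+x. (\<integral>\<^sup>+y. F x * k y x \<partial>M) \<partial>lborel)"
  proof (rule P.Fubini'[symmetric])
    show "(\<lambda>(y, x). F x * k y x) \<in> borel_measurable (M \<Otimes>\<^sub>M lborel)"
      using k by (simp add: split_beta)
  qed
  also have "\<dots> = (\<integral>\<^sup>+x. F x * T x \<partial>lborel)"
  proof (rule nn_integral_cong)
    fix x :: "complex^'n^'n"
    have "(\<lambda>y. k y x) \<in> borel_measurable M"
      using measurable_compose[OF measurable_Pair2' k, of x] by simp
    then show "(\<integral>\<^sup>+y. F x * k y x \<partial>M) = F x * T x" unfolding T_def by (rule nn_integral_cmult)
  qed
  also have "\<dots> \<le> (\<integral>\<^sup>+x. F x * emeasure M (K R) \<partial>lborel)"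
    by (intro nn_integral_mono mult_left_mono T) auto
  also have "\<dots> = (\<integral>\<^sup>+x. F x \<partial>lborel) * emeasure M (K R)"
    by (rule nn_integral_multc) measurable
  also have "\<dots> < \<infinity>"
    using nn_integral_gauss_norm_symdisc[where 'n = 'n] finK[OF K(1,2)] by (simp add: F_def ennreal_mult_less_top)
  finally show ?thesis using c by (auto simp: ennreal_mult_less_top)
qed

section \<open>Assembly of the orthonormal basis\<close>

section \<open>Orthonormal bases of closures\<close>

text \<open>A filter covers both notions of equality in use: almost everywhere, and on
  \<open>Mp\<close> through the principal filter.\<close>

lemma cspan_eventually:
  assumes "f \<in> cspan A" "\<And>a. a \<in> A \<Longrightarrow> \<exists>b\<in>cspan B. eventually (\<lambda>x. a x = b x) F"
  shows "\<exists>g\<in>cspan B. eventually (\<lambda>x. f x = g x) F"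
  using assms(1)
proof (induction rule: cspan_induct)
  case (base c h)
  obtain b where "b \<in> cspan B" "eventually (\<lambda>x. h x = b x) F" using assms(2)[OF base] by blast
  then show ?case by (intro bexI[of _ "\<lambda>x. c * b x"] cspan_cmult) (auto elim: eventually_mono)
next
  case zero
  show ?case by (intro bexI[of _ "\<lambda>x. 0"] cspan_zero) simp
next
  case (add f g)
  obtain f' where f': "f' \<in> cspan B" "eventually (\<lambda>x. f x = f' x) F" using add(1) by blast
  obtain g' where g': "g' \<in> cspan B" "eventually (\<lambda>x. g x = g' x) F" using add(2) by blast
  from f'(2) g'(2) have "eventually (\<lambda>x. f x + g x = f' x + g' x) F" by eventually_elim simp
  with f'(1) g'(1) show ?case by (intro bexI[of _ "\<lambda>x. f' x + g' x"] cspan_add)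
qed

lemma cspan_cnj:
  assumes "f \<in> cspan S" shows "(\<lambda>x. cnj (f x)) \<in> cspan ((\<lambda>h x. cnj (h x)) ` S)"
  using assms
proof (induction rule: cspan_induct)
  case (base c h)
  have "(\<lambda>x. cnj c * cnj (h x)) \<in> cspan ((\<lambda>h x. cnj (h x)) ` S)"
    by (intro cspan_cmult cspan_base imageI base)
  then show ?case by simp
qed (auto intro: cspan_add cspan_zero)

lemma L2_cong: "(\<And>x. x \<in> space M \<Longrightarrow> f x = g x) \<Longrightarrow> f \<in> L2 M \<longleftrightarrow> g \<in> L2 M"
  unfolding L2_def by (simp cong: measurable_cong Bochner_Integration.integrable_cong)

lemma L2_inner_cong:
  "(\<And>x. x \<in> space M \<Longrightarrow> f x = f' x) \<Longrightarrow> (\<And>x. x \<in> space M \<Longrightarrow> g x = g' x) \<Longrightarrow> L2_inner M f g = L2_inner M f' g'"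
  unfolding L2_inner_def by (intro Bochner_Integration.integral_cong) auto

lemma L2_closure_mono_AE:
  assumes "\<And>h. h \<in> A \<Longrightarrow> \<exists>k\<in>B. AE x in M. h x = k x"
  shows "L2_closure M A \<subseteq> L2_closure M B"
proof
  fix f assume f: "f \<in> L2_closure M A"
  have "\<exists>k\<in>B. (\<integral>\<^sup>+x. ennreal ((norm (f x - k x))\<^sup>2) \<partial>M) < ennreal e" if "e > 0" for e
  proof -
    obtain h where h: "h \<in> A" "(\<integral>\<^sup>+x. ennreal ((norm (f x - h x))\<^sup>2) \<partial>M) < ennreal e"
      using f \<open>e > 0\<close> by (auto simp: L2_closure_def)
    obtain k where k: "k \<in> B" "AE x in M. h x = k x" using assms[OF h(1)] by blast
    have "(\<integral>\<^sup>+x. ennreal ((norm (f x - k x))\<^sup>2) \<partial>M) = (\<integral>\<^sup>+x. ennreal ((norm (f x - h x))\<^sup>2) \<partial>M)"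
      by (intro nn_integral_cong_AE) (use k(2) in eventually_elim, simp)
    with h(2) k(1) show ?thesis by (intro bexI[of _ k]) simp_all
  qed
  then show "f \<in> L2_closure M B" using f by (auto simp: L2_closure_def)
qed

lemma L2_closure_memI:
  assumes "f \<in> L2 M" "h \<in> W" "\<And>x. x \<in> space M \<Longrightarrow> f x = h x"
  shows "f \<in> L2_closure M W"
proof -
  have "(\<integral>\<^sup>+x. ennreal ((norm (f x - h x))\<^sup>2) \<partial>M) = 0"
    using assms(3) by (subst nn_integral_cong[where v = "\<lambda>_. 0"]) auto
  then show ?thesis using assms(1,2) by (auto simp: L2_closure_def intro!: bexI[of _ h])
qed

text \<open>Separates the Hilbert space argument from tensors: \<open>S\<close> is a countable
  spanning family, \<open>W\<close> the space to be closed, \<open>V\<close> a set of labels and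
  \<open>F\<close> assigns functions to labels. Agreement is asked for on \<open>space M\<close>
  only, as \<open>F b\<close> and the elements of \<open>W\<close> are uncontrolled
  elsewhere.\<close>

lemma orthonormal_basis_exists:
  assumes S: "countable S" "S \<noteq> {}" "S \<subseteq> L2 M"
    and WS: "\<And>f. f \<in> W \<Longrightarrow> \<exists>g\<in>cspan S. \<forall>x\<in>space M. f x = g x"
    and SW: "\<And>g. g \<in> cspan S \<Longrightarrow> \<exists>f\<in>W. \<forall>x\<in>space M. g x = f x"
    and SV: "\<And>g. g \<in> cspan S \<Longrightarrow> \<exists>b\<in>V. \<forall>x\<in>space M. F b x = g x"
  shows "\<exists>B\<subseteq>V. orthonormal_basis M F B (L2_closure M W) \<and> (\<forall>b\<in>B. \<exists>g\<in>cspan S. \<forall>x\<in>space M. F b x = g x)"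
proof -
  define s where "s = from_nat_into S"
  have s: "range s = S" unfolding s_def by (rule range_from_nat_into[OF S(2,1)])
  then have "s k \<in> cspan S" for k by (intro cspan_base) auto
  from gram_schmidt[of S M s, OF S(3) this] obtain E where E: "E \<subseteq> cspan S" "orthonormal_set M E"
    "\<forall>k. \<exists>h\<in>cspan E. (\<integral>\<^sup>+x. ennreal ((norm (s k x - h x))\<^sup>2) \<partial>M) = 0" by (elim exE conjE)
  have SL: "g \<in> L2 M" if "g \<in> cspan S" for g by (rule L2_cspan[OF S(3) that])
  have EL: "e \<in> L2 M" if "e \<in> E" for e using that E(1) SL by blast
  have SE: "\<exists>h\<in>cspan E. AE x in M. a x = h x" if a: "a \<in> S" for a
  proof -
    obtain k where k: "a = s k" using a unfolding s[symmetric] by auto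
    obtain h where h: "h \<in> cspan E" "(\<integral>\<^sup>+x. ennreal ((norm (a x - h x))\<^sup>2) \<partial>M) = 0" using E(3) unfolding k by (elim allE[of _ k] bexE)
    have [measurable]: "a \<in> borel_measurable M" "h \<in> borel_measurable M"
      using a S(3) L2_cspan[OF _ h(1)] EL by (auto intro: L2_measurable)
    have "AE x in M. ennreal ((norm (a x - h x))\<^sup>2) = 0" using h(2) by (subst nn_integral_0_iff_AE[symmetric]) auto
    then have "AE x in M. a x = h x" by eventually_elim simp
    with h(1) show ?thesis by blast
  qed
  have "\<exists>b. b \<in> V \<and> (\<forall>x\<in>space M. F b x = e x)" if "e \<in> E" for e using SV[of e] E(1) that by blast
  then obtain \<beta> where \<beta>: "\<And>e. e \<in> E \<Longrightarrow> \<beta> e \<in> V" "\<And>e x. e \<in> E \<Longrightarrow> x \<in> space M \<Longrightarrow> F (\<beta> e) x = e x" by metis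
  have FL: "F (\<beta> e) \<in> L2 M" if "e \<in> E" for e
    using L2_cong[of M "F (\<beta> e)" e] \<beta>(2)[OF that] EL[OF that] by blast
  have inner: "L2_inner M (F (\<beta> e)) (F (\<beta> e')) = (if e = e' then 1 else 0)" if "e \<in> E" "e' \<in> E" for e e'
    using L2_inner_cong[of M "F (\<beta> e)" e "F (\<beta> e')" e'] \<beta>(2) that E(2) by (simp add: orthonormal_set_def)
  \<comment> \<open>Distinct basis functions get distinct labels, because the inner products 0 and 1
    tell them apart; so indexing by labels keeps orthonormality.\<close>
  have inj: "\<beta> e = \<beta> e' \<longleftrightarrow> e = e'" if "e \<in> E" "e' \<in> E" for e e'
    using inner[OF that] inner[OF that(1,1)] by (metis zero_neq_one)
  have "orthonormal_basis M F (\<beta> ` E) (L2_closure M W)"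
    unfolding orthonormal_basis_def
  proof (intro conjI ballI)
    show "F ` \<beta> ` E \<subseteq> L2_closure M W"
    proof clarify
      fix e assume e: "e \<in> E"
      obtain f where "f \<in> W" "\<forall>x\<in>space M. e x = f x" using SW[of e] E(1) e by blast
      then show "F (\<beta> e) \<in> L2_closure M W" using \<beta>(2)[OF e] by (intro L2_closure_memI[OF FL[OF e]]) auto
    qed
    show "L2_inner M (F b) (F b') = (if b = b' then 1 else 0)" if "b \<in> \<beta> ` E" "b' \<in> \<beta> ` E" for b b'
      using that by (auto simp: inner inj)
    show "L2_closure M (cspan (F ` \<beta> ` E)) = L2_closure M W"
    proof (intro equalityI L2_closure_mono_AE)
      fix h assume "h \<in> cspan (F ` \<beta> ` E)"
      then have "\<exists>g\<in>cspan E. AE x in M. h x = g x"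
      proof (rule cspan_eventually)
        fix f assume "f \<in> F ` \<beta> ` E"
        then obtain e where e: "f = F (\<beta> e)" "e \<in> E" by blast
        then show "\<exists>g\<in>cspan E. AE x in M. f x = g x"
          by (intro bexI[of _ e] cspan_base AE_I2) (auto simp: \<beta>(2))
      qed
      then obtain g where g: "g \<in> cspan E" "AE x in M. h x = g x" by blast
      have "\<exists>k\<in>cspan S. AE x in M. g x = k x"
        using g(1)
      proof (rule cspan_eventually)
        fix e assume "e \<in> E"
        then show "\<exists>k\<in>cspan S. AE x in M. e x = k x" using E(1) by (intro bexI[of _ e]) auto
      qed
      then obtain k where k: "k \<in> cspan S" "AE x in M. g x = k x" by blast
      obtain f where f: "f \<in> W" "\<forall>x\<in>space M. k x = f x" using SW[OF k(1)] by blast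
      from f(2) have "AE x in M. k x = f x" by (intro AE_I2) simp
      with g(2) k(2) have "AE x in M. h x = f x" by eventually_elim simp
      with f(1) show "\<exists>k\<in>W. AE x in M. h x = k x" by blast
    next
      fix h assume "h \<in> W"
      then obtain g where g: "g \<in> cspan S" "\<forall>x\<in>space M. h x = g x" using WS by blast
      obtain k where k: "k \<in> cspan E" "AE x in M. g x = k x" using cspan_eventually[OF g(1) SE] by blast
      have "\<exists>l\<in>cspan (F ` \<beta> ` E). AE x in M. k x = l x"
        using k(1)
      proof (rule cspan_eventually)
        fix e assume "e \<in> E"
        then show "\<exists>l\<in>cspan (F ` \<beta> ` E). AE x in M. e x = l x"
          by (intro bexI[of _ "F (\<beta> e)"] cspan_base AE_I2) (auto simp: \<beta>(2))
      qed
      then obtain l where l: "l \<in> cspan (F ` \<beta> ` E)" "AE x in M. k x = l x" by blast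
      from g(2) have "AE x in M. h x = g x" by (intro AE_I2) simp
      with k(2) l(2) have "AE x in M. h x = l x" by eventually_elim simp
      with l(1) show "\<exists>k\<in>cspan (F ` \<beta> ` E). AE x in M. h x = k x" by blast
    qed
  qed
  moreover have "\<forall>b\<in>\<beta> ` E. \<exists>g\<in>cspan S. \<forall>x\<in>space M. F b x = g x" using \<beta>(2) E(1) by blast
  moreover have "\<beta> ` E \<subseteq> V" using \<beta>(1) by auto
  ultimately show ?thesis by blast
qed

section \<open>The span of the matrix coefficients\<close>

definition mono_coeffs :: "nat \<Rightarrow> nat \<Rightarrow> ('n::finite mpair \<Rightarrow> complex) set" where
  "mono_coeffs p N = {tuple_coeff p N (\<lambda>k. mono_fun (\<alpha> k)) (\<lambda>k. mono_fun (\<beta> k)) |\<alpha> \<beta>. True}"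

lemma polys_mono_fun: "mono_fun \<alpha> \<in> polys"
  using polys_mono[of 1 \<alpha>] by simp

lemma tuple_coeff_cong:
  "(\<And>k. k < N \<Longrightarrow> u k = u' k) \<Longrightarrow> (\<And>k. k < N \<Longrightarrow> v k = v' k) \<Longrightarrow> tuple_coeff p N u v = tuple_coeff p N u' v'"
  unfolding tuple_coeff_def by (intro ext prod.cong) auto

text \<open>Only the exponents at \<open>k < N\<close> matter, so the index functions may be taken
  from a finite product of countable sets.\<close>

lemma countable_mono_coeffs: "countable (mono_coeffs p N :: ('n::finite mpair \<Rightarrow> complex) set)"
proof -
  let ?A = "PiE {..<N} (\<lambda>_. UNIV :: ('n \<Rightarrow> nat) set)"
  let ?f = "\<lambda>(\<alpha>, \<beta>). tuple_coeff p N (\<lambda>k. mono_fun (\<alpha> k)) (\<lambda>k. mono_fun (\<beta> k))"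
  have "mono_coeffs p N \<subseteq> ?f ` (?A \<times> ?A)"
  proof
    fix f :: "'n mpair \<Rightarrow> complex" assume "f \<in> mono_coeffs p N"
    then obtain \<alpha> \<beta> where f: "f = tuple_coeff p N (\<lambda>k. mono_fun (\<alpha> k)) (\<lambda>k. mono_fun (\<beta> k))" by (auto simp: mono_coeffs_def)
    have eq: "f = ?f (restrict \<alpha> {..<N}, restrict \<beta> {..<N})" unfolding f by (auto intro!: tuple_coeff_cong)
    have A: "restrict \<alpha> {..<N} \<in> ?A" for \<alpha> by (simp only: restrict_PiE_iff) simp
    show "f \<in> ?f ` (?A \<times> ?A)" by (rule image_eqI[of f ?f, OF eq SigmaI[OF A A]])
  qed
  moreover have "countable ?A" by (intro countable_PiE) auto
  ultimately show ?thesis by (meson countable_SIGMA countable_image countable_subset)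
qed

lemma osc_coeff_linear:
  assumes "f \<in> polys" "g \<in> polys" "h \<in> polys"
  shows "osc_coeff (\<lambda>z. f z + g z) h x = osc_coeff f h x + osc_coeff g h x"
    "osc_coeff h (\<lambda>z. f z + g z) x = osc_coeff h f x + osc_coeff h g x"
  using assms by (simp_all add: osc_coeff_def omega_add fock_inner_add fock_inner_add_polys omega_fock)

lemma osc_coeff_cmult:
  "osc_coeff (\<lambda>z. c * f z) h x = c * osc_coeff f h x"
  "osc_coeff f (\<lambda>z. c * h z) x = cnj c * osc_coeff f h x"
  by (simp_all add: osc_coeff_def omega_cmult fock_inner_cmult)

lemma osc_coeff_cspan:
  fixes f h :: "complex^'n::finite \<Rightarrow> complex"
  assumes f: "f \<in> polys" and h: "h \<in> polys"
  shows "osc_coeff f h \<in> cspan {osc_coeff (mono_fun \<alpha>) (mono_fun \<beta>) |\<alpha> \<beta>. True}" (is "_ \<in> cspan ?B")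
  using f
proof (induction rule: polys_induct)
  case (mono c \<alpha>)
  show ?case using h
  proof (induction rule: polys_induct)
    case (mono d \<beta>)
    have "osc_coeff (\<lambda>z. c * mono_fun \<alpha> z) (\<lambda>z. d * mono_fun \<beta> z) = (\<lambda>x. c * (cnj d * osc_coeff (mono_fun \<alpha>) (mono_fun \<beta>) x))"
      by (simp add: fun_eq_iff osc_coeff_cmult)
    then show ?case by (simp only:) (intro cspan_cmult cspan_base, blast)
  next
    case (add g g')
    have "osc_coeff (\<lambda>z. c * mono_fun \<alpha> z) (\<lambda>z. g z + g' z)
      = (\<lambda>x. osc_coeff (\<lambda>z. c * mono_fun \<alpha> z) g x + osc_coeff (\<lambda>z. c * mono_fun \<alpha> z) g' x)"
      by (simp add: fun_eq_iff osc_coeff_linear add polys_mono)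
    then show ?case by (simp only:) (intro cspan_add add)
  qed
next
  case (add g g')
  have "osc_coeff (\<lambda>z. g z + g' z) h = (\<lambda>x. osc_coeff g h x + osc_coeff g' h x)"
    by (simp add: fun_eq_iff osc_coeff_linear add h)
  then show ?case by (simp only:) (intro cspan_add add)
qed

lemma tuple_coeff_Suc:
  "tuple_coeff p (Suc N) u v x = tuple_coeff p N u v x * (if N < p then osc_coeff (u N) (v N) x else cnj (osc_coeff (u N) (v N) x))"
  by (simp add: tuple_coeff_def)

text \<open>Induction on the number of tensor factors: spans multiply, and a monomial coefficient of
  length \<open>N\<close> times one further factor is one of length \<open>Suc N\<close>. For a
  factor of index at least \<open>p\<close> the span is conjugated first.\<close>

lemma tuple_coeff_cspan:
  fixes u v :: "nat \<Rightarrow> complex^'n::finite \<Rightarrow> complex"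
  assumes "\<And>k. k < N \<Longrightarrow> u k \<in> polys" "\<And>k. k < N \<Longrightarrow> v k \<in> polys"
  shows "tuple_coeff p N u v \<in> cspan (mono_coeffs p N)"
  using assms
proof (induction N)
  case 0
  show ?case by (rule cspan_base) (auto simp: mono_coeffs_def tuple_coeff_def fun_eq_iff)
next
  case (Suc N)
  let ?c = "\<lambda>z. if N < p then z else cnj z"
  let ?B = "{\<lambda>x. ?c (osc_coeff (mono_fun \<alpha>) (mono_fun \<beta>) x) |(\<alpha> :: 'n \<Rightarrow> nat) (\<beta> :: 'n \<Rightarrow> nat). True}"
  have osc: "osc_coeff (u N) (v N) \<in> cspan {osc_coeff (mono_fun \<alpha>) (mono_fun \<beta>) |\<alpha> \<beta>. True}"
    by (intro osc_coeff_cspan Suc.prems) auto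
  note cnj = cspan_cnj[OF osc]
  have fac: "(\<lambda>x. ?c (osc_coeff (u N) (v N) x)) \<in> cspan ?B"
  proof (cases "N < p")
    case False
    then have B: "?B = (\<lambda>h x. cnj (h x)) ` {osc_coeff (mono_fun \<alpha>) (mono_fun \<beta>) |\<alpha> \<beta>. True}" by auto
    show ?thesis unfolding B using cnj False by simp
  qed (use osc in simp)
  have "(\<lambda>x. tuple_coeff p N u v x * ?c (osc_coeff (u N) (v N) x)) \<in> cspan (mono_coeffs p (Suc N))"
  proof (rule cspan_mult[OF Suc.IH fac])
    fix a b :: "'n mpair \<Rightarrow> complex" assume "a \<in> mono_coeffs p N" "b \<in> ?B"
    then obtain \<alpha> \<beta> :: "nat \<Rightarrow> 'n \<Rightarrow> nat" and \<alpha>' \<beta>' :: "'n \<Rightarrow> nat" where a: "a = tuple_coeff p N (\<lambda>k. mono_fun (\<alpha> k)) (\<lambda>k. mono_fun (\<beta> k))"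
      and b: "b = (\<lambda>x. ?c (osc_coeff (mono_fun \<alpha>') (mono_fun \<beta>') x))" by (auto simp: mono_coeffs_def)
    have "a = tuple_coeff p N (\<lambda>k. mono_fun ((\<alpha>(N := \<alpha>')) k)) (\<lambda>k. mono_fun ((\<beta>(N := \<beta>')) k))"
      unfolding a by (rule tuple_coeff_cong) auto
    then have "(\<lambda>x. a x * b x) = tuple_coeff p (Suc N) (\<lambda>k. mono_fun ((\<alpha>(N := \<alpha>')) k)) (\<lambda>k. mono_fun ((\<beta>(N := \<beta>')) k))"
      by (simp add: fun_eq_iff tuple_coeff_Suc b)
    then show "(\<lambda>x. a x * b x) \<in> cspan (mono_coeffs p (Suc N))"
      by (intro cspan_base) (auto simp: mono_coeffs_def)
  qed (use Suc.prems in auto)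
  then show ?case by (simp add: tuple_coeff_Suc[abs_def] if_distrib cong: if_cong)
qed

lemma free_coeff_cspan:
  fixes a b :: "(nat \<Rightarrow> complex^'n::finite \<Rightarrow> complex) \<Rightarrow>\<^sub>0 complex"
  assumes "a \<in> free_vecs {..<N} (factors p (fun_space polys))" "b \<in> free_vecs {..<N} (factors p (fun_space polys))"
  shows "free_coeff p N a b \<in> cspan (mono_coeffs p N)"
proof -
  have "free_coeff p N a b = (\<lambda>x. \<Sum>u\<in>Poly_Mapping.keys a. Poly_Mapping.lookup a u *
     (\<Sum>v\<in>Poly_Mapping.keys b. cnj (Poly_Mapping.lookup b v) * tuple_coeff p N u v x))"
    by (simp add: fun_eq_iff free_coeff_def lin_ext_def pm_sum_def)
  moreover have "u k \<in> polys" if "u \<in> Poly_Mapping.keys a \<union> Poly_Mapping.keys b" "k < N" for u k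
  proof -
    have "u \<in> tuples {..<N} (factors p (fun_space polys))" using that(1) assms by (auto simp: free_vecs_def)
    then show ?thesis using that(2) by (auto simp: tuples_def factors_simps)
  qed
  ultimately show ?thesis
    by (simp only:) (intro cspan_sum cspan_cmult tuple_coeff_cspan; auto)
qed

lemma tuple_coeff_bound:
  assumes "\<And>k. k < N \<Longrightarrow> u k \<in> polys" "\<And>k. k < N \<Longrightarrow> v k \<in> polys"
  shows "\<exists>C. \<forall>x\<in>Mp. cmod (tuple_coeff p N u v x) \<le> C * cmod (fst x) ^ N"
  using assms
proof (induction N)
  case 0
  show ?case by (intro exI[of _ 1]) (simp add: tuple_coeff_def)
next
  case (Suc N)
  obtain C where C: "\<forall>x\<in>Mp. cmod (tuple_coeff p N u v x) \<le> C * cmod (fst x) ^ N" using Suc by fastforce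
  obtain D where D: "\<And>x. x \<in> Mp \<Longrightarrow> cmod (fock_inner (omega x (u N)) (v N)) \<le> D * cmod (fst x)"
    using fock_inner_omega_bound[of "u N" "v N"] Suc.prems by blast
  have "cmod (tuple_coeff p (Suc N) u v x) \<le> (C * D) * cmod (fst x) ^ Suc N" if x: "x \<in> Mp" for x
  proof -
    have "cmod (tuple_coeff p (Suc N) u v x) = cmod (tuple_coeff p N u v x) * cmod (fock_inner (omega x (u N)) (v N))"
      using x by (simp add: tuple_coeff_Suc norm_mult osc_coeff_def)
    also have "\<dots> \<le> (C * cmod (fst x) ^ N) * (D * cmod (fst x))"
      using C D x by (intro mult_mono') auto
    finally show ?thesis by (simp add: mult_ac)
  qed
  then show ?case by blast
qed

lemma cspan_mono_coeffs_bound: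
  assumes "g \<in> cspan (mono_coeffs p N)"
  shows "\<exists>C. \<forall>x\<in>Mp. cmod (g x) \<le> C * cmod (fst x) ^ N"
  using assms
proof (induction rule: cspan_induct)
  case (base c h)
  then obtain \<alpha> \<beta> where h: "h = tuple_coeff p N (\<lambda>k. mono_fun (\<alpha> k)) (\<lambda>k. mono_fun (\<beta> k))" by (auto simp: mono_coeffs_def)
  have "\<exists>C. \<forall>x\<in>Mp. cmod (h x) \<le> C * cmod (fst x) ^ N"
    unfolding h by (rule tuple_coeff_bound) (rule polys_mono_fun)+
  then obtain C where C: "\<forall>x\<in>Mp. cmod (h x) \<le> C * cmod (fst x) ^ N" by blast
  then have "\<forall>x\<in>Mp. cmod (c * h x) \<le> (cmod c * C) * cmod (fst x) ^ N"
    by (auto simp: norm_mult mult.assoc intro!: mult_left_mono)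
  then show ?case by blast
next
  case zero
  show ?case by (intro exI[of _ 0]) simp
next
  case (add f g)
  then obtain C D where "\<forall>x\<in>Mp. cmod (f x) \<le> C * cmod (fst x) ^ N" "\<forall>x\<in>Mp. cmod (g x) \<le> D * cmod (fst x) ^ N" by blast
  then have "\<forall>x\<in>Mp. cmod (f x + g x) \<le> (C + D) * cmod (fst x) ^ N"
    by (auto simp: distrib_right intro!: order_trans[OF norm_triangle_ineq] add_mono)
  then show ?case by blast
qed

text \<open>The square of the pointwise bound is, up to a constant, the integrand of
  \<open>nn_integral_haar_finite\<close>.\<close>

lemma mono_coeffs_L2:
  fixes m :: "'n::finite mpair \<Rightarrow> 'n mpair \<Rightarrow> 'n mpair" and M :: "'n mpair measure"
  assumes law: "metaplectic_law m" and haar: "haar_measure m M"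
  shows "mono_coeffs p (2 * CARD('n) + 1) \<subseteq> L2 M"
proof
  let ?N = "2 * CARD('n) + 1"
  note M = haar_measure_space[OF haar]
  fix f :: "'n mpair \<Rightarrow> complex" assume f: "f \<in> mono_coeffs p ?N"
  have osc: "osc_coeff (mono_fun \<alpha>) (mono_fun \<beta>) \<in> borel_measurable M" for \<alpha> \<beta> :: "'n \<Rightarrow> nat"
  proof -
    have "(\<lambda>x. fock_inner (omega x (mono_fun \<alpha>)) (mono_fun \<beta>)) \<in> borel_measurable M"
      by (intro M(3) fock_inner_omega_measurable polys_mono_fun)
    then show ?thesis by (rule measurable_cong[THEN iffD1, rotated]) (simp add: osc_coeff_def M(1))
  qed
  have cnj: "(\<lambda>x. cnj (g x)) \<in> borel_measurable M" if "g \<in> borel_measurable M" for g :: "'n mpair \<Rightarrow> complex"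
    by (rule measurable_compose[OF that]) (intro borel_measurable_continuous_onI continuous_intros)
  have fM: "f \<in> borel_measurable M"
  proof -
    obtain \<alpha> \<beta> where f: "f = tuple_coeff p ?N (\<lambda>k. mono_fun (\<alpha> k)) (\<lambda>k. mono_fun (\<beta> k))" using f by (auto simp: mono_coeffs_def)
    have "(\<lambda>x. if k < p then osc_coeff (mono_fun (\<alpha> k)) (mono_fun (\<beta> k)) x
        else cnj (osc_coeff (mono_fun (\<alpha> k)) (mono_fun (\<beta> k)) x)) \<in> borel_measurable M" for k
      using osc cnj[OF osc] by (cases "k < p") auto
    then show ?thesis unfolding f tuple_coeff_def by (intro borel_measurable_prod)
  qed
  have pM: "(\<lambda>y. cmod (fst y) ^ (2 * ?N)) \<in> borel_measurable M"
    by (intro M(3) borel_measurable_continuous_on_restrict continuous_intros)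
  obtain C where C: "\<forall>x\<in>Mp. cmod (f x) \<le> C * cmod (fst x) ^ ?N"
    using cspan_mono_coeffs_bound[OF cspan_base[OF f]] by blast
  have "integrable M (\<lambda>x. (norm (f x))\<^sup>2)"
  proof (rule Bochner_Integration.integrable_bound)
    have "integrable M (\<lambda>y. cmod (fst y) ^ (2 * ?N))"
      using pM nn_integral_haar_finite[OF law haar] by (intro integrableI_bounded) auto
    then show "integrable M (\<lambda>y. C\<^sup>2 * cmod (fst y) ^ (2 * ?N))" by (rule Bochner_Integration.integrable_mult_right)
    show "(\<lambda>x. (norm (f x))\<^sup>2) \<in> borel_measurable M" using fM by measurable
    show "AE x in M. norm ((norm (f x))\<^sup>2) \<le> norm (C\<^sup>2 * cmod (fst x) ^ (2 * ?N))"
    proof (rule AE_I2)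
      fix x assume "x \<in> space M"
      then have "(cmod (f x))\<^sup>2 \<le> (C * cmod (fst x) ^ ?N)\<^sup>2" using C by (intro power_mono) (auto simp: M(1))
      then show "norm ((norm (f x))\<^sup>2) \<le> norm (C\<^sup>2 * cmod (fst x) ^ (2 * ?N))"
      proof -
        have "(C * cmod (fst x) ^ ?N)\<^sup>2 = C\<^sup>2 * cmod (fst x) ^ (2 * ?N)"
          by (simp only: power_mult_distrib power_mult[symmetric] mult.commute[of _ 2])
        moreover assume "(cmod (f x))\<^sup>2 \<le> (C * cmod (fst x) ^ ?N)\<^sup>2"
        ultimately show ?thesis by (metis abs_power2 real_norm_def)
      qed
    qed
  qed
  then show "f \<in> L2 M" using fM by (simp add: L2_def)
qed

text \<open>The restriction is there because \<open>tuples\<close> consists of extensional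
  functions.\<close>

lemma mono_tuple:
  "(\<lambda>k\<in>{..<N}. mono_fun (\<alpha> k)) \<in> tuples {..<N} (factors p (fun_space polys))"
  by (auto simp: tuples_def factors_simps polys_mono_fun)

lemma mono_coeff_tensors:
  fixes \<alpha> \<beta> :: "nat \<Rightarrow> 'n::finite \<Rightarrow> nat"
  obtains U V :: "'n tens" where "U \<in> vecs (polys_pq p q)" "V \<in> vecs (polys_pq p q)"
    "\<And>x. x \<in> Mp \<Longrightarrow> tuple_coeff p (p + q) (\<lambda>k. mono_fun (\<alpha> k)) (\<lambda>k. mono_fun (\<beta> k)) x = inner_pq p q (omega_pq p q x U) V"
proof -
  let ?u = "\<lambda>\<alpha>. Poly_Mapping.single (\<lambda>k\<in>{..<p + q}. mono_fun (\<alpha> k)) (1 :: complex) :: (nat \<Rightarrow> complex^'n \<Rightarrow> complex) \<Rightarrow>\<^sub>0 complex"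
  let ?cl = "tensor_class {..<p + q} (factors p (fun_space polys)) :: _ \<Rightarrow> 'n tens"
  have u: "?u \<alpha> \<in> free_vecs {..<p + q} (factors p (fun_space polys))" for \<alpha>
    by (intro free_vecs_single mono_tuple)
  show ?thesis
  proof (rule that)
    show "?cl (?u \<alpha>) \<in> vecs (polys_pq p q)" "?cl (?u \<beta>) \<in> vecs (polys_pq p q)"
      using u by (auto simp: polys_pq_def mixed_tensors_def vecs_tensor_space)
    show "tuple_coeff p (p + q) (\<lambda>k. mono_fun (\<alpha> k)) (\<lambda>k. mono_fun (\<beta> k)) x = inner_pq p q (omega_pq p q x (?cl (?u \<alpha>))) (?cl (?u \<beta>))"
      if "x \<in> Mp" for x
      unfolding inner_omega_class[OF that u u]
      by (simp add: free_coeff_def) (rule fun_cong[OF tuple_coeff_cong]; simp)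
  qed
qed

text \<open>One free vector \<open>a\<close> serves all \<open>x\<close> at once: it records the
  scalars of the linear combination, and only the functional applied to it varies with
  \<open>x\<close>.\<close>

lemma cspan_mono_coeffs_matcoeff:
  assumes "g \<in> cspan (mono_coeffs p (p + q))"
  shows "\<exists>b\<in>vecs (tensor2 (polys_pq p q) (conj_space (polys_pq p q))). \<forall>x\<in>Mp. matcoeff p q b x = g x"
proof -
  let ?V = "\<lambda>i. if i then conj_space (polys_pq p q) else polys_pq p q"
  let ?\<phi> = "\<lambda>x t. inner_pq p q (omega_pq p q x (t False)) (t True)"
  have "\<exists>a\<in>free_vecs UNIV ?V. \<forall>x\<in>Mp. g x = lin_ext (?\<phi> x) a"
    using assms
  proof (induction rule: cspan_induct)
    case (base c h)
    then obtain \<alpha> \<beta> where h: "h = tuple_coeff p (p + q) (\<lambda>k. mono_fun (\<alpha> k)) (\<lambda>k. mono_fun (\<beta> k))" by (auto simp: mono_coeffs_def)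
    obtain U V where UV: "U \<in> vecs (polys_pq p q)" "V \<in> vecs (polys_pq p q)"
      "\<And>x. x \<in> Mp \<Longrightarrow> h x = inner_pq p q (omega_pq p q x U) V"
      using mono_coeff_tensors[of p q \<alpha> \<beta>] unfolding h by blast
    have "(\<lambda>i. if i then V else U) \<in> tuples UNIV ?V" using UV(1,2) by (auto simp: tuples_def PiE_def Pi_def)
    then show ?case
      by (intro bexI[of _ "Poly_Mapping.single (\<lambda>i. if i then V else U) c"] free_vecs_single) (auto simp: UV(3))
  next
    case zero
    show ?case by (intro bexI[of _ 0] free_vecs_zero) simp
  next
    case (add f g)
    then obtain a b where "a \<in> free_vecs UNIV ?V" "b \<in> free_vecs UNIV ?V"
      "\<forall>x\<in>Mp. f x = lin_ext (?\<phi> x) a" "\<forall>x\<in>Mp. g x = lin_ext (?\<phi> x) b" by blast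
    then show ?case by (intro bexI[of _ "a + b"] free_vecs_add) (auto simp: lin_ext_add)
  qed
  then obtain a where a: "a \<in> free_vecs UNIV ?V" "\<forall>x\<in>Mp. g x = lin_ext (?\<phi> x) a" by blast
  have "matcoeff p q (tensor_class UNIV ?V a) x = g x" if "x \<in> Mp" for x
    unfolding matcoeff_def tensor_lift_class[OF multilinear_inner_omega[OF that] a(1)] using a(2) that by simp
  then show ?thesis
    using a(1) by (intro bexI[of _ "tensor_class UNIV ?V a"]) (auto simp: tensor2_def vecs_tensor_space)
qed

text \<open>Equality is claimed on \<open>Mp\<close> alone, since the functions in
  \<open>coeff_span\<close> have uncontrolled values elsewhere.\<close>

lemma coeff_span_imp_mono_coeffs:
  fixes f :: "'n::finite mpair \<Rightarrow> complex"
  assumes "f \<in> coeff_span p q"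
  shows "\<exists>g\<in>cspan (mono_coeffs p (p + q)). \<forall>x\<in>Mp. f x = g x"
proof -
  let ?T = "{\<lambda>x. inner_pq p q (omega_pq p q x u) v | u v. u \<in> vecs (polys_pq p q) \<and> v \<in> vecs (polys_pq p q)}
    :: ('n mpair \<Rightarrow> complex) set"
  have "f \<in> cspan ?T" using assms by (simp add: coeff_span_def)
  then have "\<exists>g\<in>cspan (mono_coeffs p (p + q)). eventually (\<lambda>x. f x = g x) (principal Mp)"
  proof (rule cspan_eventually)
    fix h assume "h \<in> ?T"
    then obtain a b where h: "h = (\<lambda>x. inner_pq p q (omega_pq p q x (tensor_class {..<p + q} (factors p (fun_space polys)) a)) (tensor_class {..<p + q} (factors p (fun_space polys)) b))"
      and ab: "a \<in> free_vecs {..<p + q} (factors p (fun_space polys))" "b \<in> free_vecs {..<p + q} (factors p (fun_space polys))"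
      by (auto simp: polys_pq_def mixed_tensors_def vecs_tensor_space)
    show "\<exists>g\<in>cspan (mono_coeffs p (p + q)). eventually (\<lambda>x. h x = g x) (principal Mp)"
      by (rule bexI[OF _ free_coeff_cspan[OF ab]]) (simp add: eventually_principal h inner_omega_class[OF _ ab])
  qed
  then show "\<exists>g\<in>cspan (mono_coeffs p (p + q)). \<forall>x\<in>Mp. f x = g x" by (simp only: eventually_principal)
qed

lemma mono_coeffs_imp_coeff_span:
  fixes g :: "'n::finite mpair \<Rightarrow> complex"
  assumes "g \<in> cspan (mono_coeffs p (p + q))"
  shows "\<exists>f\<in>coeff_span p q. \<forall>x\<in>Mp. g x = f x"
proof -
  have "\<exists>f\<in>coeff_span p q. eventually (\<lambda>x. g x = f x) (principal Mp)"
    unfolding coeff_span_def using assms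
  proof (rule cspan_eventually)
    fix h :: "'n mpair \<Rightarrow> complex" assume "h \<in> mono_coeffs p (p + q)"
    then obtain \<alpha> \<beta> where h: "h = tuple_coeff p (p + q) (\<lambda>k. mono_fun (\<alpha> k)) (\<lambda>k. mono_fun (\<beta> k))" by (auto simp: mono_coeffs_def)
    obtain U V where UV: "U \<in> vecs (polys_pq p q)" "V \<in> vecs (polys_pq p q)"
      "\<And>x. x \<in> Mp \<Longrightarrow> h x = inner_pq p q (omega_pq p q x U) V"
      using mono_coeff_tensors[of p q \<alpha> \<beta>] unfolding h by blast
    show "\<exists>f\<in>cspan {\<lambda>x. inner_pq p q (omega_pq p q x u) v | u v. u \<in> vecs (polys_pq p q) \<and> v \<in> vecs (polys_pq p q)}.
        eventually (\<lambda>x. h x = f x) (principal Mp)"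
      by (rule bexI[of _ "\<lambda>x. inner_pq p q (omega_pq p q x U) V"], simp add: eventually_principal UV(3))
        (rule cspan_base, use UV(1,2) in blast)
  qed
  then show "\<exists>f\<in>coeff_span p q. \<forall>x\<in>Mp. g x = f x" by (simp only: eventually_principal)
qed

theorem corollary4p1:
  fixes m :: "'n::finite mpair \<Rightarrow> 'n mpair \<Rightarrow> 'n mpair"
    and M :: "'n mpair measure"
    and p :: nat
  assumes "metaplectic_law m"
    and "haar_measure m M"
    and "p \<le> 2 * CARD('n) + 1"
  defines "q \<equiv> 2 * CARD('n) + 1 - p"
  shows "coeff_span p q \<subseteq> L2 M \<and>
    (\<exists>B. B \<subseteq> vecs (tensor2 (polys_pq p q) (conj_space (polys_pq p q))) \<and>
         orthonormal_basis M (matcoeff p q) B (L2_closure M (coeff_span p q)) \<and>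
         (\<forall>b\<in>B. \<exists>C::real. \<forall>x\<in>Mp. cmod (matcoeff p q b x) \<le> C * cmod (fst x) ^ (2 * CARD('n) + 1)))"
proof -
  let ?S = "mono_coeffs p (p + q) :: ('n mpair \<Rightarrow> complex) set"
  \<comment> \<open>The truncated subtraction in \<open>q\<close> is exact because \<open>p\<close>
    is at most \<open>2n + 1\<close>.\<close>
  have pq: "p + q = 2 * CARD('n) + 1" using assms(3) by (simp add: q_def)
  have space: "space M = Mp" by (rule haar_measure_space(1)[OF assms(2)])
  have SL: "?S \<subseteq> L2 M" unfolding pq by (rule mono_coeffs_L2[OF assms(1,2)])
  have "coeff_span p q \<subseteq> L2 M"
  proof
    fix f :: "'n mpair \<Rightarrow> complex" assume "f \<in> coeff_span p q"
    then obtain g where "g \<in> cspan ?S" "\<forall>x\<in>Mp. f x = g x" using coeff_span_imp_mono_coeffs by blast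
    then show "f \<in> L2 M" using L2_cspan[OF SL] L2_cong[of M f g] space by blast
  qed
  moreover have "\<exists>B\<subseteq>vecs (tensor2 (polys_pq p q) (conj_space (polys_pq p q))).
      orthonormal_basis M (matcoeff p q) B (L2_closure M (coeff_span p q)) \<and>
      (\<forall>b\<in>B. \<exists>g\<in>cspan ?S. \<forall>x\<in>space M. matcoeff p q b x = g x)"
  proof (rule orthonormal_basis_exists[OF countable_mono_coeffs _ SL])
    show "?S \<noteq> {}" by (auto simp: mono_coeffs_def)
  qed (unfold space, (erule coeff_span_imp_mono_coeffs mono_coeffs_imp_coeff_span cspan_mono_coeffs_matcoeff)+)
  then obtain B where B: "B \<subseteq> vecs (tensor2 (polys_pq p q) (conj_space (polys_pq p q)))"
    "orthonormal_basis M (matcoeff p q) B (L2_closure M (coeff_span p q))"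
    "\<forall>b\<in>B. \<exists>g\<in>cspan ?S. \<forall>x\<in>Mp. matcoeff p q b x = g x" unfolding space by blast
  have "\<exists>C::real. \<forall>x\<in>Mp. cmod (matcoeff p q b x) \<le> C * cmod (fst x) ^ (2 * CARD('n) + 1)" if b: "b \<in> B" for b
  proof -
    obtain g where g: "g \<in> cspan ?S" "\<forall>x\<in>Mp. matcoeff p q b x = g x" using B(3) b by blast
    from cspan_mono_coeffs_bound[OF g(1)] show ?thesis unfolding pq using g(2) by simp
  qed
  ultimately show ?thesis using B(1,2) by blast
qed

end
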